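(* Let $(R,\mathfrak{m},k)$ be a commutative Noetherian local ring, and let $I$ be an integrally closed $\mathfrak{m}$-primary ideal of $R$. Then $I$, regarded as an $R$-module, has maximal complexity and maximal curvature, i.e., $$\operatorname{cx}_R(I)=\operatorname{cx}_R(k)\quad\text{and}\quad \operatorname{curv}_R(I)=\operatorname{curv}_R(k).$$
   Context: All modules are finitely generated. For an $R$-module $M$, the $n$th Betti number is $\beta_n^R(M)=\operatorname{rank}_k(\operatorname{Ext}_R^n(M,k))$. The complexity $\operatorname{cx}_R(M)$ is the smallest non-negative integer $b$ such that there exists a real number $\alpha>0$ with $\beta_n^R(M)\le \alpha n^{b-1}$ for all $n\gg 0$; if no such $b$ exists, $\operatorname{cx}_R(M):=\infty$. The curvature is $\operatorname{curv}_R(M):=\limsup_{n\to\infty}\sqrt[n]{\beta_n^R(M)}$ (the reciprocal of the radius of convergence of $\sum_{n\ge 0}\beta_n^R(M)t^n$). An $R$-module $M$ is said to have maximal complexity (resp., maximal curvature) if $\operatorname{cx}_R(M)=\operatorname{cx}_R(k)$ (resp., $\operatorname{curv}_R(M)=\operatorname{curv}_R(k)$). *)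

theory Defs
  imports
    "Jordan_Normal_Form.Missing_VectorSpace"
    "HOL-Algebra.Ring_Divisibility"
    "HOL-Algebra.QuotRing"
    "HOL-Algebra.Ideal_Product"
    "HOL-Library.Extended_Nat"
    "HOL-Library.Extended_Real"
begin

locale noetherian_local_ring = cring R + noetherian_ring R for R (structure) +
  fixes \<mm> :: "'a set"
  assumes maximal_ideal: "maximalideal \<mm> R"
    and unique_maximal_ideal: "maximalideal J R \<Longrightarrow> J = \<mm>"

definition radical_ideal :: "('a, 'b) ring_scheme \<Rightarrow> 'a set \<Rightarrow> 'a set" where
  "radical_ideal R I = {x \<in> carrier R. \<exists>n::nat. n > 0 \<and> x [^]\<^bsub>R\<^esub> n \<in> I}"

definition primary_ideal :: "('a, 'b) ring_scheme \<Rightarrow> 'a set \<Rightarrow> bool" where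
  "primary_ideal R I \<longleftrightarrow> ideal I R \<and> I \<noteq> carrier R \<and>
     (\<forall>x\<in>carrier R. \<forall>y\<in>carrier R. x \<otimes>\<^bsub>R\<^esub> y \<in> I \<longrightarrow> x \<in> I \<or> y \<in> radical_ideal R I)"

definition primary_to :: "('a, 'b) ring_scheme \<Rightarrow> 'a set \<Rightarrow> 'a set \<Rightarrow> bool" where
  "primary_to R P I \<longleftrightarrow> primary_ideal R I \<and> radical_ideal R I = P"

text \<open>The power \<open>I\<^sup>i\<close> is taken in the monoid of ideals; in particular \<open>I\<^sup>0 = R\<close>.\<close>

definition integral_over_ideal :: "('a, 'b) ring_scheme \<Rightarrow> 'a set \<Rightarrow> 'a \<Rightarrow> bool" where
  "integral_over_ideal R I r \<longleftrightarrow> r \<in> carrier R \<and>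
     (\<exists>n::nat. n > 0 \<and> (\<exists>a. (\<forall>i\<in>{1..n}. a i \<in> I [^]\<^bsub>ideals_set R\<^esub> i) \<and>
        r [^]\<^bsub>R\<^esub> n \<oplus>\<^bsub>R\<^esub> (\<Oplus>\<^bsub>R\<^esub>i\<in>{1..n}. a i \<otimes>\<^bsub>R\<^esub> r [^]\<^bsub>R\<^esub> (n - i)) = \<zero>\<^bsub>R\<^esub>))"

definition integrally_closed_ideal :: "('a, 'b) ring_scheme \<Rightarrow> 'a set \<Rightarrow> bool" where
  "integrally_closed_ideal R I \<longleftrightarrow> ideal I R \<and> {r. integral_over_ideal R I r} = I"

text \<open>
  The fields \<open>mult\<close> and \<open>one\<close> of a module record play no role in the
  locale of modules; below they are filled with arbitrary values.
\<close>

definition regular_module :: "('a, 'b) ring_scheme \<Rightarrow> ('a, 'a) module" where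
  "regular_module R = \<lparr>carrier = carrier R, monoid.mult = monoid.mult R, one = one R,
     zero = zero R, add = add R, smult = monoid.mult R\<rparr>"

definition ideal_module :: "('a, 'b) ring_scheme \<Rightarrow> 'a set \<Rightarrow> ('a, 'a) module" where
  "ideal_module R I = (regular_module R)\<lparr>carrier := I\<rparr>"

definition quotient_module :: "('a, 'm, 'c) module_scheme \<Rightarrow> 'm set \<Rightarrow> ('a, 'm set) module" where
  "quotient_module M N = \<lparr>carrier = a_rcosets\<^bsub>M\<^esub> N, monoid.mult = (\<lambda>X Y. N), one = N,
     zero = N, add = set_add M,
     smult = (\<lambda>r X. \<Union>x\<in>X. N +>\<^bsub>M\<^esub> (r \<odot>\<^bsub>M\<^esub> x))\<rparr>"

text \<open>Homomorphisms are made extensional so that they are determined by their values on the carrier.\<close>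

definition hom_module ::
  "('a, 'b) ring_scheme \<Rightarrow> ('a, 'm, 'c) module_scheme \<Rightarrow> ('a, 'n, 'd) module_scheme \<Rightarrow>
   ('a, 'm \<Rightarrow> 'n) module" where
  "hom_module R M N = \<lparr>carrier = LinearCombinations.module_hom R M N \<inter> extensional (carrier M),
     monoid.mult = (\<lambda>f g. \<lambda>x\<in>carrier M. \<zero>\<^bsub>N\<^esub>),
     one = (\<lambda>x\<in>carrier M. \<zero>\<^bsub>N\<^esub>),
     zero = (\<lambda>x\<in>carrier M. \<zero>\<^bsub>N\<^esub>),
     add = (\<lambda>f g. \<lambda>x\<in>carrier M. f x \<oplus>\<^bsub>N\<^esub> g x),
     smult = (\<lambda>r f. \<lambda>x\<in>carrier M. r \<odot>\<^bsub>N\<^esub> f x)\<rparr>"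

abbreviation free_module :: "('a, 'b) ring_scheme \<Rightarrow> nat \<Rightarrow> ('a, nat \<Rightarrow> 'a) module" where
  "free_module R n \<equiv> ring.func_space R {..<n}"

text \<open>
  A resolution \<open>\<cdots> \<rightarrow> R\<^bsup>b 2\<^esup> \<rightarrow> R\<^bsup>b 1\<^esup> \<rightarrow> R\<^bsup>b 0\<^esup> \<rightarrow> M \<rightarrow> 0\<close> by free modules of finite
  rank, with differentials \<open>d n : R\<^bsup>b (n+1)\<^esup> \<rightarrow> R\<^bsup>b n\<^esup>\<close> and augmentation \<open>e\<close>. It exists
  for every finitely generated module over a Noetherian ring.
\<close>

definition free_resolution ::
  "('a, 'b) ring_scheme \<Rightarrow> ('a, 'm, 'c) module_scheme \<Rightarrow> (nat \<Rightarrow> nat) \<Rightarrow>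
   (nat \<Rightarrow> (nat \<Rightarrow> 'a) \<Rightarrow> (nat \<Rightarrow> 'a)) \<Rightarrow> ((nat \<Rightarrow> 'a) \<Rightarrow> 'm) \<Rightarrow> bool" where
  "free_resolution R M b d e \<longleftrightarrow>
     e \<in> LinearCombinations.module_hom R (free_module R (b 0)) M \<and>
     (\<forall>n. d n \<in> LinearCombinations.module_hom R (free_module R (b (Suc n))) (free_module R (b n))) \<and>
     e ` carrier (free_module R (b 0)) = carrier M \<and>
     d 0 ` carrier (free_module R (b 1)) =
       {x \<in> carrier (free_module R (b 0)). e x = \<zero>\<^bsub>M\<^esub>} \<and>
     (\<forall>n. d (Suc n) ` carrier (free_module R (b (Suc (Suc n)))) =
       {x \<in> carrier (free_module R (b (Suc n))). d n x = \<zero>\<^bsub>free_module R (b n)\<^esub>})"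

definition cochain_module ::
  "('a, 'b) ring_scheme \<Rightarrow> (nat \<Rightarrow> nat) \<Rightarrow> ('a, 'n, 'c) module_scheme \<Rightarrow> nat \<Rightarrow>
   ('a, (nat \<Rightarrow> 'a) \<Rightarrow> 'n) module" where
  "cochain_module R b N n = hom_module R (free_module R (b n)) N"

definition coboundary_map ::
  "('a, 'b) ring_scheme \<Rightarrow> (nat \<Rightarrow> nat) \<Rightarrow> (nat \<Rightarrow> (nat \<Rightarrow> 'a) \<Rightarrow> (nat \<Rightarrow> 'a)) \<Rightarrow> nat \<Rightarrow>
   ((nat \<Rightarrow> 'a) \<Rightarrow> 'n) \<Rightarrow> ((nat \<Rightarrow> 'a) \<Rightarrow> 'n)" where
  "coboundary_map R b d n f = (\<lambda>x\<in>carrier (free_module R (b (Suc n))). f (d n x))"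

definition cocycles ::
  "('a, 'b) ring_scheme \<Rightarrow> (nat \<Rightarrow> nat) \<Rightarrow> (nat \<Rightarrow> (nat \<Rightarrow> 'a) \<Rightarrow> (nat \<Rightarrow> 'a)) \<Rightarrow>
   ('a, 'n, 'c) module_scheme \<Rightarrow> nat \<Rightarrow> ((nat \<Rightarrow> 'a) \<Rightarrow> 'n) set" where
  "cocycles R b d N n = {f \<in> carrier (cochain_module R b N n).
     coboundary_map R b d n f = \<zero>\<^bsub>cochain_module R b N (Suc n)\<^esub>}"

fun coboundaries ::
  "('a, 'b) ring_scheme \<Rightarrow> (nat \<Rightarrow> nat) \<Rightarrow> (nat \<Rightarrow> (nat \<Rightarrow> 'a) \<Rightarrow> (nat \<Rightarrow> 'a)) \<Rightarrow>
   ('a, 'n, 'c) module_scheme \<Rightarrow> nat \<Rightarrow> ((nat \<Rightarrow> 'a) \<Rightarrow> 'n) set" where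
  "coboundaries R b d N 0 = {\<zero>\<^bsub>cochain_module R b N 0\<^esub>}"
| "coboundaries R b d N (Suc n) = coboundary_map R b d n ` carrier (cochain_module R b N n)"

definition hom_cohomology ::
  "('a, 'b) ring_scheme \<Rightarrow> (nat \<Rightarrow> nat) \<Rightarrow> (nat \<Rightarrow> (nat \<Rightarrow> 'a) \<Rightarrow> (nat \<Rightarrow> 'a)) \<Rightarrow>
   ('a, 'n, 'c) module_scheme \<Rightarrow> nat \<Rightarrow> ('a, ((nat \<Rightarrow> 'a) \<Rightarrow> 'n) set) module" where
  "hom_cohomology R b d N n =
     quotient_module ((cochain_module R b N n)\<lparr>carrier := cocycles R b d N n\<rparr>)
       (coboundaries R b d N n)"

text \<open>
  \<open>Ext\<^sup>n\<^sub>R(M,N) = H\<^sup>n(Hom\<^sub>R(F,N))\<close> for a chosen resolution \<open>F\<close> of a finitely generated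
  module \<open>M\<close> over a Noetherian ring; up to isomorphism it does not depend on the choice.
\<close>

definition Ext_module ::
  "('a, 'b) ring_scheme \<Rightarrow> ('a, 'm, 'c) module_scheme \<Rightarrow> ('a, 'n, 'd) module_scheme \<Rightarrow> nat \<Rightarrow>
   ('a, ((nat \<Rightarrow> 'a) \<Rightarrow> 'n) set) module" where
  "Ext_module R M N n =
     (let (b, d) = (SOME (b, d). \<exists>e. free_resolution R M b d e) in hom_cohomology R b d N n)"

definition residue_module :: "('a, 'b) ring_scheme \<Rightarrow> 'a set \<Rightarrow> ('a, 'a set) module" where
  "residue_module R \<mm> = quotient_module (regular_module R) \<mm>"

text \<open>
  An \<open>R\<close>-module \<open>V\<close> with \<open>\<mm>V = 0\<close> viewed as a vector space over \<open>R/\<mm>\<close>: the scalar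
  \<open>X \<in> R/\<mm>\<close> acts through any of its representatives.
\<close>

definition residue_space :: "('a, 'v, 'c) module_scheme \<Rightarrow> ('a set, 'v) module" where
  "residue_space V = \<lparr>carrier = carrier V, monoid.mult = monoid.mult V, one = one V,
     zero = zero V, add = add V, smult = (\<lambda>X v. (SOME r. r \<in> X) \<odot>\<^bsub>V\<^esub> v)\<rparr>"

definition betti ::
  "('a, 'b) ring_scheme \<Rightarrow> 'a set \<Rightarrow> ('a, 'm, 'c) module_scheme \<Rightarrow> nat \<Rightarrow> nat" where
  "betti R \<mm> M n =
     vectorspace.dim (R Quot \<mm>) (residue_space (Ext_module R M (residue_module R \<mm>) n))"

text \<open>The infimum over \<^typ>\<open>enat\<close> is \<open>\<infinity>\<close> if there is no admissible exponent.\<close>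

definition complexity ::
  "('a, 'b) ring_scheme \<Rightarrow> 'a set \<Rightarrow> ('a, 'm, 'c) module_scheme \<Rightarrow> enat" where
  "complexity R \<mm> M = Inf {enat b | b. \<exists>\<alpha>::real. \<alpha> > 0 \<and>
     (\<forall>\<^sub>F n in sequentially. real (betti R \<mm> M n) \<le> \<alpha> * real n powi (int b - 1))}"

definition curvature ::
  "('a, 'b) ring_scheme \<Rightarrow> 'a set \<Rightarrow> ('a, 'm, 'c) module_scheme \<Rightarrow> ereal" where
  "curvature R \<mm> M = limsup (\<lambda>n. ereal (root n (real (betti R \<mm> M n))))"

definition has_maximal_complexity ::
  "('a, 'b) ring_scheme \<Rightarrow> 'a set \<Rightarrow> ('a, 'm, 'c) module_scheme \<Rightarrow> bool" where
  "has_maximal_complexity R \<mm> M \<longleftrightarrow> complexity R \<mm> M = complexity R \<mm> (residue_module R \<mm>)"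

definition has_maximal_curvature ::
  "('a, 'b) ring_scheme \<Rightarrow> 'a set \<Rightarrow> ('a, 'm, 'c) module_scheme \<Rightarrow> bool" where
  "has_maximal_curvature R \<mm> M \<longleftrightarrow> curvature R \<mm> M = curvature R \<mm> (residue_module R \<mm>)"

end

theory Submission
  imports Defs
begin

text \<open>
  Let \<open>k = R/\<mm>\<close>. If \<open>z\<mm> \<subseteq> \<mm>I\<close>, the Cayley--Hamilton argument makes \<open>z\<close> integral over \<open>I\<close>
  (unless \<open>\<mm> = 0\<close>), so for integrally closed \<open>I\<close> a socle element \<open>z\<close> of \<open>R/I\<close> admits some
  \<open>y \<in> \<mm>\<close> with \<open>zy \<in> I - \<mm>I\<close>, and there is a linear map \<open>\<mu> : I \<rightarrow> k\<close> with \<open>\<mu>(zy) = 1\<close>.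

  Let \<open>F\<close> and \<open>G\<close> be free resolutions of \<open>k\<close> and \<open>I\<close>. The extension
  \<open>0 \<rightarrow> I \<rightarrow> I + Rz \<rightarrow> k \<rightarrow> 0\<close> lifts to \<open>\<alpha> : F \<rightarrow> G\<close> of degree \<open>-1\<close>, \<open>\<mu>\<close> lifts to
  \<open>\<gamma> : G \<rightarrow> F\<close>, and multiplication by \<open>y\<close>, being zero on \<open>k\<close>, has a null homotopy \<open>h\<close> on \<open>F\<close>.
  With \<open>\<theta> = \<gamma>\<alpha>\<close> the map \<open>\<theta>h + h\<theta>\<close> is a chain map lifting \<open>\<mu>(zy) = 1\<close> on \<open>k\<close>, hence homotopic to
  the identity. So a class of \<open>Ext(k,k)\<close> that is killed by \<open>\<gamma>\<close> lies in the image of \<open>\<alpha>\<close>, which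
  gives \<open>\<beta>\<^bsub>n+1\<^esub>(k) \<le> \<beta>\<^bsub>n\<^esub>(I) + \<beta>\<^bsub>n+1\<^esub>(I)\<close>. Neither minimal resolutions nor products on \<open>Ext\<close>
  are needed.

  Conversely, \<open>I\<close> is joined to \<open>R\<close> by a finite chain of ideals with successive quotients \<open>k\<close>, and
  the long exact sequences give \<open>\<beta>\<^bsub>n\<^esub>(I) \<le> C \<beta>\<^bsub>n+1\<^esub>(k)\<close> for \<open>n \<ge> 1\<close>.
\<close>

section \<open>Dimension and exactness\<close>

text \<open>\<open>Ext\<close> is read off a resolution picked by choice, so Betti numbers are not
  ranks of free modules and every inequality has to come from exactness at a middle space, tested on
  cocycles. For the first inequality the homotopy supplies it. Let u be a cocycle on F with
  u\<gamma> = vd on G. Then u\<theta> = vd\<alpha> = -(v\<alpha>)d, and on the image of h this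
  becomes (v\<alpha>)hd, because dh = y - hd and y acts as zero on k. So u, being cohomologous to
  u(\<theta>h + h\<theta>), is cohomologous to (uh\<gamma>)\<alpha>, and uh\<gamma> is a cocycle,
  again because y acts as zero on k. Integral closedness enters through \<mu>(zy) = 1 alone: it
  makes \<theta>h cover the identity in degree 0.

  Both inequalities lose a shift of the degree and a constant factor; complexity and curvature see
  neither. If \<mm> = 0 there is no such y, but then the Betti numbers of k vanish in positive
  degrees.\<close>

lemma (in vectorspace) fin_dim_subspace:
  assumes fd: "fin_dim" and W: "VectorSpace.subspace K W V"
  shows "vectorspace.fin_dim K (vs W)"
proof -
  interpret W: vectorspace K "vs W" by (rule subspace_is_vs[OF W])
  have sub: "submodule K W V" and WV: "W \<subseteq> carrier V"
    using W unfolding VectorSpace.subspace_def submodule_def by auto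
  \<comment> \<open>A set independent in \<open>W\<close> is independent in the whole space, so
    \<open>dim\<close> bounds its size; hence a maximal independent subset of \<open>W\<close>
    exists, and it is a finite basis.\<close>
  have small: "finite A \<and> card A \<le> dim" if "A \<subseteq> W \<and> W.lin_indpt A" for A
    using that span_li_not_depend(2)[OF _ sub, of A] WV li_le_dim[OF fd, of A] by auto
  have "W.lin_indpt {}" by (simp add: W.lin_dep_def)
  then obtain A where A: "finite A" "maximal A (\<lambda>S. S \<subseteq> W \<and> W.lin_indpt S)"
    using maximal_exists[of "\<lambda>S. S \<subseteq> W \<and> W.lin_indpt S", OF small, of "{}"] by auto
  have "W.basis A" using W.max_li_is_basis[of A] A(2) by simp
  then show ?thesis using A(1) unfolding W.fin_dim_def W.basis_def by blast
qed

lemma (in vectorspace) dim_subspace_le: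
  assumes fd: "fin_dim" and W: "VectorSpace.subspace K W V"
  shows "vectorspace.dim K (vs W) \<le> dim"
proof -
  interpret W: vectorspace K "vs W" by (rule subspace_is_vs[OF W])
  have sub: "submodule K W V" and WV: "W \<subseteq> carrier V"
    using W unfolding VectorSpace.subspace_def submodule_def by auto
  obtain A where A: "finite A" "W.basis A"
    using W.finite_basis_exists[OF fin_dim_subspace[OF assms]] by blast
  then have "A \<subseteq> W" "W.lin_indpt A" unfolding W.basis_def by auto
  then have "card A \<le> dim"
    using span_li_not_depend(2)[OF _ sub, of A] WV li_le_dim(2)[OF fd, of A] by auto
  then show ?thesis using W.dim_basis[OF A] by simp
qed

lemma (in linear_map) dim_le_of_surj:
  assumes fd: "V.fin_dim" and surj: "T ` carrier V = carrier W"
  shows "W.dim \<le> V.dim"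
proof -
  have "imT = carrier W" using surj by (simp add: im_def)
  then show ?thesis using rank_nullity[OF fd] by simp
qed

text \<open>Rank-nullity for \<open>T\<close> leaves the kernel of \<open>T\<close> to be bounded.
  It is covered by \<open>S\<close>, but \<open>S\<close> may also leave it, since exactness is
  assumed as one inclusion; hence the passage to the subspace of \<open>U\<close> that
  \<open>S\<close> sends into the kernel.\<close>

lemma dim_le_of_exact:
  assumes S: "linear_map K U V S" and T: "linear_map K V W T"
    and fd: "vectorspace.fin_dim K U" "vectorspace.fin_dim K V" "vectorspace.fin_dim K W"
    and exact: "\<And>v. v \<in> carrier V \<Longrightarrow> T v = \<zero>\<^bsub>W\<^esub> \<Longrightarrow> v \<in> S ` carrier U"
  shows "vectorspace.dim K V \<le> vectorspace.dim K U + vectorspace.dim K W"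
proof -
  interpret S: linear_map K U V S by (rule S)
  interpret T: linear_map K V W T by (rule T)
  define U' where "U' = {u \<in> carrier U. T (S u) = \<zero>\<^bsub>W\<^esub>}"
  have "submodule K U' U"
    unfolding U'_def by (rule submodule.intro) (auto intro: S.V.module.module_axioms)
  then have sU': "VectorSpace.subspace K U' U" using S.V.vectorspace_axioms by (simp add: VectorSpace.subspace_def)
  interpret U': vectorspace K "S.V.vs U'" by (rule S.V.subspace_is_vs[OF sU'])
  interpret k: vectorspace K "S.W.vs T.kerT" by (rule S.W.subspace_is_vs[OF T.kerT_is_subspace])
  have "linear_map K (S.V.vs U') (S.W.vs T.kerT) S"
    by unfold_locales (auto simp: LinearCombinations.module_hom_def U'_def T.ker_def)
  then interpret S': linear_map K "S.V.vs U'" "S.W.vs T.kerT" S .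
  have "S ` carrier (S.V.vs U') = carrier (S.W.vs T.kerT)"
    using exact by (fastforce simp: U'_def T.ker_def)
  then have "k.dim \<le> U'.dim"
    by (rule S'.dim_le_of_surj[OF S.V.fin_dim_subspace[OF fd(1) sU']])
  also have "\<dots> \<le> S.V.dim" by (rule S.V.dim_subspace_le[OF fd(1) sU'])
  finally have 1: "k.dim \<le> S.V.dim" .
  have "vectorspace.dim K (T.W.vs T.imT) \<le> T.W.dim"
    by (rule T.W.dim_subspace_le[OF fd(3) T.imT_is_subspace])
  with 1 T.rank_nullity[OF fd(2)] show ?thesis by linarith
qed

section \<open>Linear maps and quotient modules\<close>

abbreviation lin_maps ::
  "('a, 'b) ring_scheme \<Rightarrow> ('a, 'm, 'c) module_scheme \<Rightarrow> ('a, 'n, 'd) module_scheme \<Rightarrow> ('m \<Rightarrow> 'n) set" where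
  "lin_maps \<equiv> LinearCombinations.module_hom"

lemma lin_closed: "f \<in> lin_maps R M N \<Longrightarrow> x \<in> carrier M \<Longrightarrow> f x \<in> carrier N"
  by (auto simp: LinearCombinations.module_hom_def)

lemmas lin_add = LinearCombinations.module_hom_add
lemmas lin_smult = LinearCombinations.module_hom_smult

lemma linI:
  assumes "\<And>x. x \<in> carrier M \<Longrightarrow> f x \<in> carrier N"
    and "\<And>x y. x \<in> carrier M \<Longrightarrow> y \<in> carrier M \<Longrightarrow> f (x \<oplus>\<^bsub>M\<^esub> y) = f x \<oplus>\<^bsub>N\<^esub> f y"
    and "\<And>r x. r \<in> carrier R \<Longrightarrow> x \<in> carrier M \<Longrightarrow> f (r \<odot>\<^bsub>M\<^esub> x) = r \<odot>\<^bsub>N\<^esub> f x"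
  shows "f \<in> lin_maps R M N"
  using assms by (auto simp: LinearCombinations.module_hom_def)

lemma lin_zero:
  assumes "Module.module R M" "Module.module R N" "f \<in> lin_maps R M N"
  shows "f \<zero>\<^bsub>M\<^esub> = \<zero>\<^bsub>N\<^esub>"
  using mod_hom.f0_is_0[of R M N f] assms by (simp add: mod_hom_def mod_hom_axioms_def)

lemma lin_neg:
  assumes "Module.module R M" "Module.module R N" "f \<in> lin_maps R M N" "x \<in> carrier M"
  shows "f (\<ominus>\<^bsub>M\<^esub> x) = \<ominus>\<^bsub>N\<^esub> f x"
  using mod_hom.f_neg[of R M N f] assms by (simp add: mod_hom_def mod_hom_axioms_def)

lemma lin_comp:
  "f \<in> lin_maps R M N \<Longrightarrow> g \<in> lin_maps R N P \<Longrightarrow> (\<lambda>x. g (f x)) \<in> lin_maps R M P"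
  by (auto simp: LinearCombinations.module_hom_def Pi_def)

lemma lin_id: "(\<lambda>x. x) \<in> lin_maps R M M"
  by (auto simp: LinearCombinations.module_hom_def)

lemma lin_const_zero:
  assumes "Module.module R N" shows "(\<lambda>x. \<zero>\<^bsub>N\<^esub>) \<in> lin_maps R M N"
proof -
  interpret N: Module.module R N by (rule assms)
  show ?thesis by (rule linI) auto
qed

lemma lin_plus:
  assumes "Module.module R N" "f \<in> lin_maps R M N" "g \<in> lin_maps R M N"
  shows "(\<lambda>x. f x \<oplus>\<^bsub>N\<^esub> g x) \<in> lin_maps R M N"
proof -
  interpret N: Module.module R N by (rule assms)
  note c = lin_closed[OF assms(2)] lin_closed[OF assms(3)]
  show ?thesis
    by (rule linI)
      (auto simp: c lin_add[OF assms(2)] lin_add[OF assms(3)] lin_smult[OF assms(2)]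
        lin_smult[OF assms(3)] N.smult_r_distr N.M.a_ac)
qed

lemma lin_uminus:
  assumes "Module.module R N" "f \<in> lin_maps R M N"
  shows "(\<lambda>x. \<ominus>\<^bsub>N\<^esub> f x) \<in> lin_maps R M N"
proof -
  interpret N: Module.module R N by (rule assms)
  note c = lin_closed[OF assms(2)]
  show ?thesis
    by (rule linI)
      (auto simp: c lin_add[OF assms(2)] lin_smult[OF assms(2)]
        N.smult_r_minus N.M.minus_add)
qed

lemma lin_scale:
  assumes "Module.module R N" "f \<in> lin_maps R M N" "r \<in> carrier R"
  shows "(\<lambda>x. r \<odot>\<^bsub>N\<^esub> f x) \<in> lin_maps R M N"
proof -
  interpret N: Module.module R N by (rule assms)
  note c = lin_closed[OF assms(2)]
  show ?thesis
    by (rule linI)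
      (auto simp: c assms(3) lin_add[OF assms(2)] lin_smult[OF assms(2)]
        N.smult_r_distr N.R.m_comm simp flip: N.smult_assoc1)
qed

lemma (in Module.module) submodule_imp_abelian_subgroup:
  assumes "submodule R H M"
  shows "abelian_subgroup H M"
proof (rule abelian_subgroupI3)
  have "subgroup H (add_monoid M)"
  proof (rule add.subgroupI)
    show "H \<subseteq> carrier M" "H \<noteq> {}"
      using submodule.subset[OF assms]
        submodule.zero_closed[OF assms] by auto
    show "\<ominus>\<^bsub>M\<^esub> a \<in> H" if a: "a \<in> H" for a
    proof -
      have "\<ominus>\<^bsub>M\<^esub> a = (\<ominus> \<one>) \<odot>\<^bsub>M\<^esub> a"
        using a submodule.subset[OF assms] smult_minus_1 by auto
      also have "\<dots> \<in> H"
        using a submodule.smult_closed[OF assms] by simp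
      finally show ?thesis .
    qed
  qed (simp add: submodule.m_closed[OF assms])
  then show "additive_subgroup H M" by (simp add: additive_subgroup_def)
qed (rule M.abelian_group_axioms)

context
  fixes R :: "('a, 'b) ring_scheme" and M :: "('a, 'm, 'c) module_scheme" and N :: "'m set"
  assumes M: "Module.module R M" and N: "submodule R N M"
begin

interpretation M: Module.module R M by (rule M)
interpretation N: abelian_subgroup N M by (rule M.submodule_imp_abelian_subgroup[OF N])

lemma quotient_module_carrier: "carrier (quotient_module M N) = (\<lambda>x. N +>\<^bsub>M\<^esub> x) ` carrier M"
  by (auto simp: quotient_module_def A_RCOSETS_def')

lemma quotient_module_zero: "\<zero>\<^bsub>quotient_module M N\<^esub> = N"
  by (simp add: quotient_module_def)

lemma coset_eq_zero_iff: "x \<in> carrier M \<Longrightarrow> N +>\<^bsub>M\<^esub> x = N \<longleftrightarrow> x \<in> N"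
  using N.a_rcos_const N.a_rcos_self[of x] by auto

lemma quotient_module_add:
  "x \<in> carrier M \<Longrightarrow> y \<in> carrier M \<Longrightarrow>
    (N +>\<^bsub>M\<^esub> x) \<oplus>\<^bsub>quotient_module M N\<^esub> (N +>\<^bsub>M\<^esub> y) = N +>\<^bsub>M\<^esub> (x \<oplus>\<^bsub>M\<^esub> y)"
  by (simp add: quotient_module_def N.a_rcos_sum)

text \<open>The action on a coset is a union over its representatives. All of them give the same
  coset because \<open>N\<close> absorbs scalars, and the union is not empty.\<close>

lemma quotient_module_smult:
  assumes r: "r \<in> carrier R" and x: "x \<in> carrier M"
  shows "r \<odot>\<^bsub>quotient_module M N\<^esub> (N +>\<^bsub>M\<^esub> x) = N +>\<^bsub>M\<^esub> (r \<odot>\<^bsub>M\<^esub> x)"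
proof -
  have *: "N +>\<^bsub>M\<^esub> (r \<odot>\<^bsub>M\<^esub> y) = N +>\<^bsub>M\<^esub> (r \<odot>\<^bsub>M\<^esub> x)" if y: "y \<in> N +>\<^bsub>M\<^esub> x" for y
  proof -
    obtain n where n: "n \<in> N" "y = n \<oplus>\<^bsub>M\<^esub> x" using y by (auto simp: a_r_coset_def')
    have nM: "n \<in> carrier M" using n(1) N.a_subset by auto
    have rn: "r \<odot>\<^bsub>M\<^esub> n \<in> N" using submodule.smult_closed[OF N r n(1)] .
    have "r \<odot>\<^bsub>M\<^esub> y = r \<odot>\<^bsub>M\<^esub> n \<oplus>\<^bsub>M\<^esub> r \<odot>\<^bsub>M\<^esub> x" using n nM r x by (simp add: M.smult_r_distr)
    then have "r \<odot>\<^bsub>M\<^esub> y \<in> N +>\<^bsub>M\<^esub> (r \<odot>\<^bsub>M\<^esub> x)" using rn by (auto simp: a_r_coset_def')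
    then show ?thesis using r x by (metis M.smult_closed N.a_subgroup M.a_repr_independence)
  qed
  have "N +>\<^bsub>M\<^esub> x \<noteq> {}" using N.a_rcos_self[OF x] by auto
  then have "(\<Union>y\<in>N +>\<^bsub>M\<^esub> x. N +>\<^bsub>M\<^esub> (r \<odot>\<^bsub>M\<^esub> y)) = N +>\<^bsub>M\<^esub> (r \<odot>\<^bsub>M\<^esub> x)"
    using * by auto
  then show ?thesis by (simp add: quotient_module_def)
qed

lemma quotient_module_is_module: "Module.module R (quotient_module M N)"
proof (rule module_criteria)
  show "cring R" by (rule M.is_cring)
  show "\<zero>\<^bsub>quotient_module M N\<^esub> \<in> carrier (quotient_module M N)"
    using coset_eq_zero_iff[of "\<zero>\<^bsub>M\<^esub>"] submodule.zero_closed[OF N]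
    by (auto simp: quotient_module_zero quotient_module_carrier intro!: image_eqI[of _ _ "\<zero>\<^bsub>M\<^esub>"])
  show "\<forall>v\<in>carrier (quotient_module M N). \<exists>w\<in>carrier (quotient_module M N).
      v \<oplus>\<^bsub>quotient_module M N\<^esub> w = \<zero>\<^bsub>quotient_module M N\<^esub>"
  proof
    fix v assume "v \<in> carrier (quotient_module M N)"
    then obtain x where x: "x \<in> carrier M" "v = N +>\<^bsub>M\<^esub> x" by (auto simp: quotient_module_carrier)
    have "v \<oplus>\<^bsub>quotient_module M N\<^esub> (N +>\<^bsub>M\<^esub> (\<ominus>\<^bsub>M\<^esub> x)) = N"
      using x coset_eq_zero_iff[of "\<zero>\<^bsub>M\<^esub>"] submodule.zero_closed[OF N]
      by (simp add: quotient_module_add M.r_neg)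
    then show "\<exists>w\<in>carrier (quotient_module M N).
      v \<oplus>\<^bsub>quotient_module M N\<^esub> w = \<zero>\<^bsub>quotient_module M N\<^esub>"
      using x by (auto simp: quotient_module_carrier quotient_module_zero)
  qed
  show "\<forall>v\<in>carrier (quotient_module M N). v \<oplus>\<^bsub>quotient_module M N\<^esub> \<zero>\<^bsub>quotient_module M N\<^esub> = v"
  proof
    fix v assume "v \<in> carrier (quotient_module M N)"
    then obtain x where x: "x \<in> carrier M" "v = N +>\<^bsub>M\<^esub> x" by (auto simp: quotient_module_carrier)
    have "N = N +>\<^bsub>M\<^esub> \<zero>\<^bsub>M\<^esub>"
      using coset_eq_zero_iff[of "\<zero>\<^bsub>M\<^esub>"] submodule.zero_closed[OF N] by simp
    then have "v \<oplus>\<^bsub>quotient_module M N\<^esub> N = N +>\<^bsub>M\<^esub> (x \<oplus>\<^bsub>M\<^esub> \<zero>\<^bsub>M\<^esub>)"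
      using quotient_module_add[of x "\<zero>\<^bsub>M\<^esub>"] x by simp
    then show "v \<oplus>\<^bsub>quotient_module M N\<^esub> \<zero>\<^bsub>quotient_module M N\<^esub> = v"
      using x by (simp add: quotient_module_zero)
  qed
qed (auto simp: quotient_module_carrier quotient_module_add quotient_module_smult M.a_ac
      M.smult_assoc1 M.smult_l_distr M.smult_r_distr)

lemma coset_in_lin_maps: "(\<lambda>x. N +>\<^bsub>M\<^esub> x) \<in> lin_maps R M (quotient_module M N)"
  by (rule linI) (auto simp: quotient_module_carrier quotient_module_add quotient_module_smult)

lemma coset_eq_iff:
  assumes "x \<in> carrier M" "y \<in> carrier M"
  shows "N +>\<^bsub>M\<^esub> x = N +>\<^bsub>M\<^esub> y \<longleftrightarrow> x \<oplus>\<^bsub>M\<^esub> \<ominus>\<^bsub>M\<^esub> y \<in> N"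
proof
  assume "N +>\<^bsub>M\<^esub> x = N +>\<^bsub>M\<^esub> y"
  then have "x \<in> N +>\<^bsub>M\<^esub> y" using N.a_rcos_self[OF assms(1)] by simp
  then obtain n where n: "n \<in> N" "x = n \<oplus>\<^bsub>M\<^esub> y" by (auto simp: a_r_coset_def')
  moreover have "n \<in> carrier M" using n(1) N.a_subset by auto
  ultimately show "x \<oplus>\<^bsub>M\<^esub> \<ominus>\<^bsub>M\<^esub> y \<in> N" using assms by (simp add: M.a_assoc M.r_neg)
next
  assume "x \<oplus>\<^bsub>M\<^esub> \<ominus>\<^bsub>M\<^esub> y \<in> N"
  moreover have "x = (x \<oplus>\<^bsub>M\<^esub> \<ominus>\<^bsub>M\<^esub> y) \<oplus>\<^bsub>M\<^esub> y" using assms by (simp add: M.a_assoc M.l_neg)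
  ultimately have "x \<in> N +>\<^bsub>M\<^esub> y" by (auto simp: a_r_coset_def')
  then show "N +>\<^bsub>M\<^esub> x = N +>\<^bsub>M\<^esub> y"
    using assms by (metis N.a_subgroup M.a_repr_independence)
qed

end

section \<open>The residue field\<close>

context cring
begin

lemma regular_module: "Module.module R (regular_module R)"
  by (rule module_criteria)
    (auto simp: regular_module_def a_ac m_assoc l_distr r_distr is_cring intro: r_neg)

lemma ideal_submodule_regular:
  assumes "ideal J R" shows "submodule R J (regular_module R)"
proof -
  interpret J: ideal J R by (rule assms)
  show ?thesis
    by (rule submodule.intro)
      (use regular_module J.a_subset J.zero_closed J.a_closed J.I_l_closed in
        \<open>auto simp: regular_module_def\<close>)
qed

lemma ideal_module_is_module:
  assumes "ideal J R" shows "Module.module R (ideal_module R J)"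
  unfolding ideal_module_def
  by (rule LinearCombinations.module.submodule_is_module[OF regular_module ideal_submodule_regular[OF assms]])

lemma ideal_module_simps [simp]:
  "carrier (ideal_module R J) = J" "\<zero>\<^bsub>ideal_module R J\<^esub> = \<zero>"
  "x \<oplus>\<^bsub>ideal_module R J\<^esub> y = x \<oplus> y" "r \<odot>\<^bsub>ideal_module R J\<^esub> x = r \<otimes> x"
  by (simp_all add: ideal_module_def regular_module_def)

lemma regular_module_simps [simp]:
  "carrier (regular_module R) = carrier R" "\<zero>\<^bsub>regular_module R\<^esub> = \<zero>"
  "x \<oplus>\<^bsub>regular_module R\<^esub> y = x \<oplus> y" "r \<odot>\<^bsub>regular_module R\<^esub> x = r \<otimes> x"
  by (simp_all add: regular_module_def)

lemma a_inv_ideal_module: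
  assumes "ideal J R" "x \<in> J" shows "\<ominus>\<^bsub>ideal_module R J\<^esub> x = \<ominus> x"
proof -
  interpret J: ideal J R by (rule assms)
  interpret M: Module.module R "ideal_module R J" by (rule ideal_module_is_module[OF assms(1)])
  show ?thesis
    using assms(2) J.a_subset by (intro M.minus_equality) (auto simp: l_neg J.a_inv_closed)
qed

end

context noetherian_local_ring
begin

interpretation mm: maximalideal \<mm> R by (rule maximal_ideal)

text \<open>\<open>R/\<mm>\<close> occurs both as the \<open>R\<close>-module \<open>kk\<close> and as the field \<open>KK\<close>.\<close>

abbreviation kk :: "('a, 'a set) module" where "kk \<equiv> residue_module R \<mm>"

lemma coset_regular [simp]: "J +>\<^bsub>regular_module R\<^esub> x = J +> x"
  by (auto simp: a_r_coset_def')

lemma mm_ideal: "ideal \<mm> R" ..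

lemma kk_carrier: "carrier kk = (\<lambda>x. \<mm> +> x) ` carrier R"
  using quotient_module_carrier[OF regular_module ideal_submodule_regular[OF mm_ideal]]
  by (simp add: residue_module_def)

lemma kk_zero: "\<zero>\<^bsub>kk\<^esub> = \<mm>"
  by (simp add: residue_module_def quotient_module_def)

lemma kk_add: "x \<in> carrier R \<Longrightarrow> y \<in> carrier R \<Longrightarrow> (\<mm> +> x) \<oplus>\<^bsub>kk\<^esub> (\<mm> +> y) = \<mm> +> (x \<oplus> y)"
  using quotient_module_add[OF regular_module ideal_submodule_regular[OF mm_ideal], of x y]
  by (simp add: residue_module_def)

lemma kk_smult: "r \<in> carrier R \<Longrightarrow> x \<in> carrier R \<Longrightarrow> r \<odot>\<^bsub>kk\<^esub> (\<mm> +> x) = \<mm> +> (r \<otimes> x)"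
  using quotient_module_smult[OF regular_module ideal_submodule_regular[OF mm_ideal], of r x]
  by (simp add: residue_module_def)

lemma kk_module: "Module.module R kk"
  unfolding residue_module_def
  by (rule quotient_module_is_module[OF regular_module ideal_submodule_regular[OF mm_ideal]])

lemma kk_coset_lin: "(\<lambda>x. \<mm> +> x) \<in> lin_maps R (regular_module R) kk"
  using coset_in_lin_maps[OF regular_module ideal_submodule_regular[OF mm_ideal]]
  by (simp add: residue_module_def)

lemma kk_coset_eq_zero: "x \<in> carrier R \<Longrightarrow> \<mm> +> x = \<mm> \<longleftrightarrow> x \<in> \<mm>"
  using coset_eq_zero_iff[OF regular_module ideal_submodule_regular[OF mm_ideal], of x] by simp

lemma kk_smult_mm: "r \<in> \<mm> \<Longrightarrow> v \<in> carrier kk \<Longrightarrow> r \<odot>\<^bsub>kk\<^esub> v = \<zero>\<^bsub>kk\<^esub>"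
  unfolding kk_carrier
  by (erule imageE) (simp add: kk_smult kk_zero kk_coset_eq_zero mm.I_r_closed mm.Icarr)

abbreviation KK :: "'a set ring" where "KK \<equiv> R Quot \<mm>"

lemma KK_field: "field KK"
  by (rule mm.quotient_is_field[OF is_cring])

text \<open>These are the modules that \<open>residue_space\<close> turns into vector spaces over
  \<open>KK\<close>. The property passes to \<open>hom_module\<close>, submodules and quotients, and
  so reaches the cohomology modules.\<close>

definition killed :: "('a, 'v, 'c) module_scheme \<Rightarrow> bool" where
  "killed V \<longleftrightarrow> Module.module R V \<and> (\<forall>r\<in>\<mm>. \<forall>v\<in>carrier V. r \<odot>\<^bsub>V\<^esub> v = \<zero>\<^bsub>V\<^esub>)"

text \<open>The representative picked by choice in \<open>residue_space\<close> differs from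
  \<open>r\<close> by an element of \<mm>, and that difference acts as zero.\<close>

lemma residue_space_smult:
  assumes "killed V" "r \<in> carrier R" "v \<in> carrier V"
  shows "(\<mm> +> r) \<odot>\<^bsub>residue_space V\<^esub> v = r \<odot>\<^bsub>V\<^esub> v"
proof -
  interpret V: Module.module R V using assms(1) by (simp add: killed_def)
  define s where "s = (SOME s. s \<in> \<mm> +> r)"
  have "s \<in> \<mm> +> r" unfolding s_def using mm.a_rcos_self[OF assms(2)] by (rule someI)
  then obtain a where a: "a \<in> \<mm>" "s = a \<oplus> r" by (auto simp: a_r_coset_def')
  then have "s \<odot>\<^bsub>V\<^esub> v = r \<odot>\<^bsub>V\<^esub> v"
    using assms mm.Icarr[OF a(1)] by (simp add: V.smult_l_distr killed_def)
  then show ?thesis by (simp add: residue_space_def s_def)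
qed

lemma residue_space_vectorspace:
  assumes "killed V" shows "vectorspace KK (residue_space V)"
proof -
  interpret V: Module.module R V using assms by (simp add: killed_def)
  have carr: "carrier KK = (\<lambda>x. \<mm> +> x) ` carrier R" by (auto simp: FactRing_def A_RCOSETS_def')
  have mult: "(\<mm> +> x) \<otimes>\<^bsub>KK\<^esub> (\<mm> +> y) = \<mm> +> (x \<otimes> y)" if "x \<in> carrier R" "y \<in> carrier R" for x y
    using that by (simp add: FactRing_def mm.rcoset_mult_add)
  have add: "(\<mm> +> x) \<oplus>\<^bsub>KK\<^esub> (\<mm> +> y) = \<mm> +> (x \<oplus> y)" if "x \<in> carrier R" "y \<in> carrier R" for x y
    using that by (simp add: FactRing_def mm.a_rcos_sum)
  have one: "\<one>\<^bsub>KK\<^esub> = \<mm> +> \<one>" by (simp add: FactRing_def)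
  have s: "carrier (residue_space V) = carrier V" "\<zero>\<^bsub>residue_space V\<^esub> = \<zero>\<^bsub>V\<^esub>"
    "\<And>x y. x \<oplus>\<^bsub>residue_space V\<^esub> y = x \<oplus>\<^bsub>V\<^esub> y" by (simp_all add: residue_space_def)
  show ?thesis
    by (rule vs_criteria[OF KK_field])
      (auto simp: s carr mult add one residue_space_smult[OF assms] V.M.a_ac V.smult_assoc1
        V.smult_l_distr V.smult_r_distr intro: V.M.r_neg)
qed

lemma residue_space_linear_map:
  assumes "killed V" "killed W" "f \<in> lin_maps R V W"
  shows "linear_map KK (residue_space V) (residue_space W) f"
proof -
  interpret V: vectorspace KK "residue_space V" by (rule residue_space_vectorspace[OF assms(1)])
  interpret W: vectorspace KK "residue_space W" by (rule residue_space_vectorspace[OF assms(2)])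
  have carr: "carrier KK = (\<lambda>x. \<mm> +> x) ` carrier R" by (auto simp: FactRing_def A_RCOSETS_def')
  have s: "carrier (residue_space V) = carrier V" for V :: "('a, 'x, 'y) module_scheme"
    by (simp add: residue_space_def)
  have sm: "f ((\<mm> +> r) \<odot>\<^bsub>residue_space V\<^esub> v) = (\<mm> +> r) \<odot>\<^bsub>residue_space W\<^esub> f v"
    if "r \<in> carrier R" "v \<in> carrier V" for r v
    using that assms by (simp add: residue_space_smult lin_closed[OF assms(3)] lin_smult[OF assms(3)])
  have "f \<in> lin_maps KK (residue_space V) (residue_space W)"
    using sm lin_closed[OF assms(3)] lin_add[OF assms(3)]
    by (intro linI) (auto simp: carr residue_space_def)
  then show ?thesis by unfold_locales
qed

lemma hom_module_is_module:
  fixes M :: "('a, 'm, 'c) module_scheme" and N :: "('a, 'n, 'd) module_scheme"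
  assumes M: "Module.module R M" and N: "Module.module R N"
  shows "Module.module R (hom_module R M N)"
proof -
  interpret M: Module.module R M by (rule M)
  interpret N: Module.module R N by (rule N)
  \<comment> \<open>The operations of \<open>hom_module\<close> restrict their results to the
    carrier, so each closure condition comes down to this fact and the pointwise closure of linear
    maps.\<close>
  have restr: "restrict f (carrier M) \<in> lin_maps R M N" if "f \<in> lin_maps R M N" for f
    using that by (auto simp: LinearCombinations.module_hom_def Pi_def)
  have eq: "f = g" if "f \<in> extensional (carrier M)" "g \<in> extensional (carrier M)"
     "\<And>x. x \<in> carrier M \<Longrightarrow> f x = g x" for f g :: "'m \<Rightarrow> 'n"
    using that by (rule extensionalityI)
  show ?thesis
  proof (rule module_criteria)
    show "\<forall>v\<in>carrier (hom_module R M N). \<exists>neg_v\<in>carrier (hom_module R M N).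
        v \<oplus>\<^bsub>hom_module R M N\<^esub> neg_v = \<zero>\<^bsub>hom_module R M N\<^esub>"
    proof
      fix v assume v: "v \<in> carrier (hom_module R M N)"
      then have v': "v \<in> lin_maps R M N" by (simp add: hom_module_def)
      show "\<exists>neg_v\<in>carrier (hom_module R M N). v \<oplus>\<^bsub>hom_module R M N\<^esub> neg_v = \<zero>\<^bsub>hom_module R M N\<^esub>"
        by (rule bexI[of _ "restrict (\<lambda>x. \<ominus>\<^bsub>N\<^esub> v x) (carrier M)"])
          (use lin_closed[OF v'] in \<open>auto simp: hom_module_def N.M.r_neg
            intro!: restr lin_uminus N v' restrict_ext\<close>)
    qed
    show "\<forall>v w. v \<in> carrier (hom_module R M N) \<and> w \<in> carrier (hom_module R M N) \<longrightarrow>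
        v \<oplus>\<^bsub>hom_module R M N\<^esub> w \<in> carrier (hom_module R M N)"
      by (auto simp: hom_module_def intro!: restr lin_plus N)
    show "\<forall>c v. c \<in> carrier R \<and> v \<in> carrier (hom_module R M N) \<longrightarrow>
        c \<odot>\<^bsub>hom_module R M N\<^esub> v \<in> carrier (hom_module R M N)"
      by (auto simp: hom_module_def intro!: restr lin_scale N)
    show "\<zero>\<^bsub>hom_module R M N\<^esub> \<in> carrier (hom_module R M N)"
      by (auto simp: hom_module_def intro!: restr lin_const_zero N)
  qed (auto simp: hom_module_def is_cring N.M.a_ac N.smult_assoc1 N.smult_l_distr N.smult_r_distr
      lin_closed intro!: eq)
qed

lemma killed_hom_module:
  assumes M: "Module.module R M" and N: "killed N" shows "killed (hom_module R M N)"
  using hom_module_is_module[OF M, of N] N lin_closed[of _ R M N]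
  by (auto simp: killed_def hom_module_def intro!: restrict_ext)

lemma killed_submodule:
  assumes "killed M" "submodule R H M" shows "killed (M\<lparr>carrier := H\<rparr>)"
  using LinearCombinations.module.submodule_is_module[of R M H] assms submodule.subset[OF assms(2)]
  by (auto simp: killed_def)

lemma killed_quotient:
  assumes "killed M" "submodule R H M" shows "killed (quotient_module M H)"
proof -
  have M: "Module.module R M" using assms by (simp add: killed_def)
  interpret M: Module.module R M by (rule M)
  have "H +>\<^bsub>M\<^esub> \<zero>\<^bsub>M\<^esub> = H"
    using coset_eq_zero_iff[OF M assms(2), of "\<zero>\<^bsub>M\<^esub>"] submodule.zero_closed[OF assms(2)]
    by simp
  then show ?thesis
    using assms(1) quotient_module_is_module[OF M assms(2)]
    by (auto simp: killed_def quotient_module_carrier[OF M assms(2)] quotient_module_smult[OF M assms(2)]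
        quotient_module_zero[OF M assms(2)] mm.Icarr)
qed

lemma killed_kk: "killed kk"
  using kk_module kk_smult_mm by (simp add: killed_def)

end

section \<open>Finite free modules\<close>

text \<open>The combination x_0 v_0 + ... + x_(j-1) v_(j-1). Recursion on the number of terms lets
  inductions run over initial segments and asks for \<open>v\<close> only below the bound.\<close>

primrec partial_comb ::
  "('a, 'm, 'c) module_scheme \<Rightarrow> (nat \<Rightarrow> 'm) \<Rightarrow> (nat \<Rightarrow> 'a) \<Rightarrow> nat \<Rightarrow> 'm" where
  "partial_comb N v x 0 = \<zero>\<^bsub>N\<^esub>"
| "partial_comb N v x (Suc j) = partial_comb N v x j \<oplus>\<^bsub>N\<^esub> x j \<odot>\<^bsub>N\<^esub> v j"

context cring
begin

abbreviation FF :: "nat \<Rightarrow> ('a, nat \<Rightarrow> 'a) module" where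
  "FF n \<equiv> free_module R n"

abbreviation vecs :: "nat \<Rightarrow> (nat \<Rightarrow> 'a) set" where
  "vecs n \<equiv> carrier (FF n)"

lemma FF_module: "Module.module R (FF n)"
  by (rule func_space_is_module)

lemma free_module_carrier: "vecs n = {..<n} \<rightarrow>\<^sub>E carrier R"
  by (simp add: func_space_def)

lemma free_module_coord [simp]: "x \<in> vecs n \<Longrightarrow> i < n \<Longrightarrow> x i \<in> carrier R"
  by (auto simp: free_module_carrier)

lemma free_module_coord_lin: "i < n \<Longrightarrow> (\<lambda>x. x i) \<in> lin_maps R (FF n) (regular_module R)"
  by (rule linI) (auto simp: func_space_def)

definition unit_vector :: "nat \<Rightarrow> nat \<Rightarrow> nat \<Rightarrow> 'a" where
  "unit_vector n i = (\<lambda>j\<in>{..<n}. if j = i then \<one> else \<zero>)"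

lemma unit_vector_closed [simp]: "unit_vector n i \<in> vecs n"
  by (auto simp: unit_vector_def free_module_carrier)

lemma partial_comb_closed:
  assumes "Module.module R N" "\<And>i. i < n \<Longrightarrow> v i \<in> carrier N" "x \<in> vecs n" "j \<le> n"
  shows "partial_comb N v x j \<in> carrier N"
proof -
  interpret N: Module.module R N by (rule assms(1))
  show ?thesis using assms(4) by (induction j) (use assms in auto)
qed

lemma partial_comb_lin:
  assumes N: "Module.module R N" and v: "\<And>i. i < n \<Longrightarrow> v i \<in> carrier N" and j: "j \<le> n"
  shows "(\<lambda>x. partial_comb N v x j) \<in> lin_maps R (FF n) N"
  using j
proof (induction j)
  case 0
  show ?case by (simp add: lin_const_zero[OF N])
next
  case (Suc j)
  interpret N: Module.module R N by (rule N)
  have "(\<lambda>a. a \<odot>\<^bsub>N\<^esub> v j) \<in> lin_maps R (regular_module R) N"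
    using v[of j] Suc.prems by (intro linI) (auto simp: N.smult_l_distr N.smult_assoc1)
  from lin_comp[OF free_module_coord_lin this, of j n]
  show ?case using Suc lin_plus[OF N] by simp
qed

lemma partial_comb_map:
  assumes N: "Module.module R N" and P: "Module.module R P" and g: "g \<in> lin_maps R N P"
    and v: "\<And>i. i < n \<Longrightarrow> v i \<in> carrier N" and x: "x \<in> vecs n" and j: "j \<le> n"
  shows "g (partial_comb N v x j) = partial_comb P (\<lambda>i. g (v i)) x j"
  using j
proof (induction j)
  case 0
  show ?case by (simp add: lin_zero[OF N P g])
next
  case (Suc j)
  interpret N: Module.module R N by (rule N)
  show ?case
    using Suc partial_comb_closed[OF N v x, where j=j] v[of j] x
    by (simp add: lin_add[OF g] lin_smult[OF g])
qed

lemma partial_comb_unit_vector: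
  assumes x: "x \<in> vecs n" and j: "j \<le> n"
  shows "partial_comb (FF n) (unit_vector n) x j = (\<lambda>i\<in>{..<n}. if i < j then x i else \<zero>)"
  using j
proof (induction j)
  case 0
  show ?case by (simp add: func_space_def)
next
  case (Suc j)
  then show ?case
    using x by (auto simp: func_space_def unit_vector_def fun_eq_iff less_Suc_eq PiE_iff)
qed

lemma partial_comb_unit_vector_full:
  assumes x: "x \<in> vecs n"
  shows "partial_comb (FF n) (unit_vector n) x n = x"
  unfolding partial_comb_unit_vector[OF x order_refl]
  using x by (auto simp: free_module_carrier PiE_iff extensional_def fun_eq_iff)

lemma lin_eq_partial_comb:
  assumes N: "Module.module R N" and f: "f \<in> lin_maps R (FF n) N"
    and x: "x \<in> vecs n"
  shows "f x = partial_comb N (\<lambda>i. f (unit_vector n i)) x n"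
  using partial_comb_map[OF FF_module N f _ x order_refl, of "unit_vector n"]
  by (simp add: partial_comb_unit_vector_full[OF x])

text \<open>Free modules are projective: preimages of the images of the unit vectors determine the
  lift. The map \<psi> only has to hit the image of \<phi>, which is the form in which exactness of
  a resolution provides it.\<close>

lemma free_module_lift:
  assumes M: "Module.module R M" and X: "Module.module R X"
    and \<phi>: "\<phi> \<in> lin_maps R (FF n) X" and \<psi>: "\<psi> \<in> lin_maps R M X"
    and im: "\<And>x. x \<in> vecs n \<Longrightarrow> \<phi> x \<in> \<psi> ` carrier M"
  shows "\<exists>f \<in> lin_maps R (FF n) M. \<forall>x \<in> vecs n. \<psi> (f x) = \<phi> x"
proof -
  have "\<forall>i. \<exists>y. y \<in> carrier M \<and> \<psi> y = \<phi> (unit_vector n i)"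
    using im[OF unit_vector_closed] by (metis imageE)
  then obtain v where v: "\<And>i. v i \<in> carrier M" "\<And>i. \<psi> (v i) = \<phi> (unit_vector n i)" by metis
  show ?thesis
  proof (intro bexI ballI)
    show "(\<lambda>x. partial_comb M v x n) \<in> lin_maps R (FF n) M"
      by (rule partial_comb_lin[OF M v(1) order_refl])
    fix x assume x: "x \<in> vecs n"
    show "\<psi> (partial_comb M v x n) = \<phi> x"
      using partial_comb_map[OF M X \<psi> v(1) x order_refl] lin_eq_partial_comb[OF X \<phi> x] v(2) by simp
  qed
qed

end

context noetherian_local_ring
begin

text \<open>The coordinates reduced modulo \<mm> span: a functional is the combination of the
  \<open>\<delta> i\<close> with its values on the unit vectors as coefficients. The truncations
  \<open>g j\<close> add one coordinate at a time.\<close>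

lemma fin_dim_hom_free_kk:
  "vectorspace.fin_dim KK (residue_space (hom_module R (FF n) kk))"
proof -
  let ?M = "hom_module R (FF n) kk"
  let ?V = "residue_space ?M"
  have kM: "killed ?M" by (rule killed_hom_module[OF FF_module killed_kk])
  interpret V: vectorspace KK ?V by (rule residue_space_vectorspace[OF kM])
  interpret kk: Module.module R kk by (rule kk_module)
  interpret F: Module.module R "FF n" by (rule FF_module)
  define \<delta> where "\<delta> i = restrict (\<lambda>x. \<mm> +> x i) (vecs n)" for i
  have res: "restrict f (vecs n) \<in> carrier ?V" if "f \<in> lin_maps R (FF n) kk" for f
    using that by (auto simp: residue_space_def hom_module_def LinearCombinations.module_hom_def Pi_def)
  have \<delta>: "\<delta> i \<in> carrier ?V" if "i < n" for i
    unfolding \<delta>_def by (intro res lin_comp[OF free_module_coord_lin[OF that] kk_coset_lin])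
  define A where "A = \<delta> ` {..<n}"
  have A: "finite A" "A \<subseteq> carrier ?V" using \<delta> by (auto simp: A_def)
  have sp: "submodule KK (V.span A) ?V" by (rule V.span_is_submodule[OF A(2)])
  have "f \<in> V.span A" if f: "f \<in> carrier ?V" for f
  proof -
    have fl: "f \<in> lin_maps R (FF n) kk" and fe: "f \<in> extensional (vecs n)"
      using f by (auto simp: residue_space_def hom_module_def)
    define g where "g j = restrict (\<lambda>x. partial_comb kk (\<lambda>i. f (unit_vector n i)) x j) (vecs n)" for j
    have fu: "f (unit_vector n i) \<in> carrier kk" for i using lin_closed[OF fl] by simp
    have "g j \<in> V.span A" if "j \<le> n" for j
      using that
    proof (induction j)
      case 0
      have "g 0 = \<zero>\<^bsub>?V\<^esub>" by (simp add: g_def residue_space_def hom_module_def)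
      then show ?case using submodule.zero_closed[OF sp] by simp
    next
      case (Suc j)
      obtain c where c: "c \<in> carrier R" "f (unit_vector n j) = \<mm> +> c" using fu[of j] by (auto simp: kk_carrier)
      have "(\<mm> +> c) \<odot>\<^bsub>?V\<^esub> \<delta> j = c \<odot>\<^bsub>?M\<^esub> \<delta> j"
        using residue_space_smult[OF kM c(1)] \<delta>[of j] Suc.prems by (simp add: residue_space_def)
      moreover have "g (Suc j) = g j \<oplus>\<^bsub>?M\<^esub> c \<odot>\<^bsub>?M\<^esub> \<delta> j"
        using Suc.prems c by (auto simp: g_def \<delta>_def hom_module_def kk_smult m_comm intro!: restrict_ext)
      ultimately have "g (Suc j) = g j \<oplus>\<^bsub>?V\<^esub> (\<mm> +> c) \<odot>\<^bsub>?V\<^esub> \<delta> j" by (simp add: residue_space_def)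
      moreover have "\<delta> j \<in> V.span A" using Suc.prems A V.in_own_span[OF A(2)] by (auto simp: A_def)
      moreover have "\<mm> +> c \<in> carrier KK" using c by (auto simp: FactRing_def A_RCOSETS_def')
      ultimately show ?case
        using Suc submodule.m_closed[OF sp] submodule.smult_closed[OF sp]
        by simp
    qed
    moreover have "g n = f"
    proof (rule extensionalityI[OF _ fe])
      show "g n \<in> extensional (vecs n)" by (simp add: g_def)
      show "g n x = f x" if "x \<in> vecs n" for x
        using lin_eq_partial_comb[OF kk_module fl that] that unfolding g_def by (metis restrict_apply')
    qed
    ultimately show ?thesis by auto
  qed
  moreover have "V.span A \<subseteq> carrier ?V" by (rule submodule.subset[OF sp])
  ultimately show ?thesis unfolding V.fin_dim_def using A by blast
qed

end

section \<open>Cohomology with coefficients in the residue field\<close>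

text \<open>\<open>T\<close> applies \<phi> to a chosen representative; two representatives differ
  by an element of \<open>B\<close>, which \<phi> sends into \<open>B'\<close>.\<close>

lemma quotient_module_induced_map:
  assumes M: "Module.module R M" and M': "Module.module R M'"
    and B: "submodule R B M" and B': "submodule R B' M'"
    and \<phi>: "\<phi> \<in> lin_maps R M M'" and BB': "\<And>x. x \<in> B \<Longrightarrow> \<phi> x \<in> B'"
  shows "\<exists>T \<in> lin_maps R (quotient_module M B) (quotient_module M' B').
    \<forall>x \<in> carrier M. T (B +>\<^bsub>M\<^esub> x) = B' +>\<^bsub>M'\<^esub> \<phi> x"
proof -
  interpret M: Module.module R M by (rule M)
  interpret M': Module.module R M' by (rule M')
  interpret B: abelian_subgroup B M by (rule M.submodule_imp_abelian_subgroup[OF B])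
  define T where "T X = B' +>\<^bsub>M'\<^esub> \<phi> (SOME x. x \<in> X)" for X
  have T: "T (B +>\<^bsub>M\<^esub> x) = B' +>\<^bsub>M'\<^esub> \<phi> x" if x: "x \<in> carrier M" for x
  proof -
    define s where "s = (SOME y. y \<in> B +>\<^bsub>M\<^esub> x)"
    have "s \<in> B +>\<^bsub>M\<^esub> x" unfolding s_def using B.a_rcos_self[OF x] by (rule someI)
    then obtain b where b: "b \<in> B" "s = b \<oplus>\<^bsub>M\<^esub> x" by (auto simp: a_r_coset_def')
    have bM: "b \<in> carrier M" using b B.a_subset by auto
    have "\<phi> s \<oplus>\<^bsub>M'\<^esub> \<ominus>\<^bsub>M'\<^esub> \<phi> x = \<phi> b"
      using b bM x lin_closed[OF \<phi>] by (simp add: lin_add[OF \<phi>] M'.M.a_assoc M'.M.r_neg)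
    moreover have "s \<in> carrier M" using b bM x by simp
    ultimately show ?thesis
      using coset_eq_iff[OF M' B', of "\<phi> s" "\<phi> x"] BB'[OF b(1)] x lin_closed[OF \<phi>]
      by (simp add: T_def s_def)
  qed
  have "T \<in> lin_maps R (quotient_module M B) (quotient_module M' B')"
    by (rule linI)
      (auto simp: quotient_module_carrier[OF M B] quotient_module_carrier[OF M' B']
        quotient_module_add[OF M B] quotient_module_add[OF M' B'] quotient_module_smult[OF M B]
        quotient_module_smult[OF M' B'] T lin_closed[OF \<phi>] lin_add[OF \<phi>] lin_smult[OF \<phi>])
  then show ?thesis using T by auto
qed

context noetherian_local_ring
begin

text \<open>The condition placed on the source of a lifted map; exactness is asked of the target, by
  \<open>exact_aug\<close>.\<close>

definition free_complex ::
  "(nat \<Rightarrow> nat) \<Rightarrow> (nat \<Rightarrow> (nat \<Rightarrow> 'a) \<Rightarrow> (nat \<Rightarrow> 'a)) \<Rightarrow> bool" where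
  "free_complex b d \<longleftrightarrow>
     (\<forall>n. d n \<in> lin_maps R (FF (b (Suc n))) (FF (b n))) \<and>
     (\<forall>n. \<forall>x \<in> vecs (b (Suc (Suc n))). d n (d (Suc n) x) = \<zero>\<^bsub>FF (b n)\<^esub>)"

lemma free_complex_lin:
  "free_complex b d \<Longrightarrow> d n \<in> lin_maps R (FF (b (Suc n))) (FF (b n))"
  by (simp add: free_complex_def)

lemmas free_complex_closed = lin_closed[OF free_complex_lin]

lemma free_resolution_complex: "free_resolution R M b d e \<Longrightarrow> free_complex b d"
  unfolding free_resolution_def free_complex_def by blast

text \<open>A predicate on arbitrary functions rather than on extensional ones, so that pullbacks
  can be written as plain composites. The extensional carriers of \<open>Ext\<close> are reached
  through \<open>cocycles_iff\<close> and \<open>coboundaries_iff\<close>.\<close>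

definition cocycle ::
  "(nat \<Rightarrow> nat) \<Rightarrow> (nat \<Rightarrow> (nat \<Rightarrow> 'a) \<Rightarrow> (nat \<Rightarrow> 'a)) \<Rightarrow> nat \<Rightarrow> ((nat \<Rightarrow> 'a) \<Rightarrow> 'a set) \<Rightarrow> bool" where
  "cocycle b d n u \<longleftrightarrow> u \<in> lin_maps R (FF (b n)) kk \<and>
     (\<forall>x \<in> vecs (b (Suc n)). u (d n x) = \<zero>\<^bsub>kk\<^esub>)"

text \<open>It constrains values on the carrier only and is therefore insensitive to restriction. No
  differential enters degree 0, so there only zero qualifies.\<close>

definition coboundary ::
  "(nat \<Rightarrow> nat) \<Rightarrow> (nat \<Rightarrow> (nat \<Rightarrow> 'a) \<Rightarrow> (nat \<Rightarrow> 'a)) \<Rightarrow> nat \<Rightarrow> ((nat \<Rightarrow> 'a) \<Rightarrow> 'a set) \<Rightarrow> bool" where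
  "coboundary b d n u \<longleftrightarrow> (case n of
      0 \<Rightarrow> \<forall>x \<in> vecs (b 0). u x = \<zero>\<^bsub>kk\<^esub>
    | Suc m \<Rightarrow> \<exists>v \<in> lin_maps R (FF (b m)) kk.
        \<forall>x \<in> vecs (b n). u x = v (d m x))"

abbreviation cohom_space where
  "cohom_space b d n \<equiv> residue_space (hom_cohomology R b d kk n)"

abbreviation cohom_dim :: "(nat \<Rightarrow> nat) \<Rightarrow> (nat \<Rightarrow> (nat \<Rightarrow> 'a) \<Rightarrow> (nat \<Rightarrow> 'a)) \<Rightarrow> nat \<Rightarrow> nat" where
  "cohom_dim b d n \<equiv> vectorspace.dim KK (cohom_space b d n)"

abbreviation cocycle_module where
  "cocycle_module b d n \<equiv> (cochain_module R b kk n)\<lparr>carrier := cocycles R b d kk n\<rparr>"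

abbreviation cohom_class where
  "cohom_class b d n u \<equiv> coboundaries R b d kk n +>\<^bsub>cocycle_module b d n\<^esub> u"

lemma lin_restrict:
  "restrict f (vecs n) \<in> lin_maps R (FF n) N
    \<longleftrightarrow> f \<in> lin_maps R (FF n) N"
proof -
  interpret F: Module.module R "FF n" by (rule FF_module)
  show ?thesis by (auto simp: LinearCombinations.module_hom_def Pi_def)
qed

lemma cocycles_iff:
  assumes "free_complex b d"
  shows "u \<in> cocycles R b d kk n \<longleftrightarrow> cocycle b d n u \<and> u \<in> extensional (vecs (b n))"
proof -
  have "coboundary_map R b d n u = \<zero>\<^bsub>cochain_module R b kk (Suc n)\<^esub> \<longleftrightarrow>
    (\<forall>x \<in> vecs (b (Suc n)). u (d n x) = \<zero>\<^bsub>kk\<^esub>)"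
    by (auto simp: coboundary_map_def cochain_module_def hom_module_def fun_eq_iff restrict_def)
  then show ?thesis
    by (auto simp: cocycles_def cocycle_def cochain_module_def hom_module_def)
qed

lemma coboundaries_iff:
  assumes "free_complex b d"
  shows "u \<in> coboundaries R b d kk n \<longleftrightarrow>
    coboundary b d n u \<and> u \<in> extensional (vecs (b n))"
proof (cases n)
  case 0
  then show ?thesis
    by (auto simp: coboundary_def cochain_module_def hom_module_def extensional_def fun_eq_iff restrict_def)
next
  case (Suc m)
  show ?thesis
  proof
    assume "u \<in> coboundaries R b d kk n"
    then show "coboundary b d n u \<and> u \<in> extensional (vecs (b n))"
      using Suc by (auto simp: coboundary_def cochain_module_def hom_module_def coboundary_map_def)
  next
    assume u: "coboundary b d n u \<and> u \<in> extensional (vecs (b n))"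
    then obtain v where v: "v \<in> lin_maps R (FF (b m)) kk"
      "\<And>x. x \<in> vecs (b n) \<Longrightarrow> u x = v (d m x)" using Suc by (auto simp: coboundary_def)
    let ?v = "restrict v (vecs (b m))"
    have "u = coboundary_map R b d m ?v"
    proof (rule extensionalityI)
      show "u \<in> extensional (vecs (b n))" using u by simp
      show "coboundary_map R b d m ?v \<in> extensional (vecs (b n))"
        by (simp add: coboundary_map_def Suc)
      show "u x = coboundary_map R b d m ?v x" if "x \<in> vecs (b n)" for x
        using that v(2)[OF that] free_complex_closed[OF assms] by (simp add: coboundary_map_def Suc)
    qed
    moreover have "?v \<in> carrier (cochain_module R b kk m)"
      using v(1) by (simp add: cochain_module_def hom_module_def lin_restrict)
    ultimately show "u \<in> coboundaries R b d kk n" using Suc by auto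
  qed
qed

lemma coboundary_is_cocycle:
  assumes C: "free_complex b d" and u: "u \<in> lin_maps R (FF (b n)) kk" "coboundary b d n u"
  shows "cocycle b d n u"
proof (cases n)
  case 0
  have "d 0 \<in> lin_maps R (FF (b (Suc 0))) (FF (b 0))" using C by (simp add: free_complex_def)
  from lin_closed[OF this] show ?thesis using u 0 by (auto simp: cocycle_def coboundary_def)
next
  case (Suc m)
  then obtain v where v: "v \<in> lin_maps R (FF (b m)) kk"
      "\<And>x. x \<in> vecs (b n) \<Longrightarrow> u x = v (d m x)" using u by (auto simp: coboundary_def)
  have "d n \<in> lin_maps R (FF (b (Suc n))) (FF (b n))" using C by (simp add: free_complex_def)
  from v lin_closed[OF this] u(1) C lin_zero[OF FF_module kk_module v(1)]
  show ?thesis unfolding Suc by (auto simp: cocycle_def free_complex_def)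
qed

lemma killed_cochain_module: "killed (cochain_module R b kk n)"
  unfolding cochain_module_def by (rule killed_hom_module[OF FF_module killed_kk])

lemma cochain_simps:
  "\<zero>\<^bsub>cochain_module R b kk n\<^esub> = restrict (\<lambda>x. \<zero>\<^bsub>kk\<^esub>) (vecs (b n))"
  "u \<oplus>\<^bsub>cochain_module R b kk n\<^esub> v = restrict (\<lambda>x. u x \<oplus>\<^bsub>kk\<^esub> v x) (vecs (b n))"
  "r \<odot>\<^bsub>cochain_module R b kk n\<^esub> u = restrict (\<lambda>x. r \<odot>\<^bsub>kk\<^esub> u x) (vecs (b n))"
  by (simp_all add: cochain_module_def hom_module_def)

lemma cocycle_restrict:
  assumes C: "free_complex b d"
  shows "cocycle b d n (restrict u (vecs (b n))) \<longleftrightarrow> cocycle b d n u"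
proof -
  have "d n \<in> lin_maps R (FF (b (Suc n))) (FF (b n))" using C by (simp add: free_complex_def)
  from lin_closed[OF this] show ?thesis by (auto simp: cocycle_def lin_restrict)
qed

lemma coboundary_restrict:
  "coboundary b d n (restrict u (vecs (b n))) \<longleftrightarrow> coboundary b d n u"
  by (cases n) (auto simp: coboundary_def)

lemma coboundary_plus:
  assumes "coboundary b d n u" "coboundary b d n v"
  shows "coboundary b d n (\<lambda>x. u x \<oplus>\<^bsub>kk\<^esub> v x)"
proof -
  interpret kk: Module.module R kk by (rule kk_module)
  show ?thesis
  proof (cases n)
    case 0 then show ?thesis using assms by (auto simp: coboundary_def)
  next
    case (Suc m)
    with assms obtain u' v' where "u' \<in> lin_maps R (FF (b m)) kk" "v' \<in> lin_maps R (FF (b m)) kk"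
      "\<forall>x \<in> vecs (b n). u x = u' (d m x)"
      "\<forall>x \<in> vecs (b n). v x = v' (d m x)"
      by (auto simp: coboundary_def)
    then show ?thesis using Suc lin_plus[OF kk_module, of u' _ v']
      by (auto simp: coboundary_def intro!: bexI[of _ "\<lambda>x. u' x \<oplus>\<^bsub>kk\<^esub> v' x"])
  qed
qed

lemma coboundary_scale:
  assumes "coboundary b d n u" "r \<in> carrier R"
  shows "coboundary b d n (\<lambda>x. r \<odot>\<^bsub>kk\<^esub> u x)"
proof -
  interpret kk: Module.module R kk by (rule kk_module)
  show ?thesis
  proof (cases n)
    case 0 then show ?thesis using assms by (auto simp: coboundary_def)
  next
    case (Suc m)
    with assms obtain u' where "u' \<in> lin_maps R (FF (b m)) kk"
      "\<forall>x \<in> vecs (b n). u x = u' (d m x)"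
      by (auto simp: coboundary_def)
    then show ?thesis using Suc lin_scale[OF kk_module, of u' _ r] assms
      by (auto simp: coboundary_def intro!: bexI[of _ "\<lambda>x. r \<odot>\<^bsub>kk\<^esub> u' x"])
  qed
qed

lemma coboundary_zero: "coboundary b d n (\<lambda>x. \<zero>\<^bsub>kk\<^esub>)"
  by (cases n) (auto simp: coboundary_def intro!: bexI[of _ "\<lambda>x. \<zero>\<^bsub>kk\<^esub>"] lin_const_zero kk_module)

lemma cocycle_plus:
  "cocycle b d n u \<Longrightarrow> cocycle b d n v \<Longrightarrow> cocycle b d n (\<lambda>x. u x \<oplus>\<^bsub>kk\<^esub> v x)"
proof -
  interpret kk: Module.module R kk by (rule kk_module)
  show "cocycle b d n u \<Longrightarrow> cocycle b d n v \<Longrightarrow> cocycle b d n (\<lambda>x. u x \<oplus>\<^bsub>kk\<^esub> v x)"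
    by (auto simp: cocycle_def intro!: lin_plus kk_module)
qed

lemma cocycle_scale:
  "cocycle b d n u \<Longrightarrow> r \<in> carrier R \<Longrightarrow> cocycle b d n (\<lambda>x. r \<odot>\<^bsub>kk\<^esub> u x)"
proof -
  interpret kk: Module.module R kk by (rule kk_module)
  show "cocycle b d n u \<Longrightarrow> r \<in> carrier R \<Longrightarrow> cocycle b d n (\<lambda>x. r \<odot>\<^bsub>kk\<^esub> u x)"
    by (auto simp: cocycle_def intro!: lin_scale kk_module)
qed

lemma cocycle_uminus: "cocycle b d n u \<Longrightarrow> cocycle b d n (\<lambda>x. \<ominus>\<^bsub>kk\<^esub> u x)"
proof -
  interpret kk: Module.module R kk by (rule kk_module)
  show "cocycle b d n u \<Longrightarrow> cocycle b d n (\<lambda>x. \<ominus>\<^bsub>kk\<^esub> u x)"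
    by (auto simp: cocycle_def intro!: lin_uminus kk_module)
qed

lemma cocycle_zero: "cocycle b d n (\<lambda>x. \<zero>\<^bsub>kk\<^esub>)"
  by (simp add: cocycle_def lin_const_zero[OF kk_module])

lemma cocycles_submodule:
  assumes C: "free_complex b d"
  shows "submodule R (cocycles R b d kk n) (cochain_module R b kk n)"
proof -
  interpret kk: Module.module R kk by (rule kk_module)
  show ?thesis
  proof (rule submodule.intro)
    show "Module.module R (cochain_module R b kk n)" using killed_cochain_module by (simp add: killed_def)
    show "cocycles R b d kk n \<subseteq> carrier (cochain_module R b kk n)" by (auto simp: cocycles_def)
  qed (auto simp: cocycles_iff[OF C] cochain_simps cocycle_restrict[OF C]
    cocycle_plus cocycle_scale cocycle_zero)
qed

lemma cocycle_module_module:
  assumes C: "free_complex b d" shows "Module.module R (cocycle_module b d n)"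
  using killed_submodule[OF killed_cochain_module cocycles_submodule[OF C]] by (simp add: killed_def)

lemma coboundaries_submodule:
  assumes C: "free_complex b d"
  shows "submodule R (coboundaries R b d kk n) (cocycle_module b d n)"
proof (rule submodule.intro)
  show "Module.module R (cocycle_module b d n)" by (rule cocycle_module_module[OF C])
  show "coboundaries R b d kk n \<subseteq> carrier (cocycle_module b d n)"
  proof
    fix u assume u: "u \<in> coboundaries R b d kk n"
    have "u \<in> lin_maps R (FF (b n)) kk"
    proof (cases n)
      case 0
      then show ?thesis using u lin_const_zero[OF kk_module, where M = "FF (b 0)"]
        by (simp add: cochain_simps lin_restrict)
    next
      case (Suc m)
      have dm: "d m \<in> lin_maps R (FF (b n)) (FF (b m))"
        using C Suc by (simp add: free_complex_def)
      show ?thesis using u Suc lin_comp[OF dm]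
        by (auto simp: coboundary_map_def cochain_module_def hom_module_def lin_restrict)
    qed
    then show "u \<in> carrier (cocycle_module b d n)"
      using u coboundary_is_cocycle[OF C] by (auto simp: cocycles_iff[OF C] coboundaries_iff[OF C])
  qed
qed (auto simp: coboundaries_iff[OF C] cochain_simps coboundary_restrict coboundary_plus
    coboundary_scale coboundary_zero)

lemma killed_hom_cohomology:
  assumes C: "free_complex b d" shows "killed (hom_cohomology R b d kk n)"
  unfolding hom_cohomology_def
  by (rule killed_quotient[OF killed_submodule[OF killed_cochain_module cocycles_submodule[OF C]]
        coboundaries_submodule[OF C]])

lemma fin_dim_hom_cohomology:
  assumes C: "free_complex b d"
  shows "vectorspace.fin_dim KK (cohom_space b d n)"
proof -
  let ?C = "residue_space (cochain_module R b kk n)" and ?Z = "residue_space (cocycle_module b d n)"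
  have kZ: "killed (cocycle_module b d n)"
    by (rule killed_submodule[OF killed_cochain_module cocycles_submodule[OF C]])
  interpret V: vectorspace KK ?C by (rule residue_space_vectorspace[OF killed_cochain_module])
  have eq: "?Z = V.vs (cocycles R b d kk n)" by (simp add: residue_space_def)
  have sub: "VectorSpace.subspace KK (cocycles R b d kk n) ?C"
  proof -
    note s = cocycles_submodule[OF C, of n]
    have "submodule KK (cocycles R b d kk n) ?C"
    proof (rule submodule.intro)
      show "Module.module KK ?C" by (rule V.module.module_axioms)
      fix c v assume c: "c \<in> carrier KK" and v: "v \<in> cocycles R b d kk n"
      then obtain r where r: "r \<in> carrier R" "c = \<mm> +> r" by (auto simp: FactRing_def A_RCOSETS_def')
      have "v \<in> carrier (cochain_module R b kk n)" using v submodule.subset[OF s] by auto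
      then show "c \<odot>\<^bsub>?C\<^esub> v \<in> cocycles R b d kk n"
        using residue_space_smult[OF killed_cochain_module r(1)] r(2)
          submodule.smult_closed[OF s r(1) v] by simp
    qed (use submodule.subset[OF s] submodule.m_closed[OF s]
       submodule.zero_closed[OF s] in \<open>auto simp: residue_space_def\<close>)
    then show ?thesis using V.vectorspace_axioms by (simp add: VectorSpace.subspace_def)
  qed
  have fd: "vectorspace.fin_dim KK ?Z"
    unfolding eq using V.fin_dim_subspace[OF _ sub] fin_dim_hom_free_kk[of "b n"]
    by (simp add: cochain_module_def)
  interpret T: linear_map KK ?Z "cohom_space b d n"
    "cohom_class b d n"
    unfolding hom_cohomology_def
    by (intro residue_space_linear_map kZ killed_quotient coboundaries_submodule C
      coset_in_lin_maps cocycle_module_module)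
  show ?thesis
    by (rule T.surj_fin_dim[OF fd])
     (simp add: residue_space_def hom_cohomology_def
       quotient_module_carrier[OF cocycle_module_module[OF C] coboundaries_submodule[OF C]])
qed

text \<open>A single linear map between two possibly different degrees is taken instead of a chain
  map, so that the same statement covers chain maps and connecting maps.\<close>

lemma cohomology_pullback:
  assumes C: "free_complex b d" and C': "free_complex b' d'"
    and f: "f \<in> lin_maps R (FF (b' n')) (FF (b n))"
    and Z: "\<And>u. cocycle b d n u \<Longrightarrow> cocycle b' d' n' (\<lambda>x. u (f x))"
    and B: "\<And>u. coboundary b d n u \<Longrightarrow> coboundary b' d' n' (\<lambda>x. u (f x))"
  shows "\<exists>T. linear_map KK (cohom_space b d n) (cohom_space b' d' n') T \<and>
    (\<forall>u \<in> cocycles R b d kk n. T (cohom_class b d n u) =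
       cohom_class b' d' n' (restrict (\<lambda>x. u (f x)) (vecs (b' n'))))"
proof -
  let ?\<phi> = "\<lambda>u. restrict (\<lambda>x. u (f x)) (vecs (b' n'))"
  note fc = lin_closed[OF f]
  have \<phi>: "?\<phi> \<in> lin_maps R (cocycle_module b d n) (cocycle_module b' d' n')"
    by (rule linI)
      (auto simp: cocycles_iff[OF C] cocycles_iff[OF C'] cocycle_restrict[OF C'] Z cochain_simps fc intro!: restrict_ext)
  have B': "?\<phi> u \<in> coboundaries R b' d' kk n'" if "u \<in> coboundaries R b d kk n" for u
    using that B by (simp add: coboundaries_iff[OF C] coboundaries_iff[OF C'] coboundary_restrict)
  obtain T where T: "T \<in> lin_maps R (hom_cohomology R b d kk n) (hom_cohomology R b' d' kk n')"
    "\<forall>u \<in> cocycles R b d kk n. T (cohom_class b d n u) =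
      cohom_class b' d' n' (?\<phi> u)"
    using quotient_module_induced_map[OF cocycle_module_module[OF C] cocycle_module_module[OF C']
      coboundaries_submodule[OF C] coboundaries_submodule[OF C'] \<phi> B']
    by (auto simp: hom_cohomology_def)
  from residue_space_linear_map[OF killed_hom_cohomology[OF C] killed_hom_cohomology[OF C'] T(1)] T(2)
  show ?thesis by blast
qed

text \<open>Translates the inequality for vector spaces into conditions on cochains. The encoding of
  cohomology by cosets and extensional functions is dealt with here once; the applications only
  compute with \<open>cocycle\<close> and \<open>coboundary\<close>.\<close>

theorem cohom_dim_le_of_exact:
  assumes C1: "free_complex b1 d1" and C2: "free_complex b2 d2" and C3: "free_complex b3 d3"
    and f: "f \<in> lin_maps R (FF (b2 n2)) (FF (b1 n1))"
    and fZ: "\<And>u. cocycle b1 d1 n1 u \<Longrightarrow> cocycle b2 d2 n2 (\<lambda>x. u (f x))"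
    and fB: "\<And>u. coboundary b1 d1 n1 u \<Longrightarrow> coboundary b2 d2 n2 (\<lambda>x. u (f x))"
    and g: "g \<in> lin_maps R (FF (b3 n3)) (FF (b2 n2))"
    and gZ: "\<And>u. cocycle b2 d2 n2 u \<Longrightarrow> cocycle b3 d3 n3 (\<lambda>x. u (g x))"
    and gB: "\<And>u. coboundary b2 d2 n2 u \<Longrightarrow> coboundary b3 d3 n3 (\<lambda>x. u (g x))"
    and exact: "\<And>u. cocycle b2 d2 n2 u \<Longrightarrow> coboundary b3 d3 n3 (\<lambda>x. u (g x)) \<Longrightarrow>
      \<exists>w. cocycle b1 d1 n1 w \<and> coboundary b2 d2 n2 (\<lambda>x. u x \<oplus>\<^bsub>kk\<^esub> \<ominus>\<^bsub>kk\<^esub> w (f x))"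
  shows "cohom_dim b2 d2 n2 \<le> cohom_dim b1 d1 n1 + cohom_dim b3 d3 n3"
proof -
  obtain S where S: "linear_map KK (cohom_space b1 d1 n1) (cohom_space b2 d2 n2) S"
    and S': "\<And>u. u \<in> cocycles R b1 d1 kk n1 \<Longrightarrow> S (cohom_class b1 d1 n1 u) =
       cohom_class b2 d2 n2 (restrict (\<lambda>x. u (f x)) (vecs (b2 n2)))"
    using cohomology_pullback[where f = f, OF C1 C2 f fZ fB] by auto
  obtain T where T: "linear_map KK (cohom_space b2 d2 n2) (cohom_space b3 d3 n3) T"
    and T': "\<And>u. u \<in> cocycles R b2 d2 kk n2 \<Longrightarrow> T (cohom_class b2 d2 n2 u) =
       cohom_class b3 d3 n3 (restrict (\<lambda>x. u (g x)) (vecs (b3 n3)))"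
    using cohomology_pullback[where f = g, OF C2 C3 g gZ gB] by auto
  have carr: "carrier (cohom_space b d n) =
      (\<lambda>u. cohom_class b d n u) ` cocycles R b d kk n"
    if "free_complex b d" for b d n
    using quotient_module_carrier[OF cocycle_module_module[OF that] coboundaries_submodule[OF that]]
    by (simp add: residue_space_def hom_cohomology_def)
  show ?thesis
  proof (rule dim_le_of_exact[OF S T])
    fix X assume X: "X \<in> carrier (cohom_space b2 d2 n2)"
      and TX: "T X = \<zero>\<^bsub>cohom_space b3 d3 n3\<^esub>"
    obtain u where u: "u \<in> cocycles R b2 d2 kk n2"
      and Xu: "X = cohom_class b2 d2 n2 u"
      using X unfolding carr[OF C2] by auto
    have uZ: "cocycle b2 d2 n2 u" using u by (simp add: cocycles_iff[OF C2])
    let ?ug = "restrict (\<lambda>x. u (g x)) (vecs (b3 n3))"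
    have ug: "?ug \<in> cocycles R b3 d3 kk n3"
      using gZ[OF uZ] by (simp add: cocycles_iff[OF C3] cocycle_restrict[OF C3])
    have "cohom_class b3 d3 n3 ?ug = coboundaries R b3 d3 kk n3"
      using TX unfolding Xu T'[OF u] by (simp add: residue_space_def hom_cohomology_def quotient_module_def)
    then have "?ug \<in> coboundaries R b3 d3 kk n3"
      using coset_eq_zero_iff[OF cocycle_module_module[OF C3] coboundaries_submodule[OF C3], where x = ?ug] ug by simp
    then have "coboundary b3 d3 n3 (\<lambda>x. u (g x))"
      by (simp add: coboundaries_iff[OF C3] coboundary_restrict)
    from exact[OF uZ this] obtain w where w: "cocycle b1 d1 n1 w"
      "coboundary b2 d2 n2 (\<lambda>x. u x \<oplus>\<^bsub>kk\<^esub> \<ominus>\<^bsub>kk\<^esub> w (f x))" by auto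
    let ?w = "restrict w (vecs (b1 n1))"
    have wZ: "?w \<in> cocycles R b1 d1 kk n1"
      using w(1) by (simp add: cocycles_iff[OF C1] cocycle_restrict[OF C1])
    define wf where "wf = restrict (\<lambda>x. w (f x)) (vecs (b2 n2))"
    have wf: "wf \<in> cocycles R b2 d2 kk n2"
      using fZ[OF w(1)] by (simp add: wf_def cocycles_iff[OF C2] cocycle_restrict[OF C2])
    have wf_eq: "restrict (\<lambda>x. ?w (f x)) (vecs (b2 n2)) = wf"
      using lin_closed[OF f] by (auto simp: wf_def intro!: restrict_ext)
    interpret Z2: Module.module R "cocycle_module b2 d2 n2" by (rule cocycle_module_module[OF C2])
    interpret kk: Module.module R kk by (rule kk_module)
    have wfl: "(\<lambda>x. w (f x)) \<in> lin_maps R (FF (b2 n2)) kk"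
      using fZ[OF w(1)] by (simp add: cocycle_def)
    let ?n = "restrict (\<lambda>x. \<ominus>\<^bsub>kk\<^esub> w (f x)) (vecs (b2 n2))"
    \<comment> \<open>By uniqueness of inverses the negative in \<open>cocycle_module\<close> is the
      pointwise one, which matches equality of cosets with the pointwise difference in
      \<open>w(2)\<close>.\<close>
    have "\<ominus>\<^bsub>cocycle_module b2 d2 n2\<^esub> wf = ?n"
    proof (rule Z2.M.minus_equality)
      show "?n \<oplus>\<^bsub>cocycle_module b2 d2 n2\<^esub> wf = \<zero>\<^bsub>cocycle_module b2 d2 n2\<^esub>"
        using lin_closed[OF wfl] by (auto simp: cochain_simps wf_def kk.l_neg intro!: restrict_ext)
      show "?n \<in> carrier (cocycle_module b2 d2 n2)"
        using cocycle_uminus[OF fZ[OF w(1)]] by (simp add: cocycles_iff[OF C2] cocycle_restrict[OF C2])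
    qed (simp add: wf)
    then have "u \<oplus>\<^bsub>cocycle_module b2 d2 n2\<^esub> \<ominus>\<^bsub>cocycle_module b2 d2 n2\<^esub> wf =
      restrict (\<lambda>x. u x \<oplus>\<^bsub>kk\<^esub> \<ominus>\<^bsub>kk\<^esub> w (f x)) (vecs (b2 n2))"
      by (auto simp: cochain_simps intro!: restrict_ext)
    then have "u \<oplus>\<^bsub>cocycle_module b2 d2 n2\<^esub> \<ominus>\<^bsub>cocycle_module b2 d2 n2\<^esub> wf \<in> coboundaries R b2 d2 kk n2"
      using w(2) by (simp add: coboundaries_iff[OF C2] coboundary_restrict)
    then have "X = S (cohom_class b1 d1 n1 ?w)"
      unfolding Xu S'[OF wZ] wf_eq
      using coset_eq_iff[OF cocycle_module_module[OF C2] coboundaries_submodule[OF C2], where x = u and y = wf] u wf by simp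
    then show "X \<in> S ` carrier (cohom_space b1 d1 n1)"
      using wZ unfolding carr[OF C1] by blast
  qed (use fin_dim_hom_cohomology C1 C2 C3 in auto)
qed

lemma cohom_dim_eq_0:
  assumes C: "free_complex b d" and Z: "\<And>u. cocycle b d n u \<Longrightarrow> coboundary b d n u"
  shows "cohom_dim b d n = 0"
proof -
  let ?V = "cohom_space b d n"
  interpret V: vectorspace KK ?V by (rule residue_space_vectorspace[OF killed_hom_cohomology[OF C]])
  have "carrier ?V \<subseteq> {\<zero>\<^bsub>?V\<^esub>}"
    using Z quotient_module_carrier[OF cocycle_module_module[OF C] coboundaries_submodule[OF C], of n]
      coset_eq_zero_iff[OF cocycle_module_module[OF C] coboundaries_submodule[OF C], of _ n]
    by (auto simp: residue_space_def hom_cohomology_def quotient_module_zero[OF cocycle_module_module[OF C] coboundaries_submodule[OF C]]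
      cocycles_iff[OF C] coboundaries_iff[OF C])
  then have "carrier ?V = {\<zero>\<^bsub>?V\<^esub>}" using V.zero_closed by blast
  moreover have "V.span {} = {\<zero>\<^bsub>?V\<^esub>}" by (rule V.span_empty)
  ultimately have "V.dim \<le> card ({}::((nat \<Rightarrow> 'a) \<Rightarrow> 'a set) set set)"
    by (intro V.gen_ge_dim) auto
  then show ?thesis by simp
qed

end

section \<open>Lifting chain maps and homotopies\<close>

context noetherian_local_ring
begin

interpretation fm: Module.module R "FF n" for n by (rule FF_module)
interpretation kk: Module.module R kk by (rule kk_module)

lemma kk_minus_zero: "\<ominus>\<^bsub>kk\<^esub> \<zero>\<^bsub>kk\<^esub> = \<zero>\<^bsub>kk\<^esub>"
  by (rule kk.minus_equality) auto

text \<open>A free resolution whose augmentation need not be onto. This makes the notion stable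
  under dropping degree 0, where \<open>d 0\<close> becomes the augmentation, with values in
  \<open>FF (b 0)\<close>.\<close>

definition exact_aug ::
  "('a, 'm, 'c) module_scheme \<Rightarrow> (nat \<Rightarrow> nat) \<Rightarrow> (nat \<Rightarrow> (nat \<Rightarrow> 'a) \<Rightarrow> (nat \<Rightarrow> 'a)) \<Rightarrow>
    ((nat \<Rightarrow> 'a) \<Rightarrow> 'm) \<Rightarrow> bool" where
  "exact_aug X b d e \<longleftrightarrow> Module.module R X \<and> free_complex b d \<and>
     e \<in> lin_maps R (FF (b 0)) X \<and>
     (\<forall>x \<in> vecs (b (Suc 0)). e (d 0 x) = \<zero>\<^bsub>X\<^esub>) \<and>
     (\<forall>x \<in> vecs (b 0). e x = \<zero>\<^bsub>X\<^esub> \<longrightarrow> x \<in> d 0 ` vecs (b (Suc 0))) \<and>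
     (\<forall>n. \<forall>x \<in> vecs (b (Suc n)). d n x = \<zero>\<^bsub>FF (b n)\<^esub> \<longrightarrow>
        x \<in> d (Suc n) ` vecs (b (Suc (Suc n))))"

lemma free_resolution_exact_augmented:
  "Module.module R M \<Longrightarrow> free_resolution R M b d e \<Longrightarrow> exact_aug M b d e"
  using free_resolution_complex[of M b d e]
  unfolding free_resolution_def exact_aug_def by auto

text \<open>A homotopy raises the degree by one, so it is a lift into the resolution shifted in this
  way.\<close>

lemma exact_aug_shift:
  assumes "exact_aug X b d e"
  shows "exact_aug (FF (b 0)) (\<lambda>n. b (Suc n)) (\<lambda>n. d (Suc n)) (d 0)"
  using assms FF_module unfolding exact_aug_def free_complex_def by auto

text \<open>A map that commutes with the negated differential anticommutes with the original one;
  one lifting lemma thus serves chain maps, homotopies and connecting maps.\<close>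

lemma free_complex_uminus:
  assumes "free_complex p a" shows "free_complex p (\<lambda>n x. \<ominus>\<^bsub>FF (p n)\<^esub> a n x)"
  using assms lin_neg[OF FF_module FF_module free_complex_lin[OF assms]]
    free_complex_closed[OF assms]
  by (auto simp: free_complex_def intro!: lin_uminus[OF FF_module])

text \<open>Solves d f = f a + c degree by degree for a prescribed correction \<open>c\<close>.
  Taking \<open>c\<close> zero gives chain maps; taking for it the map to be contracted gives
  homotopies; a third choice gives the twisted lift behind the long exact sequence. The assumptions
  on \<open>c\<close> say that the right-hand side is always a cycle.\<close>

lemma chain_lift:
  assumes A: "free_complex p a" and B: "exact_aug X b d e"
    and \<phi>: "\<phi> \<in> lin_maps R (FF (p 0)) X"
    and im: "\<And>x. x \<in> vecs (p 0) \<Longrightarrow> \<phi> x \<in> e ` vecs (b 0)"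
    and c: "\<And>n. c n \<in> lin_maps R (FF (p (Suc n))) (FF (b n))"
    and c0: "\<And>x. x \<in> vecs (p (Suc 0)) \<Longrightarrow> \<phi> (a 0 x) \<oplus>\<^bsub>X\<^esub> e (c 0 x) = \<zero>\<^bsub>X\<^esub>"
    and cS: "\<And>n x. x \<in> vecs (p (Suc (Suc n))) \<Longrightarrow>
       c n (a (Suc n) x) \<oplus>\<^bsub>FF (b n)\<^esub> d n (c (Suc n) x) = \<zero>\<^bsub>FF (b n)\<^esub>"
  obtains f where "\<And>n. f n \<in> lin_maps R (FF (p n)) (FF (b n))"
    and "\<And>x. x \<in> vecs (p 0) \<Longrightarrow> e (f 0 x) = \<phi> x"
    and "\<And>n x. x \<in> vecs (p (Suc n)) \<Longrightarrow>
      d n (f (Suc n) x) = f n (a n x) \<oplus>\<^bsub>FF (b n)\<^esub> c n x"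
proof -
  have X: "Module.module R X" and e: "e \<in> lin_maps R (FF (b 0)) X" and C: "free_complex b d"
    using B by (auto simp: exact_aug_def)
  interpret X: Module.module R X by (rule X)
  note a = free_complex_lin[OF A] and d = free_complex_lin[OF C]
  note [simp] = lin_closed[OF a] lin_closed[OF d] lin_closed[OF c] lin_closed[OF e]
    lin_add[OF d] lin_add[OF e]
  \<comment> \<open>\<open>P\<close> carries, beside linearity, the solvability of the next
    equation, and for n = 0 the compatibility with the augmentation; \<open>Q\<close> is the
    equation linking two successive stages.\<close>
  define P where "P n f \<longleftrightarrow> f \<in> lin_maps R (FF (p n)) (FF (b n)) \<and>
    (n = 0 \<longrightarrow> (\<forall>x \<in> vecs (p 0). e (f x) = \<phi> x)) \<and>
    (\<forall>x \<in> vecs (p (Suc n)).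
       f (a n x) \<oplus>\<^bsub>FF (b n)\<^esub> c n x \<in> d n ` vecs (b (Suc n)))" for n f
  define Q where "Q n f f' \<longleftrightarrow> (\<forall>x \<in> vecs (p (Suc n)).
     d n (f' x) = f (a n x) \<oplus>\<^bsub>FF (b n)\<^esub> c n x)" for n f f'
  have "\<exists>f. \<forall>n. P n (f n) \<and> Q n (f n) (f (Suc n))"
  proof (rule dependent_nat_choice)
    obtain f where f: "f \<in> lin_maps R (FF (p 0)) (FF (b 0))"
      "\<And>x. x \<in> vecs (p 0) \<Longrightarrow> e (f x) = \<phi> x"
      using free_module_lift[OF FF_module X \<phi> e im] by auto
    note [simp] = lin_closed[OF f(1)]
    have "f (a 0 x) \<oplus>\<^bsub>FF (b 0)\<^esub> c 0 x \<in> d 0 ` vecs (b (Suc 0))"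
      if x: "x \<in> vecs (p (Suc 0))" for x
    proof -
      have "e (f (a 0 x) \<oplus>\<^bsub>FF (b 0)\<^esub> c 0 x) = \<zero>\<^bsub>X\<^esub>"
        using x c0[OF x] by (simp add: f(2))
      then show ?thesis using B x by (simp add: exact_aug_def)
    qed
    then have "P 0 f" using f unfolding P_def by simp
    then show "\<exists>f. P 0 f" by blast
  next
    fix f n assume Pf: "P n f"
    have f: "f \<in> lin_maps R (FF (p n)) (FF (b n))" using Pf by (simp add: P_def)
    have "(\<lambda>x. f (a n x) \<oplus>\<^bsub>FF (b n)\<^esub> c n x) \<in> lin_maps R (FF (p (Suc n))) (FF (b n))"
      by (intro lin_plus FF_module c lin_comp[OF a f])
    from free_module_lift[OF FF_module FF_module this d]
    obtain f' where f': "f' \<in> lin_maps R (FF (p (Suc n))) (FF (b (Suc n)))"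
      "\<And>x. x \<in> vecs (p (Suc n)) \<Longrightarrow> d n (f' x) = f (a n x) \<oplus>\<^bsub>FF (b n)\<^esub> c n x"
      using Pf unfolding P_def by auto
    note [simp] = lin_closed[OF f] lin_closed[OF f'(1)]
    have "f' (a (Suc n) x) \<oplus>\<^bsub>FF (b (Suc n))\<^esub> c (Suc n) x \<in> d (Suc n) ` vecs (b (Suc (Suc n)))"
      if x: "x \<in> vecs (p (Suc (Suc n)))" for x
    proof -
      have "a n (a (Suc n) x) = \<zero>\<^bsub>FF (p n)\<^esub>" using A x by (simp add: free_complex_def)
      \<comment> \<open>Expanding with the equation for \<open>f'\<close>, the term with a a
        vanishes and the two terms with \<open>c\<close> cancel by \<open>cS\<close>. Exactness then
        makes the next equation solvable.\<close>
      then have "d n (f' (a (Suc n) x) \<oplus>\<^bsub>FF (b (Suc n))\<^esub> c (Suc n) x) = \<zero>\<^bsub>FF (b n)\<^esub>"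
        using x cS[OF x] lin_zero[OF FF_module FF_module f]
        by (simp add: f'(2) fm.a_assoc)
      then show ?thesis using B x by (simp add: exact_aug_def)
    qed
    then have "P (Suc n) f' \<and> Q n f f'" using f' unfolding P_def Q_def by simp
    then show "\<exists>f'. P (Suc n) f' \<and> Q n f f'" by blast
  qed
  then obtain f where "\<And>n. P n (f n)" "\<And>n. Q n (f n) (f (Suc n))" by auto
  then show ?thesis by (intro that[of f]) (auto simp: P_def Q_def)
qed

lemma chain_map_lift:
  assumes A: "free_complex p a" and B: "exact_aug X b d e"
    and \<phi>: "\<phi> \<in> lin_maps R (FF (p 0)) X"
    and im: "\<And>x. x \<in> vecs (p 0) \<Longrightarrow> \<phi> x \<in> e ` vecs (b 0)"
    and \<phi>a: "\<And>x. x \<in> vecs (p (Suc 0)) \<Longrightarrow> \<phi> (a 0 x) = \<zero>\<^bsub>X\<^esub>"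
  obtains f where "\<And>n. f n \<in> lin_maps R (FF (p n)) (FF (b n))"
    and "\<And>x. x \<in> vecs (p 0) \<Longrightarrow> e (f 0 x) = \<phi> x"
    and "\<And>n x. x \<in> vecs (p (Suc n)) \<Longrightarrow> d n (f (Suc n) x) = f n (a n x)"
proof -
  have X: "Module.module R X" and e: "e \<in> lin_maps R (FF (b 0)) X" and C: "free_complex b d"
    using B by (auto simp: exact_aug_def)
  interpret X: Module.module R X by (rule X)
  obtain f where f: "\<And>n. f n \<in> lin_maps R (FF (p n)) (FF (b n))"
    "\<And>x. x \<in> vecs (p 0) \<Longrightarrow> e (f 0 x) = \<phi> x"
    "\<And>n x. x \<in> vecs (p (Suc n)) \<Longrightarrow>
      d n (f (Suc n) x) = f n (a n x) \<oplus>\<^bsub>FF (b n)\<^esub> \<zero>\<^bsub>FF (b n)\<^esub>"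
    using chain_lift[OF A B \<phi> im, of "\<lambda>n x. \<zero>\<^bsub>FF (b n)\<^esub>"]
      lin_const_zero[OF FF_module] \<phi>a
      lin_zero[OF FF_module X e]
      lin_zero[OF FF_module FF_module free_complex_lin[OF C]]
    by auto
  show ?thesis
  proof (rule that[OF f(1) f(2)])
    show "d n (f (Suc n) x) = f n (a n x)" if "x \<in> vecs (p (Suc n))" for n x
      using f(3)[OF that] lin_closed[OF f(1) free_complex_closed[OF A that]] by simp
  qed
qed

text \<open>Chain maps covering zero are null homotopic. The homotopy is a lift from the negated
  source to the shifted target, with \<open>w 0\<close> as initial map and the later
  \<open>w\<close> as corrections; the negation turns d t = w - t a into the shape solved by
  \<open>chain_lift\<close>.\<close>

lemma chain_homotopy:
  assumes A: "free_complex p a" and B: "exact_aug X b d e"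
    and w: "\<And>n. w n \<in> lin_maps R (FF (p n)) (FF (b n))"
    and w0: "\<And>x. x \<in> vecs (p 0) \<Longrightarrow> e (w 0 x) = \<zero>\<^bsub>X\<^esub>"
    and wS: "\<And>n x. x \<in> vecs (p (Suc n)) \<Longrightarrow> d n (w (Suc n) x) = w n (a n x)"
  obtains t where "\<And>n. t n \<in> lin_maps R (FF (p n)) (FF (b (Suc n)))"
    and "\<And>x. x \<in> vecs (p 0) \<Longrightarrow> d 0 (t 0 x) = w 0 x"
    and "\<And>n x. x \<in> vecs (p (Suc n)) \<Longrightarrow>
      d (Suc n) (t (Suc n) x) = w (Suc n) x \<oplus>\<^bsub>FF (b (Suc n))\<^esub> \<ominus>\<^bsub>FF (b (Suc n))\<^esub> t n (a n x)"
proof -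
  note ac = lin_closed[OF free_complex_lin[OF A]]
  have wneg: "w n (\<ominus>\<^bsub>FF (p n)\<^esub> x) = \<ominus>\<^bsub>FF (b n)\<^esub> w n x" if "x \<in> vecs (p n)" for n x
    using lin_neg[OF FF_module FF_module w that] .
  obtain t where t: "\<And>n. t n \<in> lin_maps R (FF (p n)) (FF (b (Suc n)))"
    "\<And>x. x \<in> vecs (p 0) \<Longrightarrow> d 0 (t 0 x) = w 0 x"
    "\<And>n x. x \<in> vecs (p (Suc n)) \<Longrightarrow>
      d (Suc n) (t (Suc n) x) = t n (\<ominus>\<^bsub>FF (p n)\<^esub> a n x) \<oplus>\<^bsub>FF (b (Suc n))\<^esub> w (Suc n) x"
  proof (rule chain_lift[OF free_complex_uminus[OF A] exact_aug_shift[OF B] w, where c = "\<lambda>n. w (Suc n)"])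
    show "w 0 x \<in> d 0 ` vecs (b (Suc 0))" if "x \<in> vecs (p 0)" for x
      using B w0[OF that] lin_closed[OF w that] by (simp add: exact_aug_def)
    show "w 0 (\<ominus>\<^bsub>FF (p 0)\<^esub> a 0 x) \<oplus>\<^bsub>FF (b 0)\<^esub> d 0 (w (Suc 0) x) = \<zero>\<^bsub>FF (b 0)\<^esub>"
      if "x \<in> vecs (p (Suc 0))" for x
      using that by (simp add: wneg wS ac fm.l_neg lin_closed[OF w])
    show "w (Suc n) (\<ominus>\<^bsub>FF (p (Suc n))\<^esub> a (Suc n) x) \<oplus>\<^bsub>FF (b (Suc n))\<^esub> d (Suc n) (w (Suc (Suc n)) x)
        = \<zero>\<^bsub>FF (b (Suc n))\<^esub>"
      if "x \<in> vecs (p (Suc (Suc n)))" for n x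
      using that by (simp add: wneg wS ac fm.l_neg lin_closed[OF w])
  qed (use w in auto)
  show ?thesis
  proof (rule that[OF t(1) t(2)])
    show "d (Suc n) (t (Suc n) x) = w (Suc n) x \<oplus>\<^bsub>FF (b (Suc n))\<^esub> \<ominus>\<^bsub>FF (b (Suc n))\<^esub> t n (a n x)"
      if "x \<in> vecs (p (Suc n))" for n x
      using that t(3)[OF that] lin_neg[OF FF_module FF_module t(1) ac[OF that]]
        lin_closed[OF w that] lin_closed[OF t(1) ac[OF that]]
      by (simp add: fm.a_comm)
  qed
qed

text \<open>Uniqueness of lifts up to homotopy: id - \<open>W\<close> covers zero, so it equals d t
  + t d, and a cocycle \<open>u\<close> kills the first summand. What remains, u t d, is a
  coboundary, and in degree 0 it is absent.\<close>

lemma cocycle_chain_self_map: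
  assumes B: "exact_aug X b d e"
    and W: "\<And>n. W n \<in> lin_maps R (FF (b n)) (FF (b n))"
    and W0: "\<And>x. x \<in> vecs (b 0) \<Longrightarrow> e (W 0 x) = e x"
    and WS: "\<And>n x. x \<in> vecs (b (Suc n)) \<Longrightarrow> d n (W (Suc n) x) = W n (d n x)"
    and u: "cocycle b d n u"
  shows "coboundary b d n (\<lambda>x. u x \<oplus>\<^bsub>kk\<^esub> \<ominus>\<^bsub>kk\<^esub> u (W n x))"
proof -
  have X: "Module.module R X" and e: "e \<in> lin_maps R (FF (b 0)) X" and C: "free_complex b d"
    using B by (auto simp: exact_aug_def)
  interpret X: Module.module R X by (rule X)
  note d = free_complex_lin[OF C]
  have ul: "u \<in> lin_maps R (FF (b n)) kk" using u by (simp add: cocycle_def)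
  note [simp] = lin_closed[OF d] lin_closed[OF W] lin_closed[OF e] lin_closed[OF ul]
    lin_add[OF d] lin_add[OF e] lin_add[OF ul]
    lin_neg[OF FF_module FF_module d]
    lin_neg[OF FF_module X e] lin_neg[OF FF_module kk_module ul]
  define w where "w n x = x \<oplus>\<^bsub>FF (b n)\<^esub> \<ominus>\<^bsub>FF (b n)\<^esub> W n x" for n x
  have uw: "u (w n x) = u x \<oplus>\<^bsub>kk\<^esub> \<ominus>\<^bsub>kk\<^esub> u (W n x)" if "x \<in> vecs (b n)" for x
    using that by (simp add: w_def)
  obtain t where t: "\<And>n. t n \<in> lin_maps R (FF (b n)) (FF (b (Suc n)))"
    "\<And>x. x \<in> vecs (b 0) \<Longrightarrow> d 0 (t 0 x) = w 0 x"
    "\<And>n x. x \<in> vecs (b (Suc n)) \<Longrightarrow>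
      d (Suc n) (t (Suc n) x) = w (Suc n) x \<oplus>\<^bsub>FF (b (Suc n))\<^esub> \<ominus>\<^bsub>FF (b (Suc n))\<^esub> t n (d n x)"
  proof (rule chain_homotopy[OF C B, where w = w])
    show "w n \<in> lin_maps R (FF (b n)) (FF (b n))" for n
      unfolding w_def by (intro lin_plus lin_uminus lin_id W FF_module)
  qed (auto simp: w_def W0 WS X.r_neg)
  note [simp] = lin_closed[OF t(1)]
  have ud: "u (d n x) = \<zero>\<^bsub>kk\<^esub>" if "x \<in> vecs (b (Suc n))" for x
    using u that by (simp add: cocycle_def)
  show ?thesis
  proof (cases n)
    case 0
    have "u x \<oplus>\<^bsub>kk\<^esub> \<ominus>\<^bsub>kk\<^esub> u (W n x) = \<zero>\<^bsub>kk\<^esub>" if x: "x \<in> vecs (b n)" for x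
      using uw[OF x] ud[of "t n x"] t(2)[of x] x 0 by simp
    then show ?thesis using 0 by (simp add: coboundary_def)
  next
    case (Suc m)
    have "u x \<oplus>\<^bsub>kk\<^esub> \<ominus>\<^bsub>kk\<^esub> u (W n x) = u (t m (d m x))" if x: "x \<in> vecs (b n)" for x
    proof -
      have wc: "w n x \<in> vecs (b n)" using x by (simp add: w_def)
      have "w n x = d n (t n x) \<oplus>\<^bsub>FF (b n)\<^esub> t m (d m x)"
        using t(3)[of x m] x wc Suc by (simp add: fm.a_assoc fm.l_neg)
      then show ?thesis
        using uw[OF x] ud[of "t n x"] x Suc lin_closed[OF ul[unfolded Suc]]
        by (simp add: lin_add[OF ul[unfolded Suc]])
    qed
    moreover have "(\<lambda>x. u (t m x)) \<in> lin_maps R (FF (b m)) kk"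
      using lin_comp[OF t(1)[of m]] ul Suc by simp
    ultimately show ?thesis using Suc by (auto simp: coboundary_def)
  qed
qed

text \<open>Let \<open>W\<close> be \<rho> in degree 0 and zero above. As \<rho> kills boundaries,
  \<open>W\<close> is a self-map over the identity, so a cocycle of positive degree is cohomologous
  to its composite with zero. Such a \<rho> arises when the augmented module splits off
  \<open>FF (b 0)\<close>.\<close>

lemma contractible_cohom_dim_eq_0:
  assumes B: "exact_aug X b d e"
    and \<rho>: "\<rho> \<in> lin_maps R (FF (b 0)) (FF (b 0))"
    and e\<rho>: "\<And>x. x \<in> vecs (b 0) \<Longrightarrow> e (\<rho> x) = e x"
    and \<rho>d: "\<And>x. x \<in> vecs (b (Suc 0)) \<Longrightarrow> \<rho> (d 0 x) = \<zero>\<^bsub>FF (b 0)\<^esub>"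
  shows "cohom_dim b d (Suc n) = 0"
proof -
  have C: "free_complex b d" using B by (auto simp: exact_aug_def)
  note d = free_complex_lin[OF C]
  note dz = lin_zero[OF FF_module FF_module d]
  define W where "W = (\<lambda>n x. if n = 0 then \<rho> x else \<zero>\<^bsub>FF (b n)\<^esub>)"
  have W: "W n \<in> lin_maps R (FF (b n)) (FF (b n))" for n
    using \<rho> lin_const_zero[OF FF_module] by (cases n) (auto simp: W_def)
  have "coboundary b d (Suc n) u" if u: "cocycle b d (Suc n) u" for u
  proof -
    have ul: "u \<in> lin_maps R (FF (b (Suc n))) kk" using u by (simp add: cocycle_def)
    have "coboundary b d (Suc n) (\<lambda>x. u x \<oplus>\<^bsub>kk\<^esub> \<ominus>\<^bsub>kk\<^esub> u (W (Suc n) x))"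
      by (rule cocycle_chain_self_map[OF B W _ _ u]) (auto simp: W_def e\<rho> \<rho>d dz)
    then show ?thesis
      using lin_zero[OF FF_module kk_module ul] lin_closed[OF ul] kk_minus_zero
      by (simp add: coboundary_def W_def)
  qed
  then show ?thesis by (rule cohom_dim_eq_0[OF C])
qed

end

section \<open>Pullback along chain maps and the connecting map of an extension\<close>

context noetherian_local_ring
begin

interpretation fm: Module.module R "FF n" for n by (rule FF_module)
interpretation kk: Module.module R kk by (rule kk_module)
interpretation mm: maximalideal \<mm> R by (rule maximal_ideal)

lemma free_module_minus_zero:
  "\<ominus>\<^bsub>FF n\<^esub> \<zero>\<^bsub>FF n\<^esub> = \<zero>\<^bsub>FF n\<^esub>"
  by (rule fm.minus_equality) auto

text \<open>Where \<open>e\<close> vanishes, the lift takes values in \<mm>. Multiplying it by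
  \<open>z\<close> then uses the inclusion of z\<mm> in the ideal.\<close>

lemma residue_lift:
  assumes "e \<in> lin_maps R (FF n) kk"
  obtains e' where "e' \<in> lin_maps R (FF n) (regular_module R)"
    and "\<And>x. x \<in> vecs n \<Longrightarrow> \<mm> +> e' x = e x"
  using free_module_lift[OF regular_module kk_module assms kk_coset_lin] lin_closed[OF assms]
  by (auto simp: kk_carrier)

lemma chain_map_pullback:
  assumes C: "free_complex b d" and C': "free_complex b' d'"
    and f: "\<And>n. f n \<in> lin_maps R (FF (b' n)) (FF (b n))"
    and fd: "\<And>n x. x \<in> vecs (b' (Suc n)) \<Longrightarrow> d n (f (Suc n) x) = f n (d' n x)"
  shows "cocycle b d n u \<Longrightarrow> cocycle b' d' n (\<lambda>x. u (f n x))"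
    and "coboundary b d n u \<Longrightarrow> coboundary b' d' n (\<lambda>x. u (f n x))"
proof -
  note fc = lin_closed[OF f]
  show "cocycle b' d' n (\<lambda>x. u (f n x))" if "cocycle b d n u"
    using that fc by (auto simp: cocycle_def simp flip: fd intro!: lin_comp[OF f])
  show "coboundary b' d' n (\<lambda>x. u (f n x))" if u: "coboundary b d n u"
  proof (cases n)
    case 0 then show ?thesis using u fc by (auto simp: coboundary_def)
  next
    case (Suc m)
    then obtain v where v: "v \<in> lin_maps R (FF (b m)) kk"
      "\<And>x. x \<in> vecs (b n) \<Longrightarrow> u x = v (d m x)" using u by (auto simp: coboundary_def)
    show ?thesis using v fc Suc lin_comp[OF f v(1)]
      by (auto simp: coboundary_def fd intro!: bexI[of _ "\<lambda>x. v (f m x)"])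
  qed
qed

text \<open>A sign affects neither kernels nor images. A potential \<open>v\<close> pulls back to
  minus its composite with \<open>f\<close>; for n = 0 the coboundary is zero and the potential in
  the new degree is zero.\<close>

lemma anti_chain_map_pullback:
  assumes C: "free_complex b d" and C': "free_complex b' d'"
    and f: "\<And>n. f n \<in> lin_maps R (FF (b' (Suc n))) (FF (b n))"
    and fd: "\<And>n x. x \<in> vecs (b' (Suc (Suc n))) \<Longrightarrow>
      d n (f (Suc n) x) = \<ominus>\<^bsub>FF (b n)\<^esub> f n (d' (Suc n) x)"
  shows "cocycle b d n u \<Longrightarrow> cocycle b' d' (Suc n) (\<lambda>x. u (f n x))"
    and "coboundary b d n u \<Longrightarrow> coboundary b' d' (Suc n) (\<lambda>x. u (f n x))"
proof -
  note fc = lin_closed[OF f] and d'c = free_complex_closed[OF C'] and dc = free_complex_closed[OF C]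
  have fd': "f n (d' (Suc n) x) = \<ominus>\<^bsub>FF (b n)\<^esub> d n (f (Suc n) x)"
    if "x \<in> vecs (b' (Suc (Suc n)))" for n x
    using fd[OF that] fc d'c that by simp
  show "cocycle b' d' (Suc n) (\<lambda>x. u (f n x))" if "cocycle b d n u"
    using that fc dc lin_neg[OF FF_module kk_module, of u "b n"]
    by (auto simp: cocycle_def fd' kk_minus_zero intro!: lin_comp[OF f])
  show "coboundary b' d' (Suc n) (\<lambda>x. u (f n x))" if u: "coboundary b d n u"
  proof (cases n)
    case 0 then show ?thesis using u fc lin_const_zero[OF kk_module]
      by (auto simp: coboundary_def intro!: bexI[of _ "\<lambda>x. \<zero>\<^bsub>kk\<^esub>"])
  next
    case (Suc m)
    then obtain v where v: "v \<in> lin_maps R (FF (b m)) kk"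
      "\<And>x. x \<in> vecs (b n) \<Longrightarrow> u x = v (d m x)" using u by (auto simp: coboundary_def)
    have "u (f n x) = \<ominus>\<^bsub>kk\<^esub> v (f m (d' (Suc m) x))" if "x \<in> vecs (b' (Suc n))" for x
      using that v(2)[OF fc[OF that]] Suc fc d'c
      by (simp add: fd lin_neg[OF FF_module kk_module v(1)])
    then show ?thesis using Suc lin_uminus[OF kk_module lin_comp[OF f v(1)]]
      by (auto simp: coboundary_def)
  qed
qed

text \<open>The lift is made to anticommute with the differentials; this removes all signs from the
  homotopy identities built on it.\<close>

lemma connecting_anti_chain_map:
  assumes F: "exact_aug kk bF dF eF"
    and J: "ideal J R" and G: "free_resolution R (ideal_module R J) bG dG eG"
    and z: "z \<in> carrier R" and zm: "\<And>a. a \<in> \<mm> \<Longrightarrow> z \<otimes> a \<in> J"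
    and e': "e' \<in> lin_maps R (FF (bF 0)) (regular_module R)"
      "\<And>x. x \<in> vecs (bF 0) \<Longrightarrow> \<mm> +> e' x = eF x"
  obtains \<alpha> where "\<And>n. \<alpha> n \<in> lin_maps R (FF (bF (Suc n))) (FF (bG n))"
    and "\<And>x. x \<in> vecs (bF (Suc 0)) \<Longrightarrow> eG (\<alpha> 0 x) = z \<otimes> e' (dF 0 x)"
    and "\<And>n x. x \<in> vecs (bF (Suc (Suc n))) \<Longrightarrow>
      dG n (\<alpha> (Suc n) x) = \<ominus>\<^bsub>FF (bG n)\<^esub> \<alpha> n (dF (Suc n) x)"
proof -
  interpret J: ideal J R by (rule J)
  have C: "free_complex bF dF" using F by (simp add: exact_aug_def)
  have C': "free_complex (\<lambda>n. bF (Suc n)) (\<lambda>n. dF (Suc n))" using C by (simp add: free_complex_def)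
  note dF = free_complex_lin[OF C] and dFc = free_complex_closed[OF C]
  have e'c: "e' x \<in> carrier R" if "x \<in> vecs (bF 0)" for x
    using lin_closed[OF e'(1) that] by simp
  have mem: "z \<otimes> e' (dF 0 x) \<in> J" if "x \<in> vecs (bF (Suc 0))" for x
  proof -
    have "eF (dF 0 x) = \<mm>" using F that by (simp add: exact_aug_def kk_zero)
    then have "e' (dF 0 x) \<in> \<mm>"
      using e'(2)[of "dF 0 x"] dFc[OF that] kk_coset_eq_zero[OF e'c] by simp
    then show ?thesis by (rule zm)
  qed
  have surj: "eG ` vecs (bG 0) = J" using G by (simp add: free_resolution_def)
  \<comment> \<open>The extension class on the first free module of the resolution of k: a generator
    of k is lifted to \<open>z\<close>, and boundaries then go to multiples of \<open>z\<close> that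
    lie in \<open>J\<close>.\<close>
  have \<phi>: "(\<lambda>x. z \<otimes> e' (dF 0 x)) \<in> lin_maps R (FF (bF (Suc 0))) (ideal_module R J)"
    by (rule linI)
      (use z dFc e'c in \<open>auto simp: mem lin_add[OF dF] lin_smult[OF dF] lin_add[OF e'(1)]
         lin_smult[OF e'(1)] r_distr m_lcomm\<close>)
  obtain \<alpha> where \<alpha>: "\<And>n. \<alpha> n \<in> lin_maps R (FF (bF (Suc n))) (FF (bG n))"
    "\<And>x. x \<in> vecs (bF (Suc 0)) \<Longrightarrow> eG (\<alpha> 0 x) = z \<otimes> e' (dF 0 x)"
    "\<And>n x. x \<in> vecs (bF (Suc (Suc n))) \<Longrightarrow>
      dG n (\<alpha> (Suc n) x) = \<alpha> n (\<ominus>\<^bsub>FF (bF (Suc n))\<^esub> dF (Suc n) x)"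
  \<comment> \<open>The source is the resolution of k without its degree 0 and with negated
    differential, so commuting means anticommuting for \<open>dF\<close>.\<close>
  proof (rule chain_map_lift[OF free_complex_uminus[OF C']
        free_resolution_exact_augmented[OF ideal_module_is_module[OF J] G] \<phi>])
    show "z \<otimes> e' (dF 0 x) \<in> eG ` vecs (bG 0)" if "x \<in> vecs (bF (Suc 0))" for x
      using mem[OF that] surj by simp
    show "z \<otimes> e' (dF 0 (\<ominus>\<^bsub>FF (bF (Suc 0))\<^esub> dF (Suc 0) x)) = \<zero>\<^bsub>ideal_module R J\<^esub>"
      if x: "x \<in> vecs (bF (Suc (Suc 0)))" for x
    proof -
      have "dF 0 (dF (Suc 0) x) = \<zero>\<^bsub>FF (bF 0)\<^esub>" using C x by (simp add: free_complex_def)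
      then have "dF 0 (\<ominus>\<^bsub>FF (bF (Suc 0))\<^esub> dF (Suc 0) x) = \<zero>\<^bsub>FF (bF 0)\<^esub>"
        using lin_neg[OF FF_module FF_module dF dFc[OF x]]
        by (simp add: free_module_minus_zero)
      then show ?thesis
        using lin_zero[OF FF_module regular_module e'(1)] z by simp
    qed
  qed auto
  show ?thesis
    by (rule that[OF \<alpha>(1) \<alpha>(2)])
      (simp_all add: \<alpha>(3) lin_neg[OF FF_module FF_module \<alpha>(1)] dFc)
qed

end

section \<open>Comparison of resolutions of the residue field and of ideals\<close>

text \<open>Sorting sums by associativity and commutativity may leave opposite summands separated by
  another term. These rules cancel such pairs.\<close>

lemma (in abelian_group) cancel_opposite:
  assumes "a \<in> carrier G" "b \<in> carrier G"
  shows "a \<oplus> (b \<oplus> \<ominus> a) = b" "\<ominus> a \<oplus> (b \<oplus> a) = b"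
  using assms a_lcomm[of a b "\<ominus> a"] a_lcomm[of "\<ominus> a" b a] by (simp_all add: r_neg l_neg)

lemma (in abelian_group) cancel_opposite_left:
  assumes "a \<in> carrier G" "b \<in> carrier G" "c \<in> carrier G"
  shows "a \<oplus> (b \<oplus> (\<ominus> a \<oplus> c)) = b \<oplus> c" "\<ominus> a \<oplus> (b \<oplus> (a \<oplus> c)) = b \<oplus> c"
  using assms a_lcomm[of a b "\<ominus> a \<oplus> c"] a_lcomm[of "\<ominus> a" b "a \<oplus> c"]
  by (simp_all add: r_neg1 r_neg2)

context noetherian_local_ring
begin

interpretation fm: Module.module R "FF n" for n by (rule FF_module)
interpretation kk: Module.module R kk by (rule kk_module)
interpretation mm: maximalideal \<mm> R by (rule maximal_ideal)

text \<open>Exactness of Ext^m(I,k), Ext^(m+1)(k,k), Ext^(m+1)(I,k) at the middle term, where the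
  first map is pullback along \<alpha> and the second pullback along \<gamma>.\<close>

theorem cohom_dim_kk_le:
  assumes FR: "free_resolution R kk bF dF eF"
    and I: "ideal I R" and GR: "free_resolution R (ideal_module R I) bG dG eG"
    and z: "z \<in> carrier R" and zm: "\<And>a. a \<in> \<mm> \<Longrightarrow> z \<otimes> a \<in> I" and y: "y \<in> \<mm>"
    and \<mu>: "\<mu> \<in> lin_maps R (ideal_module R I) kk" and \<mu>zy: "\<mu> (z \<otimes> y) = \<mm> +> \<one>"
  shows "cohom_dim bF dF (Suc m) \<le> cohom_dim bG dG m + cohom_dim bG dG (Suc m)"
proof -
  note IM = ideal_module_is_module[OF I]
  interpret I: ideal I R by (rule I)
  have F: "exact_aug kk bF dF eF" by (rule free_resolution_exact_augmented[OF kk_module FR])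
  have G: "exact_aug (ideal_module R I) bG dG eG" by (rule free_resolution_exact_augmented[OF IM GR])
  have CF: "free_complex bF dF" and CG: "free_complex bG dG"
    using F G by (auto simp: exact_aug_def)
  have eF: "eF \<in> lin_maps R (FF (bF 0)) kk" and eG: "eG \<in> lin_maps R (FF (bG 0)) (ideal_module R I)"
    using F G by (auto simp: exact_aug_def)
  have eFsurj: "eF ` vecs (bF 0) = carrier kk" using FR by (simp add: free_resolution_def)
  note dF = free_complex_lin[OF CF] and dG = free_complex_lin[OF CG]
  have yR: "y \<in> carrier R" using mm.Icarr[OF y] .
  obtain e' where e': "e' \<in> lin_maps R (FF (bF 0)) (regular_module R)"
      "\<And>x. x \<in> vecs (bF 0) \<Longrightarrow> \<mm> +> e' x = eF x"
    by (rule residue_lift[OF eF]) blast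
  obtain \<alpha> where \<alpha>: "\<And>n. \<alpha> n \<in> lin_maps R (FF (bF (Suc n))) (FF (bG n))"
    and \<alpha>0: "\<And>x. x \<in> vecs (bF (Suc 0)) \<Longrightarrow> eG (\<alpha> 0 x) = z \<otimes> e' (dF 0 x)"
    and \<alpha>S: "\<And>n x. x \<in> vecs (bF (Suc (Suc n))) \<Longrightarrow>
      dG n (\<alpha> (Suc n) x) = \<ominus>\<^bsub>FF (bG n)\<^esub> \<alpha> n (dF (Suc n) x)"
    by (rule connecting_anti_chain_map[OF F I GR z zm e']) (assumption, assumption, rule that)
  obtain \<gamma> where \<gamma>: "\<And>n. \<gamma> n \<in> lin_maps R (FF (bG n)) (FF (bF n))"
    and \<gamma>0: "\<And>x. x \<in> vecs (bG 0) \<Longrightarrow> eF (\<gamma> 0 x) = \<mu> (eG x)"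
    and \<gamma>S: "\<And>n x. x \<in> vecs (bG (Suc n)) \<Longrightarrow> dF n (\<gamma> (Suc n) x) = \<gamma> n (dG n x)"
  proof (rule chain_map_lift[OF CG F lin_comp[OF eG \<mu>]])
    show "\<mu> (eG x) \<in> eF ` vecs (bF 0)" if "x \<in> vecs (bG 0)" for x
      unfolding eFsurj using lin_closed[OF \<mu> lin_closed[OF eG that]] .
    show "\<mu> (eG (dG 0 x)) = \<zero>\<^bsub>kk\<^esub>" if "x \<in> vecs (bG (Suc 0))" for x
      using G that lin_zero[OF IM kk_module \<mu>] by (simp add: exact_aug_def)
  qed auto
  define \<theta> where "\<theta> n x = \<gamma> n (\<alpha> n x)" for n x
  have \<theta>: "\<theta> n \<in> lin_maps R (FF (bF (Suc n))) (FF (bF n))" for n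
    unfolding \<theta>_def by (rule lin_comp[OF \<alpha> \<gamma>])
  note neg = lin_neg[OF FF_module FF_module]
  have \<theta>S: "dF n (\<theta> (Suc n) x) = \<ominus>\<^bsub>FF (bF n)\<^esub> \<theta> n (dF (Suc n) x)"
    if x: "x \<in> vecs (bF (Suc (Suc n)))" for n x
    using x lin_closed[OF \<alpha>] lin_closed[OF dF] by (simp add: \<theta>_def \<gamma>S \<alpha>S neg[OF \<gamma>])
  obtain h where h: "\<And>n. h n \<in> lin_maps R (FF (bF n)) (FF (bF (Suc n)))"
    and h0: "\<And>x. x \<in> vecs (bF 0) \<Longrightarrow> dF 0 (h 0 x) = y \<odot>\<^bsub>FF (bF 0)\<^esub> x"
    and hS: "\<And>n x. x \<in> vecs (bF (Suc n)) \<Longrightarrow>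
      dF (Suc n) (h (Suc n) x) = y \<odot>\<^bsub>FF (bF (Suc n))\<^esub> x \<oplus>\<^bsub>FF (bF (Suc n))\<^esub>
         \<ominus>\<^bsub>FF (bF (Suc n))\<^esub> h n (dF n x)"
  proof (rule chain_homotopy[OF CF F, where w = "\<lambda>n x. y \<odot>\<^bsub>FF (bF n)\<^esub> x"])
    show "(\<lambda>x. y \<odot>\<^bsub>FF (bF n)\<^esub> x) \<in> lin_maps R (FF (bF n)) (FF (bF n))" for n
      by (rule lin_scale[OF FF_module lin_id yR])
    show "eF (y \<odot>\<^bsub>FF (bF 0)\<^esub> x) = \<zero>\<^bsub>kk\<^esub>" if "x \<in> vecs (bF 0)" for x
      using that yR by (simp add: lin_smult[OF eF] kk_smult_mm[OF y] lin_closed[OF eF])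
  qed (auto simp: lin_smult[OF dF] yR)
  note [simp] = lin_closed[OF dF] lin_closed[OF h] lin_closed[OF \<theta>] yR
    lin_add[OF dF] lin_add[OF \<theta>] neg[OF dF] neg[OF \<theta>] lin_smult[OF \<theta>]
  \<comment> \<open>This is \<theta>h + h\<theta>. In degree 0 the second summand is absent, since
    \<theta> starts on degree 1 of F.\<close>
  define D where "D = (\<lambda>n x. case n of 0 \<Rightarrow> \<theta> 0 (h 0 x)
    | Suc k \<Rightarrow> \<theta> n (h n x) \<oplus>\<^bsub>FF (bF n)\<^esub> h k (\<theta> k x))"
  have D: "D n \<in> lin_maps R (FF (bF n)) (FF (bF n))" for n
    using lin_comp[OF h \<theta>, of n] lin_comp[OF \<theta> h]
    by (cases n) (auto simp: D_def intro!: lin_plus FF_module)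
  have D0: "eF (D 0 x) = eF x" if x: "x \<in> vecs (bF 0)" for x
  proof -
    have e'x: "e' x \<in> carrier R" using lin_closed[OF e'(1) x] by simp
    \<comment> \<open>\<gamma> covers \<mu>, \<alpha> covers multiplication by \<open>z\<close> on
      \<open>e'\<close> of a boundary, and the boundary of \<open>h 0 x\<close> is y x.\<close>
    have "eF (D 0 x) = \<mu> (z \<otimes> (y \<otimes> e' x))"
      using x lin_closed[OF \<alpha>, of _ 0] yR
      by (simp add: D_def \<theta>_def \<gamma>0 \<alpha>0 h0 lin_smult[OF e'(1)])
    also have "z \<otimes> (y \<otimes> e' x) = e' x \<otimes> (z \<otimes> y)" using z yR e'x by (simp add: m_ac)
    also have "\<mu> \<dots> = e' x \<odot>\<^bsub>kk\<^esub> (\<mm> +> \<one>)"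
      using lin_smult[OF \<mu> e'x, of "z \<otimes> y"] zm[OF y] \<mu>zy by simp
    also have "\<dots> = eF x" using e'x by (simp add: kk_smult e'(2)[OF x])
    finally show ?thesis .
  qed
  \<comment> \<open>d\<theta>h = -\<theta>dh = -y\<theta> + \<theta>hd and dh\<theta> = y\<theta> -
    hd\<theta> = y\<theta> + h\<theta>d. The two multiples of y\<theta> cancel. The case n = 0 is
    separate because one summand of \<open>D 0\<close> is missing.\<close>
  have DS: "dF n (D (Suc n) x) = D n (dF n x)" if x: "x \<in> vecs (bF (Suc n))" for n x
  proof (cases n)
    case 0
    have "dF 0 (D (Suc 0) x) = \<ominus>\<^bsub>FF (bF 0)\<^esub> \<theta> 0 (dF (Suc 0) (h (Suc 0) x))
       \<oplus>\<^bsub>FF (bF 0)\<^esub> y \<odot>\<^bsub>FF (bF 0)\<^esub> \<theta> 0 x"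
      using x 0 by (simp add: D_def \<theta>S h0)
    also have "\<dots> = \<theta> 0 (h 0 (dF 0 x))"
      using x 0 by (simp add: hS fm.minus_add fm.a_ac fm.r_neg fm.r_neg1 fm.r_neg2 fm.l_neg)
    finally show ?thesis using 0 by (simp add: D_def)
  next
    case (Suc k)
    have "dF n (D (Suc n) x) = \<ominus>\<^bsub>FF (bF n)\<^esub> \<theta> n (dF (Suc n) (h (Suc n) x))
       \<oplus>\<^bsub>FF (bF n)\<^esub> (y \<odot>\<^bsub>FF (bF n)\<^esub> \<theta> n x \<oplus>\<^bsub>FF (bF n)\<^esub>
         \<ominus>\<^bsub>FF (bF n)\<^esub> h k (dF k (\<theta> n x)))"
      using x Suc by (simp add: D_def \<theta>S hS)
    also have "\<ominus>\<^bsub>FF (bF n)\<^esub> h k (dF k (\<theta> n x)) = h k (\<theta> k (dF n x))"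
      using x Suc by (simp add: \<theta>S neg[OF h])
    also have "\<ominus>\<^bsub>FF (bF n)\<^esub> \<theta> n (dF (Suc n) (h (Suc n) x))
       \<oplus>\<^bsub>FF (bF n)\<^esub> (y \<odot>\<^bsub>FF (bF n)\<^esub> \<theta> n x \<oplus>\<^bsub>FF (bF n)\<^esub> h k (\<theta> k (dF n x)))
      = \<theta> n (h n (dF n x)) \<oplus>\<^bsub>FF (bF n)\<^esub> h k (\<theta> k (dF n x))"
      using x Suc by (simp add: hS fm.minus_add fm.a_ac fm.r_neg fm.r_neg1 fm.r_neg2 fm.l_neg)
    finally show ?thesis using Suc by (simp add: D_def)
  qed
  show ?thesis
  proof (rule cohom_dim_le_of_exact[OF CG CF CG \<alpha> _ _ \<gamma>])
    fix u
    show "cocycle bG dG m u \<Longrightarrow> cocycle bF dF (Suc m) (\<lambda>x. u (\<alpha> m x))"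
      "coboundary bG dG m u \<Longrightarrow> coboundary bF dF (Suc m) (\<lambda>x. u (\<alpha> m x))"
      by (rule anti_chain_map_pullback[OF CG CF \<alpha> \<alpha>S]; assumption)+
    show "cocycle bF dF (Suc m) u \<Longrightarrow> cocycle bG dG (Suc m) (\<lambda>x. u (\<gamma> (Suc m) x))"
      "coboundary bF dF (Suc m) u \<Longrightarrow> coboundary bG dG (Suc m) (\<lambda>x. u (\<gamma> (Suc m) x))"
      by (rule chain_map_pullback[OF CF CG \<gamma> \<gamma>S]; assumption)+
    assume u: "cocycle bF dF (Suc m) u" and cob: "coboundary bG dG (Suc m) (\<lambda>x. u (\<gamma> (Suc m) x))"
    have ul: "u \<in> lin_maps R (FF (bF (Suc m))) kk" using u by (simp add: cocycle_def)
    have ud: "u (dF (Suc m) x) = \<zero>\<^bsub>kk\<^esub>" if "x \<in> vecs (bF (Suc (Suc m)))" for x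
      using u that by (simp add: cocycle_def)
    note [simp] = lin_closed[OF ul] lin_add[OF ul] lin_smult[OF ul]
      lin_neg[OF FF_module kk_module ul]
    obtain v where v: "v \<in> lin_maps R (FF (bG m)) kk"
      and uv: "\<And>x. x \<in> vecs (bG (Suc m)) \<Longrightarrow> u (\<gamma> (Suc m) x) = v (dG m x)"
      using cob by (auto simp: coboundary_def)
    define v' where "v' x = v (\<alpha> m x)" for x
    have v': "v' \<in> lin_maps R (FF (bF (Suc m))) kk" unfolding v'_def by (rule lin_comp[OF \<alpha> v])
    note [simp] = lin_closed[OF v'] lin_add[OF v'] lin_smult[OF v']
      lin_neg[OF FF_module kk_module v']
    have u\<theta>: "u (\<theta> (Suc m) x) = \<ominus>\<^bsub>kk\<^esub> v' (dF (Suc m) x)" if "x \<in> vecs (bF (Suc (Suc m)))" for x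
      using that lin_closed[OF \<alpha>]
      by (simp add: \<theta>_def uv \<alpha>S v'_def lin_neg[OF FF_module kk_module v])
    \<comment> \<open>The preimage of the class of \<open>u\<close> under \<alpha>. It is a cocycle
      because hd = y - dh, where \<open>y\<close> acts as zero on k and \<open>u\<close> kills
      boundaries.\<close>
    define w where "w x = u (h m (\<gamma> m x))" for x
    show "\<exists>w. cocycle bG dG m w \<and> coboundary bF dF (Suc m) (\<lambda>x. u x \<oplus>\<^bsub>kk\<^esub> \<ominus>\<^bsub>kk\<^esub> w (\<alpha> m x))"
    proof (intro exI conjI)
      have "w (dG m x) = \<zero>\<^bsub>kk\<^esub>" if x: "x \<in> vecs (bG (Suc m))" for x
      proof -
        define g where "g = \<gamma> (Suc m) x"
        have g: "g \<in> vecs (bF (Suc m))" using lin_closed[OF \<gamma> x] by (simp add: g_def)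
        have "\<zero>\<^bsub>kk\<^esub> = u (dF (Suc m) (h (Suc m) g))" using ud[of "h (Suc m) g"] g by simp
        also have "\<dots> = \<ominus>\<^bsub>kk\<^esub> u (h m (dF m g))" using g by (simp add: hS kk_smult_mm[OF y])
        finally have "\<ominus>\<^bsub>kk\<^esub> u (h m (dF m g)) = \<zero>\<^bsub>kk\<^esub>" by simp
        then have "u (h m (dF m g)) = \<zero>\<^bsub>kk\<^esub>" using g kk_minus_zero
          by (metis kk.minus_minus lin_closed[OF ul] lin_closed[OF h] lin_closed[OF dF])
        then show ?thesis using \<gamma>S[OF x] by (simp add: w_def g_def)
      qed
      moreover have "w \<in> lin_maps R (FF (bG m)) kk"
        unfolding w_def by (rule lin_comp[OF lin_comp[OF \<gamma> h] ul])
      ultimately show "cocycle bG dG m w" by (simp add: cocycle_def)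
      have "coboundary bF dF (Suc m) (\<lambda>x. u x \<oplus>\<^bsub>kk\<^esub> \<ominus>\<^bsub>kk\<^esub> u (D (Suc m) x))"
        by (rule cocycle_chain_self_map[OF F D D0 DS u])
      \<comment> \<open>This is the part u\<theta>h of uD. Adding it back leaves uh\<theta> alone,
        which is the composite of \<open>w\<close> with \<alpha>.\<close>
      moreover have "coboundary bF dF (Suc m) (\<lambda>x. v' (h m (dF m x)))"
        using lin_comp[OF h v'] by (auto simp: coboundary_def)
      ultimately have "coboundary bF dF (Suc m)
          (\<lambda>x. (u x \<oplus>\<^bsub>kk\<^esub> \<ominus>\<^bsub>kk\<^esub> u (D (Suc m) x)) \<oplus>\<^bsub>kk\<^esub> v' (h m (dF m x)))"
        by (rule coboundary_plus)
      moreover have "(u x \<oplus>\<^bsub>kk\<^esub> \<ominus>\<^bsub>kk\<^esub> u (D (Suc m) x)) \<oplus>\<^bsub>kk\<^esub> v' (h m (dF m x)) = u x \<oplus>\<^bsub>kk\<^esub> \<ominus>\<^bsub>kk\<^esub> w (\<alpha> m x)"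
        if x: "x \<in> vecs (bF (Suc m))" for x
      proof -
        have "u (\<theta> (Suc m) (h (Suc m) x)) = \<ominus>\<^bsub>kk\<^esub> v' (dF (Suc m) (h (Suc m) x))" using x by (simp add: u\<theta>)
        also have "\<dots> = v' (h m (dF m x))" using x by (simp add: hS kk_smult_mm[OF y])
        finally have "u (D (Suc m) x) = v' (h m (dF m x)) \<oplus>\<^bsub>kk\<^esub> u (h m (\<theta> m x))"
          using x by (simp add: D_def)
        moreover have "w (\<alpha> m x) = u (h m (\<theta> m x))" by (simp add: w_def \<theta>_def)
        ultimately show ?thesis
          using x by (simp add: kk.minus_add kk.a_ac kk.r_neg kk.l_neg kk.r_neg1 kk.r_neg2 kk.cancel_opposite)
      qed
      ultimately show "coboundary bF dF (Suc m) (\<lambda>x. u x \<oplus>\<^bsub>kk\<^esub> \<ominus>\<^bsub>kk\<^esub> w (\<alpha> m x))"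
        by (simp add: coboundary_def)
    qed
  qed
qed

end

section \<open>The long exact sequence for ideals with quotient the residue field\<close>

context noetherian_local_ring
begin

interpretation fm: Module.module R "FF n" for n by (rule FF_module)
interpretation kk: Module.module R kk by (rule kk_module)
interpretation mm: maximalideal \<mm> R by (rule maximal_ideal)

text \<open>The segment Ext^n(J',k), Ext^n(J,k), Ext^(n+1)(k,k) of the long exact sequence of 0 -> J
  -> J' -> k -> 0. As the three resolutions are chosen independently, the usual splitting is
  replaced by maps \<open>q\<close> and \<open>r\<close> that hold up to correction terms.\<close>

theorem cohom_dim_ideal_le:
  assumes FR: "free_resolution R kk bF dF eF"
    and J: "ideal J R" and GR: "free_resolution R (ideal_module R J) bG dG eG"
    and J': "ideal J' R" and GR': "free_resolution R (ideal_module R J') bG' dG' eG'"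
    and JJ': "J \<subseteq> J'" and z: "z \<in> J'"
    and \<pi>: "\<pi> \<in> lin_maps R (ideal_module R J') kk" and \<pi>z: "\<pi> z = \<mm> +> \<one>"
    and ker: "\<And>a. a \<in> J' \<Longrightarrow> \<pi> a = \<zero>\<^bsub>kk\<^esub> \<longleftrightarrow> a \<in> J"
  shows "cohom_dim bG dG n \<le> cohom_dim bG' dG' n + cohom_dim bF dF (Suc n)"
proof -
  note JM = ideal_module_is_module[OF J] and JM' = ideal_module_is_module[OF J']
  interpret J: ideal J R by (rule J)
  interpret J': ideal J' R by (rule J')
  interpret JM: Module.module R "ideal_module R J" by (rule JM)
  have F: "exact_aug kk bF dF eF" by (rule free_resolution_exact_augmented[OF kk_module FR])
  have G: "exact_aug (ideal_module R J) bG dG eG" by (rule free_resolution_exact_augmented[OF JM GR])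
  have G': "exact_aug (ideal_module R J') bG' dG' eG'" by (rule free_resolution_exact_augmented[OF JM' GR'])
  have CF: "free_complex bF dF" and CG: "free_complex bG dG" and CG': "free_complex bG' dG'"
    using F G G' by (auto simp: exact_aug_def)
  have eF: "eF \<in> lin_maps R (FF (bF 0)) kk"
    and eG: "eG \<in> lin_maps R (FF (bG 0)) (ideal_module R J)"
    and eG': "eG' \<in> lin_maps R (FF (bG' 0)) (ideal_module R J')"
    using F G G' by (auto simp: exact_aug_def)
  have surjF: "eF ` vecs (bF 0) = carrier kk"
    and surjG: "eG ` vecs (bG 0) = J"
    and surjG': "eG' ` vecs (bG' 0) = J'"
    using FR GR GR' by (auto simp: free_resolution_def)
  note dF = free_complex_lin[OF CF] and dG = free_complex_lin[OF CG] and dG' = free_complex_lin[OF CG']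
  note neg = lin_neg[OF FF_module FF_module]
  have zR: "z \<in> carrier R" using J'.Icarr[OF z] .
  have zm: "z \<otimes> a \<in> J" if a: "a \<in> \<mm>" for a
  proof -
    have aR: "a \<in> carrier R" using mm.Icarr[OF a] .
    have "\<pi> (a \<otimes> z) = a \<odot>\<^bsub>kk\<^esub> \<pi> z" using lin_smult[OF \<pi> aR, of z] z by simp
    also have "\<dots> = \<zero>\<^bsub>kk\<^esub>" using kk_smult_mm[OF a] lin_closed[OF \<pi>, of z] z by simp
    finally show ?thesis using ker[of "a \<otimes> z"] J'.I_l_closed[OF z aR] aR zR by (simp add: m_comm)
  qed
  obtain e' where e': "e' \<in> lin_maps R (FF (bF 0)) (regular_module R)"
      "\<And>x. x \<in> vecs (bF 0) \<Longrightarrow> \<mm> +> e' x = eF x"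
    by (rule residue_lift[OF eF]) blast
  have e'c: "e' x \<in> carrier R" if "x \<in> vecs (bF 0)" for x
    using lin_closed[OF e'(1) that] by simp
  obtain \<kappa> where \<kappa>: "\<And>n. \<kappa> n \<in> lin_maps R (FF (bF (Suc n))) (FF (bG n))"
    and \<kappa>0: "\<And>x. x \<in> vecs (bF (Suc 0)) \<Longrightarrow> eG (\<kappa> 0 x) = z \<otimes> e' (dF 0 x)"
    and \<kappa>S: "\<And>n x. x \<in> vecs (bF (Suc (Suc n))) \<Longrightarrow>
      dG n (\<kappa> (Suc n) x) = \<ominus>\<^bsub>FF (bG n)\<^esub> \<kappa> n (dF (Suc n) x)"
    by (rule connecting_anti_chain_map[OF F J GR zR zm e']) (assumption, assumption, rule that)
  have eGJ: "eG x \<in> J" if "x \<in> vecs (bG 0)" for x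
    using lin_closed[OF eG that] by simp
  have eGJ': "eG' x \<in> J'" if "x \<in> vecs (bG' 0)" for x
    using lin_closed[OF eG' that] by simp
  obtain \<iota> where \<iota>: "\<And>n. \<iota> n \<in> lin_maps R (FF (bG n)) (FF (bG' n))"
    and \<iota>0: "\<And>x. x \<in> vecs (bG 0) \<Longrightarrow> eG' (\<iota> 0 x) = eG x"
    and \<iota>S: "\<And>n x. x \<in> vecs (bG (Suc n)) \<Longrightarrow> dG' n (\<iota> (Suc n) x) = \<iota> n (dG n x)"
  proof (rule chain_map_lift[OF CG G', where \<phi> = eG])
    show "eG \<in> lin_maps R (FF (bG 0)) (ideal_module R J')"
      using eGJ JJ' lin_add[OF eG] lin_smult[OF eG] by (intro linI) auto
    show "eG x \<in> eG' ` vecs (bG' 0)" if "x \<in> vecs (bG 0)" for x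
      using eGJ[OF that] JJ' surjG' by auto
    show "eG (dG 0 x) = \<zero>\<^bsub>ideal_module R J'\<^esub>" if "x \<in> vecs (bG (Suc 0))" for x
      using G that by (simp add: exact_aug_def)
  qed auto
  obtain p where p: "\<And>n. p n \<in> lin_maps R (FF (bG' n)) (FF (bF n))"
    and p0: "\<And>x. x \<in> vecs (bG' 0) \<Longrightarrow> eF (p 0 x) = \<pi> (eG' x)"
    and pS: "\<And>n x. x \<in> vecs (bG' (Suc n)) \<Longrightarrow> dF n (p (Suc n) x) = p n (dG' n x)"
  proof (rule chain_map_lift[OF CG' F lin_comp[OF eG' \<pi>]])
    show "\<pi> (eG' x) \<in> eF ` vecs (bF 0)" if "x \<in> vecs (bG' 0)" for x
      unfolding surjF using lin_closed[OF \<pi> lin_closed[OF eG' that]] .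
    show "\<pi> (eG' (dG' 0 x)) = \<zero>\<^bsub>kk\<^esub>" if "x \<in> vecs (bG' (Suc 0))" for x
      using G' that lin_zero[OF JM' kk_module \<pi>] by (simp add: exact_aug_def)
  qed auto
  note [simp] = lin_closed[OF dF] lin_closed[OF dG] lin_closed[OF dG'] lin_closed[OF \<kappa>]
    lin_closed[OF \<iota>] lin_closed[OF p] e'c zR
    lin_add[OF dG] lin_add[OF \<kappa>] neg[OF dG] neg[OF \<kappa>]
  \<comment> \<open>Subtracting from an element of \<open>J'\<close> the multiple of
    \<open>z\<close> with the same value under \<pi> lands in \<open>J\<close>. This depends on the
    choice of \<open>e'\<close> and need not vanish on boundaries.\<close>
  define \<phi> where "\<phi> x = eG' x \<oplus> \<ominus> (z \<otimes> e' (p 0 x))" for x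
  have \<phi>J: "\<phi> x \<in> J" if x: "x \<in> vecs (bG' 0)" for x
  proof -
    have 1: "e' (p 0 x) \<otimes> z \<in> J'" using x J'.I_l_closed[OF z] by simp
    have "\<pi> (e' (p 0 x) \<otimes> z) = e' (p 0 x) \<odot>\<^bsub>kk\<^esub> (\<mm> +> \<one>)"
      using lin_smult[OF \<pi>, of "e' (p 0 x)" z] z x \<pi>z by simp
    also have "\<dots> = \<pi> (eG' x)" using x by (simp add: kk_smult e'(2) p0)
    finally have 2: "\<pi> (e' (p 0 x) \<otimes> z) = \<pi> (eG' x)" .
    have "\<pi> (eG' x \<oplus> \<ominus> (e' (p 0 x) \<otimes> z)) = \<pi> (eG' x) \<oplus>\<^bsub>kk\<^esub> \<ominus>\<^bsub>kk\<^esub> \<pi> (e' (p 0 x) \<otimes> z)"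
      using lin_add[OF \<pi>, of "eG' x" "\<ominus> (e' (p 0 x) \<otimes> z)"] eGJ'[OF x] 1
        lin_neg[OF JM' kk_module \<pi>, of "e' (p 0 x) \<otimes> z"] a_inv_ideal_module[OF J' 1] J'.a_inv_closed[OF 1]
      by simp
    also have "\<dots> = \<zero>\<^bsub>kk\<^esub>" unfolding 2 using lin_closed[OF \<pi>, of "eG' x"] eGJ'[OF x] by (simp add: kk.r_neg)
    finally have "eG' x \<oplus> \<ominus> (e' (p 0 x) \<otimes> z) \<in> J"
      using ker[of "eG' x \<oplus> \<ominus> (e' (p 0 x) \<otimes> z)"] eGJ'[OF x] J'.a_inv_closed[OF 1] J'.a_closed by simp
    then show ?thesis using x by (simp add: \<phi>_def m_comm)
  qed
  have eG'c: "eG' x \<in> carrier R" if "x \<in> vecs (bG' 0)" for x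
    using eGJ'[OF that] J'.Icarr by blast
  have \<phi>: "\<phi> \<in> lin_maps R (FF (bG' 0)) (ideal_module R J)"
  proof (rule linI)
    fix x y assume "x \<in> vecs (bG' 0)" "y \<in> vecs (bG' 0)"
    then show "\<phi> (x \<oplus>\<^bsub>FF (bG' 0)\<^esub> y) = \<phi> x \<oplus>\<^bsub>ideal_module R J\<^esub> \<phi> y"
      using lin_add[OF eG', of x y]
      by (simp add: \<phi>_def lin_add[OF p] lin_add[OF e'(1)] r_distr minus_add a_ac eG'c)
  next
    fix r x assume "r \<in> carrier R" "x \<in> vecs (bG' 0)"
    then show "\<phi> (r \<odot>\<^bsub>FF (bG' 0)\<^esub> x) = r \<odot>\<^bsub>ideal_module R J\<^esub> \<phi> x"
      using lin_smult[OF eG', of r x]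
      by (simp add: \<phi>_def lin_smult[OF p] lin_smult[OF e'(1)] r_distr r_minus m_lcomm eG'c)
  qed (simp add: \<phi>J)
  \<comment> \<open>\<open>q\<close> lifts \<phi> and fails to be a chain map by \<kappa>p exactly,
    the obstruction to splitting J' as J plus k.\<close>
  obtain q where q: "\<And>n. q n \<in> lin_maps R (FF (bG' n)) (FF (bG n))"
    and q0: "\<And>x. x \<in> vecs (bG' 0) \<Longrightarrow> eG (q 0 x) = \<phi> x"
    and qS: "\<And>n x. x \<in> vecs (bG' (Suc n)) \<Longrightarrow>
      dG n (q (Suc n) x) = q n (dG' n x) \<oplus>\<^bsub>FF (bG n)\<^esub> \<kappa> n (p (Suc n) x)"
  proof (rule chain_lift[OF CG' G \<phi>, where c = "\<lambda>n x. \<kappa> n (p (Suc n) x)"])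
    show "\<phi> x \<in> eG ` vecs (bG 0)" if "x \<in> vecs (bG' 0)" for x
      using \<phi>J[OF that] surjG by simp
    show "(\<lambda>x. \<kappa> n (p (Suc n) x)) \<in> lin_maps R (FF (bG' (Suc n))) (FF (bG n))" for n
      by (rule lin_comp[OF p \<kappa>])
    show "\<phi> (dG' 0 x) \<oplus>\<^bsub>ideal_module R J\<^esub> eG (\<kappa> 0 (p (Suc 0) x)) = \<zero>\<^bsub>ideal_module R J\<^esub>"
      if x: "x \<in> vecs (bG' (Suc 0))" for x
    proof -
      have "eG' (dG' 0 x) = \<zero>" using G' x by (simp add: exact_aug_def)
      then show ?thesis using x by (simp add: \<phi>_def \<kappa>0 pS l_neg)
    qed
    show "\<kappa> n (p (Suc n) (dG' (Suc n) x)) \<oplus>\<^bsub>FF (bG n)\<^esub> dG n (\<kappa> (Suc n) (p (Suc (Suc n)) x)) = \<zero>\<^bsub>FF (bG n)\<^esub>"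
      if "x \<in> vecs (bG' (Suc (Suc n)))" for n x
      using that by (simp add: \<kappa>S pS fm.r_neg)
  qed auto
  \<comment> \<open>The composite J -> J' -> k is zero, so p\<iota> has a null homotopy.\<close>
  obtain r where r: "\<And>n. r n \<in> lin_maps R (FF (bG n)) (FF (bF (Suc n)))"
    and r0: "\<And>x. x \<in> vecs (bG 0) \<Longrightarrow> dF 0 (r 0 x) = p 0 (\<iota> 0 x)"
    and rS: "\<And>n x. x \<in> vecs (bG (Suc n)) \<Longrightarrow>
      dF (Suc n) (r (Suc n) x) = p (Suc n) (\<iota> (Suc n) x) \<oplus>\<^bsub>FF (bF (Suc n))\<^esub>
         \<ominus>\<^bsub>FF (bF (Suc n))\<^esub> r n (dG n x)"
  proof (rule chain_homotopy[OF CG F, where w = "\<lambda>n x. p n (\<iota> n x)"])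
    show "(\<lambda>x. p n (\<iota> n x)) \<in> lin_maps R (FF (bG n)) (FF (bF n))" for n
      by (rule lin_comp[OF \<iota> p])
    show "eF (p 0 (\<iota> 0 x)) = \<zero>\<^bsub>kk\<^esub>" if "x \<in> vecs (bG 0)" for x
      using that eGJ[OF that] ker[of "eG x"] JJ' by (auto simp: p0 \<iota>0)
  qed (auto simp: pS \<iota>S)
  note [simp] = lin_closed[OF q] lin_closed[OF r]
  \<comment> \<open>The defect \<kappa>p\<iota> of q\<iota> is cancelled by d\<kappa>r = -\<kappa>dr
    = -\<kappa>p\<iota> + \<kappa>rd, so \<open>W\<close> is a chain self-map; it covers the
    identity of \<open>J\<close>.\<close>
  define W where "W n x = q n (\<iota> n x) \<oplus>\<^bsub>FF (bG n)\<^esub> \<kappa> n (r n x)" for n x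
  have W: "W n \<in> lin_maps R (FF (bG n)) (FF (bG n))" for n
    unfolding W_def by (intro lin_plus FF_module lin_comp[OF \<iota> q] lin_comp[OF r \<kappa>])
  have W0: "eG (W 0 x) = eG x" if x: "x \<in> vecs (bG 0)" for x
  proof -
    have c: "eG x \<in> carrier R" using eGJ[OF x] J.Icarr by blast
    have "eG (W 0 x) = \<phi> (\<iota> 0 x) \<oplus> z \<otimes> e' (p 0 (\<iota> 0 x))"
      using x lin_add[OF eG, of "q 0 (\<iota> 0 x)" "\<kappa> 0 (r 0 x)"] by (simp add: W_def q0 \<kappa>0 r0)
    also have "\<dots> = eG x" using x c by (simp add: \<phi>_def \<iota>0 a_assoc l_neg)
    finally show ?thesis .
  qed
  have WS: "dG n (W (Suc n) x) = W n (dG n x)" if x: "x \<in> vecs (bG (Suc n))" for n x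
    using x by (simp add: W_def qS \<iota>S \<kappa>S rS fm.minus_add fm.a_ac fm.r_neg fm.l_neg fm.r_neg1 fm.r_neg2 fm.cancel_opposite fm.cancel_opposite_left)
  show ?thesis
  proof (rule cohom_dim_le_of_exact[OF CG' CG CF \<iota> _ _ \<kappa>])
    fix u
    show "cocycle bG' dG' n u \<Longrightarrow> cocycle bG dG n (\<lambda>x. u (\<iota> n x))"
      "coboundary bG' dG' n u \<Longrightarrow> coboundary bG dG n (\<lambda>x. u (\<iota> n x))"
      by (rule chain_map_pullback[OF CG' CG \<iota> \<iota>S]; assumption)+
    show "cocycle bG dG n u \<Longrightarrow> cocycle bF dF (Suc n) (\<lambda>x. u (\<kappa> n x))"
      "coboundary bG dG n u \<Longrightarrow> coboundary bF dF (Suc n) (\<lambda>x. u (\<kappa> n x))"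
      by (rule anti_chain_map_pullback[OF CG CF \<kappa> \<kappa>S]; assumption)+
    assume u: "cocycle bG dG n u" and cob: "coboundary bF dF (Suc n) (\<lambda>x. u (\<kappa> n x))"
    have ul: "u \<in> lin_maps R (FF (bG n)) kk" using u by (simp add: cocycle_def)
    have ud: "u (dG n x) = \<zero>\<^bsub>kk\<^esub>" if "x \<in> vecs (bG (Suc n))" for x
      using u that by (simp add: cocycle_def)
    obtain v where v: "v \<in> lin_maps R (FF (bF n)) kk"
      and uv: "\<And>x. x \<in> vecs (bF (Suc n)) \<Longrightarrow> u (\<kappa> n x) = v (dF n x)"
      using cob by (auto simp: coboundary_def)
    note [simp] = lin_closed[OF ul] lin_add[OF ul] lin_closed[OF v] lin_add[OF v]
      lin_neg[OF FF_module kk_module v]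
    \<comment> \<open>The extension of the class of \<open>u\<close> to \<open>J'\<close>. From ud =
      0 one gets uqd + u\<kappa>p = 0, and u\<kappa> = vd, so vp supplies what uq lacks to be a
      cocycle.\<close>
    define w where "w x = u (q n x) \<oplus>\<^bsub>kk\<^esub> v (p n x)" for x
    show "\<exists>w. cocycle bG' dG' n w \<and> coboundary bG dG n (\<lambda>x. u x \<oplus>\<^bsub>kk\<^esub> \<ominus>\<^bsub>kk\<^esub> w (\<iota> n x))"
    proof (intro exI conjI)
      have "w (dG' n x) = \<zero>\<^bsub>kk\<^esub>" if x: "x \<in> vecs (bG' (Suc n))" for x
      proof -
        have "\<zero>\<^bsub>kk\<^esub> = u (dG n (q (Suc n) x))" using ud[of "q (Suc n) x"] x by simp
        also have "\<dots> = u (q n (dG' n x)) \<oplus>\<^bsub>kk\<^esub> v (dF n (p (Suc n) x))" using x by (simp add: qS uv)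
        finally show ?thesis using x by (simp add: w_def pS)
      qed
      moreover have "w \<in> lin_maps R (FF (bG' n)) kk"
        unfolding w_def by (intro lin_plus kk_module lin_comp[OF q ul] lin_comp[OF p v])
      ultimately show "cocycle bG' dG' n w" by (simp add: cocycle_def)
      have 1: "coboundary bG dG n (\<lambda>x. u x \<oplus>\<^bsub>kk\<^esub> \<ominus>\<^bsub>kk\<^esub> u (W n x))"
        by (rule cocycle_chain_self_map[OF G W W0 WS u])
      \<comment> \<open>Replaces u\<kappa>r = vdr by vp\<iota>. The difference is -vrd, a
        coboundary, and it is zero when n = 0.\<close>
      have 2: "coboundary bG dG n (\<lambda>x. v (dF n (r n x)) \<oplus>\<^bsub>kk\<^esub> \<ominus>\<^bsub>kk\<^esub> v (p n (\<iota> n x)))"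
      proof (cases n)
        case 0
        then show ?thesis using v r0 by (simp add: coboundary_def kk.r_neg)
      next
        case (Suc k)
        note vk = v[unfolded Suc]
        have "v (dF n (r n x)) \<oplus>\<^bsub>kk\<^esub> \<ominus>\<^bsub>kk\<^esub> v (p n (\<iota> n x)) = \<ominus>\<^bsub>kk\<^esub> v (r k (dG k x))"
          if "x \<in> vecs (bG n)" for x
          using that lin_closed[OF vk] unfolding Suc
          by (simp add: rS lin_add[OF vk] lin_neg[OF FF_module kk_module vk]
             kk.a_ac kk.r_neg kk.l_neg kk.r_neg1 kk.r_neg2 kk.cancel_opposite kk.cancel_opposite_left)
        moreover have "(\<lambda>x. \<ominus>\<^bsub>kk\<^esub> v (r k x)) \<in> lin_maps R (FF (bG k)) kk"
          by (intro lin_uminus kk_module lin_comp[OF r vk])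
        ultimately show ?thesis using Suc
          by (auto simp: coboundary_def intro!: bexI[of _ "\<lambda>x. \<ominus>\<^bsub>kk\<^esub> v (r k x)"])
      qed
      have "(u x \<oplus>\<^bsub>kk\<^esub> \<ominus>\<^bsub>kk\<^esub> u (W n x)) \<oplus>\<^bsub>kk\<^esub> (v (dF n (r n x)) \<oplus>\<^bsub>kk\<^esub> \<ominus>\<^bsub>kk\<^esub> v (p n (\<iota> n x)))
          = u x \<oplus>\<^bsub>kk\<^esub> \<ominus>\<^bsub>kk\<^esub> w (\<iota> n x)" if x: "x \<in> vecs (bG n)" for x
        using x by (simp add: W_def w_def uv kk.minus_add kk.a_ac kk.r_neg kk.l_neg kk.r_neg1 kk.r_neg2 kk.cancel_opposite kk.cancel_opposite_left)
      with coboundary_plus[OF 1 2]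
      show "coboundary bG dG n (\<lambda>x. u x \<oplus>\<^bsub>kk\<^esub> \<ominus>\<^bsub>kk\<^esub> w (\<iota> n x))"
        by (cases n) (simp_all add: coboundary_def)
    qed
  qed
qed

end

section \<open>Existence of free resolutions\<close>

context cring
begin

text \<open>For a submodule \<open>H\<close> this says that \<open>S\<close> spans it, expressed
  through the submodules containing \<open>S\<close> so that no linear combinations have to be
  named.\<close>

definition generates :: "('a, 'm, 'c) module_scheme \<Rightarrow> 'm set \<Rightarrow> 'm set \<Rightarrow> bool" where
  "generates M S H \<longleftrightarrow> finite S \<and> S \<subseteq> H \<and>
     (\<forall>N. submodule R N M \<longrightarrow> S \<subseteq> N \<longrightarrow> H \<subseteq> N)"

lemma lin_image_submodule:
  assumes M: "Module.module R M" and N: "Module.module R N" and f: "f \<in> lin_maps R M N"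
  shows "submodule R (f ` carrier M) N"
  using mod_hom.im_is_submodule[of R M N f] M N f mod_hom.im_def[of R M N f]
  by (simp add: mod_hom_def mod_hom_axioms_def)

lemma lin_kernel_submodule:
  assumes M: "Module.module R M" and N: "Module.module R N" and f: "f \<in> lin_maps R M N"
  shows "submodule R {x \<in> carrier M. f x = \<zero>\<^bsub>N\<^esub>} M"
  using mod_hom.ker_is_submodule[of R M N f] M N f mod_hom.ker_def[of R M N f]
  by (simp add: mod_hom_def mod_hom_axioms_def)

lemma submodule_regular_imp_ideal:
  assumes N: "submodule R N (regular_module R)" shows "ideal N R"
proof (rule idealI[OF ring_axioms])
  have NR: "N \<subseteq> carrier R" using submodule.subset[OF N] by simp
  have sm: "r \<otimes> x \<in> N" if "r \<in> carrier R" "x \<in> N" for r x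
    using submodule.smult_closed[OF N that] by simp
  show "subgroup N (add_monoid R)"
  proof (rule add.subgroupI)
    show "\<ominus> a \<in> N" if "a \<in> N" for a using sm[of "\<ominus> \<one>" a] that NR by (auto simp: l_minus)
    show "a \<oplus> b \<in> N" if "a \<in> N" "b \<in> N" for a b using submodule.m_closed[OF N that] by simp
  qed (use NR submodule.zero_closed[OF N] in auto)
  show "x \<otimes> a \<in> N" "a \<otimes> x \<in> N" if "a \<in> N" "x \<in> carrier R" for a x
    using sm[OF that(2,1)] that NR by (auto simp: m_comm)
qed

lemma partial_comb_at_unit_vector:
  assumes M: "Module.module R M" and v: "\<And>i. i < n \<Longrightarrow> v i \<in> carrier M" and i: "i < n" and j: "j \<le> n"
  shows "partial_comb M v (unit_vector n i) j = (if i < j then v i else \<zero>\<^bsub>M\<^esub>)"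
proof -
  interpret M: Module.module R M by (rule M)
  show ?thesis using j
    by (induction j) (use v i in \<open>auto simp: unit_vector_def less_Suc_eq\<close>)
qed

lemma generates_imp_free_surjection:
  assumes M: "Module.module R M" and H: "submodule R H M" and gen: "generates M S H"
  shows "\<exists>s. \<exists>f \<in> lin_maps R (FF s) M. f ` vecs s = H"
proof -
  obtain vs where vs: "set vs = S" using gen finite_list[of S] by (auto simp: generates_def)
  define v where "v i = vs ! i" for i
  let ?s = "length vs"
  have HM: "H \<subseteq> carrier M" by (rule submodule.subset[OF H])
  have vH: "v i \<in> H" if "i < ?s" for i using that vs gen by (auto simp: generates_def v_def)
  then have vM: "v i \<in> carrier M" if "i < ?s" for i using that HM by auto
  let ?f = "\<lambda>x. partial_comb M v x ?s"
  have f: "?f \<in> lin_maps R (FF ?s) M" by (rule partial_comb_lin[OF M vM order_refl])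
  have "partial_comb M v x j \<in> H" if "x \<in> vecs ?s" "j \<le> ?s" for x j
    using that(2)
    by (induction j)
      (auto intro!: submodule.m_closed[OF H] submodule.smult_closed[OF H]
         submodule.zero_closed[OF H] vH free_module_coord[OF that(1)])
  then have "?f ` vecs ?s \<subseteq> H" by auto
  moreover have "S \<subseteq> ?f ` vecs ?s"
  proof
    fix w assume "w \<in> S"
    then obtain i where i: "i < ?s" "w = v i" using vs by (auto simp: in_set_conv_nth v_def)
    have "?f (unit_vector ?s i) = w"
      using partial_comb_at_unit_vector[where n = ?s and i = i and j = ?s, OF M vM i(1)] i by simp
    then show "w \<in> ?f ` vecs ?s" by (metis imageI unit_vector_closed)
  qed
  then have "H \<subseteq> ?f ` vecs ?s"
    using gen lin_image_submodule[OF FF_module M f] by (simp add: generates_def)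
  ultimately show ?thesis using f by blast
qed

end

context noetherian_local_ring
begin

interpretation fm: Module.module R "FF n" for n by (rule FF_module)

lemma coordinate_ideal:
  assumes H: "submodule R H (FF n)" and j: "j < n"
  shows "ideal ((\<lambda>x. x j) ` H) R"
proof -
  have "(\<lambda>x. x j) \<in> lin_maps R ((FF n)\<lparr>carrier := H\<rparr>) (regular_module R)"
    using subsetD[OF submodule.subset[OF H]] lin_closed[OF free_module_coord_lin[OF j]]
      lin_add[OF free_module_coord_lin[OF j]] lin_smult[OF free_module_coord_lin[OF j]]
    by (intro linI) auto
  from lin_image_submodule[OF fm.submodule_is_module[OF H] regular_module this]
  show ?thesis by (intro submodule_regular_imp_ideal) simp
qed

lemma submodule_inter:
  assumes "submodule R H M" "submodule R N M"
  shows "submodule R (H \<inter> N) M"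
  using assms unfolding submodule_def by auto

text \<open>Finite free modules over a Noetherian ring are Noetherian, by induction on the number of
  coordinates that may be nonzero. The last such coordinates of \<open>H\<close> form a finitely
  generated ideal; lifts of its generators, together with generators of the part where that
  coordinate vanishes, generate \<open>H\<close>.\<close>

lemma free_submodule_finitely_generated:
  assumes "j \<le> n" "submodule R H (FF n)"
    and "\<And>x i. x \<in> H \<Longrightarrow> j \<le> i \<Longrightarrow> i < n \<Longrightarrow> x i = \<zero>"
  shows "\<exists>S. generates (FF n) S H"
  using assms
proof (induction j arbitrary: H)
  case 0
  have "x = \<zero>\<^bsub>FF n\<^esub>" if "x \<in> H" for x
    using 0(3)[OF that] that submodule.subset[OF 0(2)]
    by (auto simp: func_space_def PiE_iff extensional_def fun_eq_iff)
  then have "H \<subseteq> {\<zero>\<^bsub>FF n\<^esub>}" by auto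
  then have "generates (FF n) {} H"
    unfolding generates_def using submodule.zero_closed by fastforce
  then show ?case by blast
next
  case (Suc j)
  note H = Suc.prems(2)
  have HM: "H \<subseteq> vecs n" by (rule submodule.subset[OF H])
  have j: "j < n" using Suc.prems(1) by simp
  have add: "(x \<oplus>\<^bsub>FF n\<^esub> y) j = x j \<oplus> y j" for x y using j by (simp add: func_space_def)
  have smult: "(r \<odot>\<^bsub>FF n\<^esub> x) j = r \<otimes> x j" for r x using j by (simp add: func_space_def)
  have lin: "(\<lambda>x. x j) \<in> lin_maps R (FF n) (regular_module R)" by (rule free_module_coord_lin[OF j])
  obtain T where T: "T \<subseteq> carrier R" "finite T" "(\<lambda>x. x j) ` H = Idl T"
    using finetely_gen[OF coordinate_ideal[OF H j]] by blast
  have "T \<subseteq> (\<lambda>x. x j) ` H" using T genideal_self by simp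
  then obtain S1 where S1: "finite S1" "S1 \<subseteq> H" "(\<lambda>x. x j) ` S1 = T"
    using finite_subset_image[OF T(2)] by metis
  define H' where "H' = H \<inter> {x \<in> vecs n. x j = \<zero>\<^bsub>regular_module R\<^esub>}"
  have H': "submodule R H' (FF n)"
    unfolding H'_def
    by (rule submodule_inter[OF H lin_kernel_submodule[OF FF_module regular_module lin]])
  have "\<exists>S. generates (FF n) S H'"
  proof (rule Suc.IH[OF _ H'])
    show "x i = \<zero>" if "x \<in> H'" "j \<le> i" "i < n" for x i
      using that Suc.prems(3)[of x i] by (cases "i = j") (auto simp: H'_def)
  qed (use j in simp)
  then obtain S2 where S2: "generates (FF n) S2 H'" by blast
  have "generates (FF n) (S1 \<union> S2) H"
    unfolding generates_def
  proof (intro conjI allI impI subsetI)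
    show "finite (S1 \<union> S2)" using S1 S2 by (simp add: generates_def)
    show "x \<in> H" if "x \<in> S1 \<union> S2" for x using that S1 S2 by (auto simp: generates_def H'_def)
    fix N x assume N: "submodule R N (FF n)" and SN: "S1 \<union> S2 \<subseteq> N" and x: "x \<in> H"
    \<comment> \<open>Applied to the intersection with \<open>N\<close>, so that the element
      \<open>y\<close> sharing the coordinate of \<open>x\<close> lies in \<open>N\<close> as well
      as in \<open>H\<close>. Then x - y falls under the induction hypothesis.\<close>
    have "ideal ((\<lambda>x. x j) ` (H \<inter> N)) R" by (rule coordinate_ideal[OF submodule_inter[OF H N] j])
    moreover have "T \<subseteq> (\<lambda>x. x j) ` (H \<inter> N)" using S1 SN by auto
    ultimately have "Idl T \<subseteq> (\<lambda>x. x j) ` (H \<inter> N)" by (rule genideal_minimal)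
    then obtain y where y: "y \<in> H" "y \<in> N" "x j = y j" using T(3) x by blast
    have c: "x \<in> vecs n" "y \<in> vecs n" using x y HM by auto
    define t where "t = x \<oplus>\<^bsub>FF n\<^esub> (\<ominus> \<one>) \<odot>\<^bsub>FF n\<^esub> y"
    have tc: "t \<in> vecs n" using c by (simp add: t_def)
    have "t \<in> H" unfolding t_def using x y
      by (intro submodule.m_closed[OF H] submodule.smult_closed[OF H]) auto
    moreover have "t j = \<zero>" using y c j by (simp add: t_def add smult l_minus r_neg)
    ultimately have "t \<in> H'" using tc by (simp add: H'_def)
    then have "t \<in> N" using S2 N SN by (auto simp: generates_def)
    then have "t \<oplus>\<^bsub>FF n\<^esub> y \<in> N" using y submodule.m_closed[OF N] by blast
    moreover have "t \<oplus>\<^bsub>FF n\<^esub> y = x"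
      using c by (simp add: t_def fm.smult_minus_1 fm.a_assoc fm.l_neg)
    ultimately show "x \<in> N" by simp
  qed
  then show ?case by blast
qed

lemma free_surjection_onto_kernel:
  assumes X: "Module.module R X" and f: "f \<in> lin_maps R (FF n) X"
  shows "\<exists>s. \<exists>g \<in> lin_maps R (FF s) (FF n).
    g ` vecs s = {x \<in> vecs n. f x = \<zero>\<^bsub>X\<^esub>}"
proof -
  let ?H = "{x \<in> vecs n. f x = \<zero>\<^bsub>X\<^esub>}"
  have H: "submodule R ?H (FF n)"
    by (rule lin_kernel_submodule[OF FF_module X f])
  obtain S where "generates (FF n) S ?H"
    using free_submodule_finitely_generated[OF order_refl H] by auto
  from generates_imp_free_surjection[OF FF_module H this] show ?thesis .
qed

theorem free_resolution_exists:
  assumes M: "Module.module R M" and gen: "generates M S (carrier M)"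
  shows "\<exists>b d e. free_resolution R M b d e"
proof -
  interpret M: Module.module R M by (rule M)
  have "submodule R (carrier M) M"
    by (rule submodule.intro) (auto intro: M)
  from generates_imp_free_surjection[OF M this gen]
  obtain b0 e where e: "e \<in> lin_maps R (FF b0) M" "e ` vecs b0 = carrier M" by blast
  obtain b1 d0 where d0: "d0 \<in> lin_maps R (FF b1) (FF b0)"
    "d0 ` vecs b1 = {x \<in> vecs b0. e x = \<zero>\<^bsub>M\<^esub>}"
    using free_surjection_onto_kernel[OF M e(1)] by blast
  \<comment> \<open>A state holds two consecutive ranks and the differential between them.
    \<open>P\<close> fixes the first state; \<open>Q\<close> says that the next differential starts
    a new rank and maps onto the kernel of the current one.\<close>
  define P :: "nat \<Rightarrow> nat \<times> nat \<times> ((nat \<Rightarrow> 'a) \<Rightarrow> nat \<Rightarrow> 'a) \<Rightarrow> bool" where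
    "P n s \<longleftrightarrow> (case s of (p, q, \<delta>) \<Rightarrow> \<delta> \<in> lin_maps R (FF q) (FF p) \<and>
       (n = 0 \<longrightarrow> s = (b0, b1, d0)))" for n s
  define Q :: "nat \<Rightarrow> nat \<times> nat \<times> ((nat \<Rightarrow> 'a) \<Rightarrow> nat \<Rightarrow> 'a) \<Rightarrow> nat \<times> nat \<times> ((nat \<Rightarrow> 'a) \<Rightarrow> nat \<Rightarrow> 'a) \<Rightarrow> bool" where
    "Q n s s' \<longleftrightarrow> (case s of (p, q, \<delta>) \<Rightarrow> case s' of (p', q', \<delta>') \<Rightarrow> p' = q \<and>
       \<delta>' ` vecs q' = {x \<in> vecs q. \<delta> x = \<zero>\<^bsub>FF p\<^esub>})" for n s s'
  have "\<exists>s. \<forall>n. P n (s n) \<and> Q n (s n) (s (Suc n))"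
  proof (rule dependent_nat_choice)
    have "P 0 (b0, b1, d0)" using d0 by (simp add: P_def)
    then show "\<exists>s. P 0 s" by blast
  next
    fix s n assume P: "P n s"
    obtain p q \<delta> where s: "s = (p, q, \<delta>)" by (cases s)
    have "\<delta> \<in> lin_maps R (FF q) (FF p)" using P s by (simp add: P_def)
    from free_surjection_onto_kernel[OF FF_module this]
    obtain q' \<delta>' where "\<delta>' \<in> lin_maps R (FF q') (FF q)"
      "\<delta>' ` vecs q' = {x \<in> vecs q. \<delta> x = \<zero>\<^bsub>FF p\<^esub>}" by blast
    then have "P (Suc n) (q, q', \<delta>') \<and> Q n s (q, q', \<delta>')" using s by (simp add: P_def Q_def)
    then show "\<exists>s'. P (Suc n) s' \<and> Q n s s'" by blast
  qed
  then obtain s where s: "\<And>n. P n (s n)" "\<And>n. Q n (s n) (s (Suc n))" by auto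
  define b where "b n = fst (s n)" for n
  define d where "d n = snd (snd (s n))" for n
  have bS: "fst (snd (s n)) = b (Suc n)" for n
    using s(2)[of n] by (auto simp: Q_def b_def split: prod.splits)
  have s0: "s 0 = (b0, b1, d0)" using s(1)[of 0] by (auto simp: P_def split: prod.splits)
  have dl: "d n \<in> lin_maps R (FF (b (Suc n))) (FF (b n))" for n
    using s(1)[of n] bS[of n] by (auto simp: P_def d_def b_def split: prod.splits)
  have "d (Suc n) ` vecs (b (Suc (Suc n))) =
      {x \<in> vecs (b (Suc n)). d n x = \<zero>\<^bsub>FF (b n)\<^esub>}" for n
    using s(2)[of n] bS[of n] bS[of "Suc n"]
    by (simp add: Q_def d_def b_def case_prod_beta)
  moreover have "b 0 = b0" "d 0 = d0" "b (Suc 0) = b1" using s0 bS[of 0] by (auto simp: b_def d_def)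
  ultimately have "free_resolution R M b d e"
    using e d0 dl unfolding free_resolution_def by simp
  then show ?thesis by blast
qed

lemma ideal_free_resolution_exists:
  assumes J: "ideal J R" shows "\<exists>b d e. free_resolution R (ideal_module R J) b d e"
proof -
  interpret J: ideal J R by (rule J)
  obtain S where S: "S \<subseteq> carrier R" "finite S" "J = Idl S" using finetely_gen[OF J] by blast
  have "generates (ideal_module R J) S (carrier (ideal_module R J))"
    unfolding generates_def
  proof (intro conjI allI impI)
    show "finite S" "S \<subseteq> carrier (ideal_module R J)" using S genideal_self by auto
    fix N assume N: "submodule R N (ideal_module R J)" and SN: "S \<subseteq> N"
    have "submodule R N (regular_module R)"
      using N J.a_subset regular_module unfolding submodule_def by auto
    from submodule_regular_imp_ideal[OF this]
    show "carrier (ideal_module R J) \<subseteq> N" using genideal_minimal[OF _ SN] S by simp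
  qed
  from free_resolution_exists[OF ideal_module_is_module[OF J] this] show ?thesis .
qed

lemma kk_free_resolution_exists: "\<exists>b d e. free_resolution R kk b d e"
proof -
  have "generates kk {\<mm> +> \<one>} (carrier kk)"
    unfolding generates_def
  proof (intro conjI allI impI)
    fix N assume N: "submodule R N kk" and SN: "{\<mm> +> \<one>} \<subseteq> N"
    have "\<mm> +> r \<in> N" if "r \<in> carrier R" for r
      using submodule.smult_closed[OF N that, of "\<mm> +> \<one>"] SN that by (simp add: kk_smult)
    then show "carrier kk \<subseteq> N" by (auto simp: kk_carrier)
  qed (auto simp: kk_carrier)
  from free_resolution_exists[OF kk_module this] show ?thesis .
qed

text \<open>Existence makes the chosen pair a genuine resolution. The choice does not depend on the
  degree, so one resolution computes all Betti numbers.\<close>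

lemma betti_eq_cohom_dim:
  assumes "\<exists>b d e. free_resolution R M b d e"
  obtains b d e where "free_resolution R M b d e" "\<And>n. betti R \<mm> M n = cohom_dim b d n"
proof -
  obtain b d where bd: "(SOME (b, d). \<exists>e. free_resolution R M b d e) = (b, d)" by fastforce
  have "\<exists>x. case x of (b, d) \<Rightarrow> \<exists>e. free_resolution R M b d e" using assms by auto
  from someI_ex[OF this] have "\<exists>e. free_resolution R M b d e" unfolding bd by simp
  then obtain e where "free_resolution R M b d e" by blast
  moreover have "betti R \<mm> M n = cohom_dim b d n" for n
    unfolding betti_def Ext_module_def bd by simp
  ultimately show ?thesis by (rule that)
qed

end

section \<open>Integral closure\<close>

text \<open>
  \<open>monic_value R I r d\<close> consists of the values at \<open>r\<close> of the monic polynomials of degree \<open>d\<close> whose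
  coefficient of \<open>X\<^bsup>d-i\<^esup>\<close> lies in \<open>I\<^sup>i\<close>; \<open>lower_terms\<close> omits the leading term.
\<close>

inductive_set lower_terms :: "('a, 'b) ring_scheme \<Rightarrow> 'a set \<Rightarrow> 'a \<Rightarrow> nat \<Rightarrow> 'a set"
  for R and I and r and d :: nat where
  zero: "\<zero>\<^bsub>R\<^esub> \<in> lower_terms R I r d"
| add: "x \<in> lower_terms R I r d \<Longrightarrow> 0 < i \<Longrightarrow> i \<le> d \<Longrightarrow> a \<in> I [^]\<^bsub>ideals_set R\<^esub> i \<Longrightarrow>
    x \<oplus>\<^bsub>R\<^esub> a \<otimes>\<^bsub>R\<^esub> r [^]\<^bsub>R\<^esub> (d - i) \<in> lower_terms R I r d"

definition monic_value :: "('a, 'b) ring_scheme \<Rightarrow> 'a set \<Rightarrow> 'a \<Rightarrow> nat \<Rightarrow> 'a set" where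
  "monic_value R I r d = {r [^]\<^bsub>R\<^esub> d \<oplus>\<^bsub>R\<^esub> l | l. l \<in> lower_terms R I r d}"

section \<open>Arithmetic of values of monic polynomials, and Cayley-Hamilton\<close>

context cring
begin

lemma ideal_power:
  assumes I: "ideal I R"
  shows "ideal (I [^]\<^bsub>ideals_set R\<^esub> (i::nat)) R"
    and "a \<in> I [^]\<^bsub>ideals_set R\<^esub> i \<Longrightarrow> b \<in> I [^]\<^bsub>ideals_set R\<^esub> j \<Longrightarrow> a \<otimes> b \<in> I [^]\<^bsub>ideals_set R\<^esub> (i + j)"
    and "I [^]\<^bsub>ideals_set R\<^esub> (1::nat) = I"
proof -
  interpret S: comm_monoid "ideals_set R" by (rule ideals_set_is_comm_monoid)
  have IS: "I \<in> carrier (ideals_set R)" using I by (simp add: ideals_set_def)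
  show "ideal (I [^]\<^bsub>ideals_set R\<^esub> i) R" using S.nat_pow_closed[OF IS, of i] by (simp add: ideals_set_def)
  show "a \<otimes> b \<in> I [^]\<^bsub>ideals_set R\<^esub> (i + j)" if "a \<in> I [^]\<^bsub>ideals_set R\<^esub> i" "b \<in> I [^]\<^bsub>ideals_set R\<^esub> j"
    using ideal_prod.prod[OF that, of R] S.nat_pow_mult[OF IS, of i j] by (simp add: ideals_set_def)
  show "I [^]\<^bsub>ideals_set R\<^esub> (1::nat) = I" using S.nat_pow_eone[OF IS] .
qed

context
  fixes I r
  assumes I: "ideal I R" and r: "r \<in> carrier R"
begin

interpretation I: ideal I R by (rule I)

lemma ideal_power_closed: "a \<in> I [^]\<^bsub>ideals_set R\<^esub> (i::nat) \<Longrightarrow> a \<in> carrier R"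
  using ideal.Icarr[OF ideal_power(1)[OF I]] .

lemma lower_terms_closed: "x \<in> lower_terms R I r d \<Longrightarrow> x \<in> carrier R"
  by (induction rule: lower_terms.induct) (auto intro: ideal_power_closed r)

lemma lower_terms_single:
  assumes "0 < i" "i \<le> d" "a \<in> I [^]\<^bsub>ideals_set R\<^esub> i"
  shows "a \<otimes> r [^] (d - i) \<in> lower_terms R I r d"
  using lower_terms.add[OF lower_terms.zero assms, of r] ideal_power_closed[OF assms(3)] r by simp

lemma lower_terms_add:
  assumes x: "x \<in> lower_terms R I r d" and y: "y \<in> lower_terms R I r d"
  shows "x \<oplus> y \<in> lower_terms R I r d"
  using y
proof (induction rule: lower_terms.induct)
  case zero
  then show ?case using x lower_terms_closed[OF x] by simp
next
  case (add y i a)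
  have "x \<oplus> (y \<oplus> a \<otimes> r [^] (d - i)) = (x \<oplus> y) \<oplus> a \<otimes> r [^] (d - i)"
    using lower_terms_closed[OF x] lower_terms_closed[OF add(1)] ideal_power_closed[OF add(4)] r by (simp add: a_assoc)
  then show ?case using lower_terms.add[OF add(5,2,3,4)] by simp
qed

lemma lower_terms_uminus:
  assumes x: "x \<in> lower_terms R I r d" shows "\<ominus> x \<in> lower_terms R I r d"
  using x
proof (induction rule: lower_terms.induct)
  case zero
  then show ?case by (simp add: lower_terms.zero)
next
  case (add y i a)
  note c = lower_terms_closed[OF add(1)] ideal_power_closed[OF add(4)]
  have "\<ominus> (y \<oplus> a \<otimes> r [^] (d - i)) = \<ominus> y \<oplus> (\<ominus> a) \<otimes> r [^] (d - i)"
    using c r by (simp add: minus_add l_minus)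
  moreover have "\<ominus> a \<in> I [^]\<^bsub>ideals_set R\<^esub> i"
    using add(4) ideal_power(1)[OF I, of i] by (simp add: additive_subgroup.a_inv_closed ideal.axioms(1))
  ultimately show ?case using lower_terms.add[OF add(5,2,3)] by simp
qed

lemma lower_terms_mult_power:
  assumes x: "x \<in> lower_terms R I r d" shows "x \<otimes> r [^] c \<in> lower_terms R I r (d + c)"
  using x
proof (induction rule: lower_terms.induct)
  case zero
  then show ?case using r by (simp add: lower_terms.zero)
next
  case (add y i a)
  note c = lower_terms_closed[OF add(1)] ideal_power_closed[OF add(4)]
  have "r [^] (d - i) \<otimes> r [^] c = r [^] (d + c - i)" using add(3) r by (simp add: nat_pow_mult)
  then have "(y \<oplus> a \<otimes> r [^] (d - i)) \<otimes> r [^] c = y \<otimes> r [^] c \<oplus> a \<otimes> r [^] (d + c - i)"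
    using c r by (simp add: l_distr m_assoc)
  then show ?case using lower_terms.add[OF add(5,2) _ add(4)] add(3) by simp
qed

text \<open>The indices are graded: coefficients from I^i and I^j multiply into I^(i+j), and i + j
  is at most d + c, so products of lower terms are lower terms for the sum of the degrees.\<close>

lemma lower_terms_mult:
  assumes x: "x \<in> lower_terms R I r d" and y: "y \<in> lower_terms R I r c"
  shows "x \<otimes> y \<in> lower_terms R I r (d + c)"
proof -
  have single: "x \<otimes> (b \<otimes> r [^] (c - j)) \<in> lower_terms R I r (d + c)"
    if j: "0 < j" "j \<le> c" and b: "b \<in> I [^]\<^bsub>ideals_set R\<^esub> j" for b j
    using x
  proof (induction rule: lower_terms.induct)
    case zero
    then show ?case using r ideal_power_closed[OF b] by (simp add: lower_terms.zero)
  next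
    case (add z i a)
    note cl = lower_terms_closed[OF add(1)] ideal_power_closed[OF add(4)] ideal_power_closed[OF b]
    have "r [^] (d - i) \<otimes> r [^] (c - j) = r [^] (d + c - (i + j))"
      using add(3) j r by (simp add: nat_pow_mult)
    moreover have "(a \<otimes> r [^] (d - i)) \<otimes> (b \<otimes> r [^] (c - j)) = (a \<otimes> b) \<otimes> (r [^] (d - i) \<otimes> r [^] (c - j))"
      using cl r by (simp add: m_ac)
    ultimately have "(z \<oplus> a \<otimes> r [^] (d - i)) \<otimes> (b \<otimes> r [^] (c - j)) =
      z \<otimes> (b \<otimes> r [^] (c - j)) \<oplus> (a \<otimes> b) \<otimes> r [^] (d + c - (i + j))"
      using cl r by (simp add: l_distr)
    then show ?case
      using lower_terms.add[OF add(5) _ _ ideal_power(2)[OF I add(4) b]] add(2,3) j by simp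
  qed
  show ?thesis using y
  proof (induction rule: lower_terms.induct)
    case zero
    then show ?case using lower_terms_closed[OF x] by (simp add: lower_terms.zero)
  next
    case (add z j b)
    have "x \<otimes> (z \<oplus> b \<otimes> r [^] (c - j)) = x \<otimes> z \<oplus> x \<otimes> (b \<otimes> r [^] (c - j))"
      using lower_terms_closed[OF x] lower_terms_closed[OF add(1)] ideal_power_closed[OF add(4)] r
      by (simp add: r_distr)
    then show ?case using lower_terms_add[OF add(5) single[OF add(2,3,4)]] by simp
  qed
qed

text \<open>The inductive construction may use an index several times or skip it;
  \<open>integral_over_ideal\<close> asks for one coefficient per index.\<close>

lemma lower_terms_sum:
  assumes "x \<in> lower_terms R I r d"
  shows "\<exists>a. (\<forall>i\<in>{1..d}. a i \<in> I [^]\<^bsub>ideals_set R\<^esub> i) \<and> x = (\<Oplus>i\<in>{1..d}. a i \<otimes> r [^] (d - i))"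
  using assms
proof (induction rule: lower_terms.induct)
  case zero
  have "\<zero> \<in> I [^]\<^bsub>ideals_set R\<^esub> i" for i :: nat
    using ideal_power(1)[OF I, of i] by (simp add: additive_subgroup.zero_closed ideal.axioms(1))
  moreover have "\<zero> = (\<Oplus>i\<in>{1..d}. \<zero> \<otimes> r [^] (d - i))" using r by simp
  ultimately show ?case by (intro exI[of _ "\<lambda>_. \<zero>"]) blast
next
  case (add y k b)
  from add(5) obtain a where a0: "\<forall>i\<in>{1..d}. a i \<in> I [^]\<^bsub>ideals_set R\<^esub> i"
    and a1: "y = (\<Oplus>i\<in>{1..d}. a i \<otimes> r [^] (d - i))" by blast
  note a = a0[rule_format] a1
  \<comment> \<open>The new coefficient is merged into the one already present at index
    \<open>k\<close>.\<close>
  define a' where "a' i = (if i = k then a i \<oplus> b else a i)" for i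
  have ac: "a i \<in> carrier R" if "i \<in> {1..d}" for i using a(1)[OF that] ideal_power_closed by blast
  have bc: "b \<in> carrier R" using ideal_power_closed[OF add(4)] .
  have k: "k \<in> {1..d}" using add by simp
  have "(\<Oplus>i\<in>{1..d}. a' i \<otimes> r [^] (d - i)) =
     (\<Oplus>i\<in>{1..d}. a i \<otimes> r [^] (d - i) \<oplus> (if k = i then b \<otimes> r [^] (d - i) else \<zero>))"
    using ac bc r by (intro finsum_cong') (auto simp: a'_def l_distr)
  also have "\<dots> = (\<Oplus>i\<in>{1..d}. a i \<otimes> r [^] (d - i)) \<oplus> (\<Oplus>i\<in>{1..d}. if k = i then b \<otimes> r [^] (d - i) else \<zero>)"
    using ac bc r by (intro finsum_addf) auto
  also have "(\<Oplus>i\<in>{1..d}. if k = i then b \<otimes> r [^] (d - i) else \<zero>) = b \<otimes> r [^] (d - k)"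
    using finsum_singleton[OF k, of "\<lambda>i. b \<otimes> r [^] (d - i)"] bc r by simp
  finally have "y \<oplus> b \<otimes> r [^] (d - k) = (\<Oplus>i\<in>{1..d}. a' i \<otimes> r [^] (d - i))" using a(2) by simp
  moreover have "a' i \<in> I [^]\<^bsub>ideals_set R\<^esub> i" if "i \<in> {1..d}" for i
    using a(1)[OF that] add(4) ideal_power(1)[OF I, of i]
    by (auto simp: a'_def intro: additive_subgroup.a_closed ideal.axioms(1))
  ultimately show ?case by blast
qed

lemma monic_value_closed: "c \<in> monic_value R I r d \<Longrightarrow> c \<in> carrier R"
  using lower_terms_closed r by (auto simp: monic_value_def)

lemma monic_value_add_lower:
  assumes "c \<in> monic_value R I r d" "l \<in> lower_terms R I r d" shows "c \<oplus> l \<in> monic_value R I r d"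
proof -
  obtain l' where l': "l' \<in> lower_terms R I r d" "c = r [^] d \<oplus> l'" using assms(1) by (auto simp: monic_value_def)
  have "c \<oplus> l = r [^] d \<oplus> (l' \<oplus> l)"
    using l' lower_terms_closed[OF l'(1)] lower_terms_closed[OF assms(2)] r by (simp add: a_assoc)
  then show ?thesis using lower_terms_add[OF l'(1) assms(2)] by (auto simp: monic_value_def)
qed

lemma monic_value_mult_lower:
  assumes c: "c \<in> monic_value R I r d" and x: "x \<in> lower_terms R I r e"
  shows "c \<otimes> x \<in> lower_terms R I r (d + e)"
proof -
  obtain l where l: "l \<in> lower_terms R I r d" "c = r [^] d \<oplus> l" using c by (auto simp: monic_value_def)
  have "c \<otimes> x = x \<otimes> r [^] d \<oplus> l \<otimes> x"
    using l lower_terms_closed[OF l(1)] lower_terms_closed[OF x] r m_comm[of "r [^] d" x]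
    by (simp add: l_distr)
  then show ?thesis
    using lower_terms_add[OF lower_terms_mult_power[OF x, of d]] lower_terms_mult[OF l(1) x] by (simp add: add.commute)
qed

lemma monic_value_mult:
  assumes c: "c \<in> monic_value R I r d" and c': "c' \<in> monic_value R I r e"
  shows "c \<otimes> c' \<in> monic_value R I r (d + e)"
proof -
  obtain l where l: "l \<in> lower_terms R I r d" "c = r [^] d \<oplus> l" using c by (auto simp: monic_value_def)
  obtain l' where l': "l' \<in> lower_terms R I r e" "c' = r [^] e \<oplus> l'" using c' by (auto simp: monic_value_def)
  have "c \<otimes> c' = c \<otimes> r [^] e \<oplus> c \<otimes> l'"
    using l' lower_terms_closed[OF l'(1)] monic_value_closed[OF c] r by (simp add: r_distr)
  also have "c \<otimes> r [^] e = r [^] (d + e) \<oplus> l \<otimes> r [^] e"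
    using l lower_terms_closed[OF l(1)] r by (simp add: l_distr nat_pow_mult)
  also have "r [^] (d + e) \<oplus> l \<otimes> r [^] e \<in> monic_value R I r (d + e)"
    using lower_terms_mult_power[OF l(1), of e] by (auto simp: monic_value_def)
  then have "r [^] (d + e) \<oplus> l \<otimes> r [^] e \<oplus> c \<otimes> l' \<in> monic_value R I r (d + e)"
    using monic_value_mult_lower[OF c l'(1)] by (rule monic_value_add_lower)
  finally show ?thesis .
qed

abbreviation (input) dot :: "(nat \<Rightarrow> 'a) \<Rightarrow> (nat \<Rightarrow> 'a) \<Rightarrow> nat \<Rightarrow> 'a" where
  "dot c x n \<equiv> partial_comb (regular_module R) x c n"

lemma dot_closed:
  "(\<And>j. j < n \<Longrightarrow> c j \<in> carrier R) \<Longrightarrow> (\<And>j. j < n \<Longrightarrow> x j \<in> carrier R) \<Longrightarrow> dot c x n \<in> carrier R"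
  by (induction n) auto

lemma dot_add:
  "(\<And>j. j < n \<Longrightarrow> c j \<in> carrier R) \<Longrightarrow> (\<And>j. j < n \<Longrightarrow> c' j \<in> carrier R) \<Longrightarrow>
   (\<And>j. j < n \<Longrightarrow> x j \<in> carrier R) \<Longrightarrow> dot (\<lambda>j. c j \<oplus> c' j) x n = dot c x n \<oplus> dot c' x n"
  by (induction n) (simp_all add: l_distr a_ac dot_closed)

lemma dot_scale:
  "(\<And>j. j < n \<Longrightarrow> c j \<in> carrier R) \<Longrightarrow> (\<And>j. j < n \<Longrightarrow> x j \<in> carrier R) \<Longrightarrow> a \<in> carrier R \<Longrightarrow>
   dot (\<lambda>j. a \<otimes> c j) x n = a \<otimes> dot c x n"
  by (induction n) (simp_all add: r_distr m_assoc dot_closed)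

text \<open>Cayley--Hamilton by elimination: the pivots stay monic in \<open>r\<close> and all other entries stay
  combinations of lower terms, so no determinants are needed.\<close>

lemma monic_annihilator_of_system:
  assumes "\<And>i. i < n \<Longrightarrow> x i \<in> carrier R"
    and "\<And>i. i < n \<Longrightarrow> b i i \<in> monic_value R I r d"
    and "\<And>i j. i < n \<Longrightarrow> j < n \<Longrightarrow> i \<noteq> j \<Longrightarrow> b i j \<in> lower_terms R I r d"
    and "\<And>i. i < n \<Longrightarrow> dot (b i) x n = \<zero>"
  shows "\<exists>D. \<exists>c \<in> monic_value R I r D. \<forall>i<n. c \<otimes> x i = \<zero>"
  using assms
proof (induction n arbitrary: b d)
  case 0
  have "\<one> \<in> monic_value R I r 0"
    using lower_terms.zero[of R I r 0] by (auto simp: monic_value_def intro!: exI[of _ \<zero>])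
  then show ?case by blast
next
  case (Suc n)
  note xc = Suc.prems(1)
  have bc: "b i j \<in> carrier R" if "i < Suc n" "j < Suc n" for i j
    using Suc.prems(2)[of i] Suc.prems(3)[of i j] that lower_terms_closed monic_value_closed by (cases "i = j") auto
  \<comment> \<open>Row \<open>i\<close> times the pivot minus \<open>b i n\<close> times row
    \<open>n\<close>, which removes the last unknown. Entries become products of two old ones, hence
    the degree d + d.\<close>
  define b' where "b' i j = b n n \<otimes> b i j \<oplus> (\<ominus> b i n) \<otimes> b n j" for i j
  have "\<exists>D. \<exists>c \<in> monic_value R I r D. \<forall>i<n. c \<otimes> x i = \<zero>"
  proof (rule Suc.IH[of b' "d + d"])
    fix i assume i: "i < n"
    show "x i \<in> carrier R" using xc i by simp
    have nb: "\<ominus> b i n \<in> lower_terms R I r d" using lower_terms_uminus[OF Suc.prems(3)[of i n]] i by simp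
    show "b' i i \<in> monic_value R I r (d + d)"
      unfolding b'_def
      using monic_value_add_lower[OF monic_value_mult[OF Suc.prems(2)[of n] Suc.prems(2)[of i]]
          lower_terms_mult[OF nb Suc.prems(3)[of n i]]] i by simp
    show "b' i j \<in> lower_terms R I r (d + d)" if j: "j < n" "i \<noteq> j" for j
      unfolding b'_def
      using lower_terms_add[OF monic_value_mult_lower[OF Suc.prems(2)[of n] Suc.prems(3)[of i j]]
          lower_terms_mult[OF nb Suc.prems(3)[of n j]]] i j by simp
    have "dot (b' i) x n = dot (\<lambda>j. b n n \<otimes> b i j) x n \<oplus> dot (\<lambda>j. (\<ominus> b i n) \<otimes> b n j) x n"
      unfolding b'_def using i bc xc by (intro dot_add) auto
    also have "\<dots> = b n n \<otimes> dot (b i) x n \<oplus> (\<ominus> b i n) \<otimes> dot (b n) x n"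
      using i bc xc by (simp add: dot_scale)
    finally have eq: "dot (b' i) x n = b n n \<otimes> dot (b i) x n \<oplus> (\<ominus> b i n) \<otimes> dot (b n) x n" .
    have d: "dot (b i) x n \<in> carrier R" "dot (b n) x n \<in> carrier R" using i bc xc by (auto intro!: dot_closed)
    have sol: "dot (b k) x n = \<ominus> (b k n \<otimes> x n)" if k: "k < Suc n" for k
    proof -
      have "dot (b k) x n \<oplus> b k n \<otimes> x n = \<zero>" using Suc.prems(4)[OF k] by simp
      moreover have "dot (b k) x n \<in> carrier R" using k bc xc by (auto intro!: dot_closed)
      ultimately show ?thesis using bc[of k n] xc[of n] k by (simp add: minus_equality)
    qed
    have "dot (b' i) x n = b n n \<otimes> (\<ominus> (b i n \<otimes> x n)) \<oplus> (\<ominus> b i n) \<otimes> (\<ominus> (b n n \<otimes> x n))"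
      unfolding eq using sol[of i] sol[of n] i by simp
    also have "\<dots> = \<zero>" using bc[of n n] bc[of i n] xc[of n] i by (simp add: l_minus r_minus m_ac l_neg)
    finally show "dot (b' i) x n = \<zero>" .
  qed
  then obtain D c where c: "c \<in> monic_value R I r D" "\<And>i. i < n \<Longrightarrow> c \<otimes> x i = \<zero>" by blast
  have cc: "c \<in> carrier R" by (rule monic_value_closed[OF c(1)])
  have "c \<otimes> dot a x k = \<zero>" if "k \<le> n" "\<And>j. j < k \<Longrightarrow> a j \<in> carrier R" for a k
    using that
  proof (induction k)
    case (Suc k)
    have "c \<otimes> (a k \<otimes> x k) = a k \<otimes> (c \<otimes> x k)" using Suc.prems xc[of k] cc by (simp add: m_lcomm)
    moreover have "dot a x k \<in> carrier R" using Suc.prems xc by (auto intro!: dot_closed)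
    ultimately show ?case using Suc xc[of k] cc c(2)[of k] by (simp add: r_distr)
  qed (simp add: cc)
  \<comment> \<open>Since \<open>c\<close> kills the first \<open>n\<close> unknowns, the last
    equation reduces to c times \<open>b n n\<close> times \<open>x n\<close> being zero.
    Multiplying \<open>c\<close> by the pivot thus kills all unknowns and stays monic.\<close>
  then have "c \<otimes> dot (b n) x n = \<zero>" using bc[of n] by simp
  moreover have "c \<otimes> (dot (b n) x n \<oplus> b n n \<otimes> x n) = \<zero>" using Suc.prems(4)[of n] cc by simp
  moreover have "dot (b n) x n \<in> carrier R" using bc[of n] xc by (auto intro!: dot_closed)
  ultimately have "c \<otimes> (b n n \<otimes> x n) = \<zero>" using cc bc[of n n] xc[of n] by (simp add: r_distr)
  then have last: "(c \<otimes> b n n) \<otimes> x n = \<zero>" using cc bc[of n n] xc[of n] by (simp add: m_assoc)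
  have "(c \<otimes> b n n) \<otimes> x i = \<zero>" if "i < Suc n" for i
  proof (cases "i = n")
    case False
    then have "(c \<otimes> b n n) \<otimes> x i = b n n \<otimes> (c \<otimes> x i)" using that cc bc[of n n] xc[of i] by (simp add: m_ac)
    then show ?thesis using c(2)[of i] that False bc[of n n] by simp
  qed (simp add: last)
  moreover have "c \<otimes> b n n \<in> monic_value R I r (D + d)" using monic_value_mult[OF c(1) Suc.prems(2)[of n]] by simp
  ultimately show ?case by blast
qed

text \<open>The generated ideal is the image of R^n under the combination map. A factor from
  \<open>J\<close> moves into the coefficients, and sums add coefficientwise.\<close>

lemma ideal_prod_genideal_dot:
  assumes X: "\<And>j. j < n \<Longrightarrow> x j \<in> carrier R" and J: "ideal J R" and s: "s \<in> J \<cdot> (Idl (x ` {..<n}))"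
  shows "\<exists>a. (\<forall>j<n. a j \<in> J) \<and> s = dot a x n"
proof -
  interpret J: ideal J R by (rule J)
  have A: "\<exists>a. (\<forall>j<n. a j \<in> carrier R) \<and> t = dot a x n" if t: "t \<in> Idl (x ` {..<n})" for t
  proof -
    let ?\<phi> = "\<lambda>a. dot a x n"
    have "?\<phi> \<in> lin_maps R (FF n) (regular_module R)"
      using X by (intro partial_comb_lin regular_module) auto
    from lin_image_submodule[OF FF_module regular_module this]
    have "ideal (?\<phi> ` vecs n) R" by (rule submodule_regular_imp_ideal)
    moreover have "x ` {..<n} \<subseteq> ?\<phi> ` vecs n"
    proof
      fix w assume "w \<in> x ` {..<n}"
      then obtain i where i: "i < n" "w = x i" by auto
      have "?\<phi> (unit_vector n i) = w"
        using partial_comb_at_unit_vector[OF regular_module, of n x i n] X i by simp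
      then show "w \<in> ?\<phi> ` vecs n" by (metis imageI unit_vector_closed)
    qed
    ultimately have "Idl (x ` {..<n}) \<subseteq> ?\<phi> ` vecs n" by (rule genideal_minimal)
    then obtain a where "a \<in> vecs n" "t = dot a x n" using t by auto
    then show ?thesis by (intro exI[of _ a]) simp
  qed
  show ?thesis using s
  proof (induction rule: ideal_prod.induct)
    case (prod i t)
    obtain a where a: "\<And>j. j < n \<Longrightarrow> a j \<in> carrier R" "t = dot a x n" using A[OF prod(2)] by blast
    then show ?case
      using dot_scale[of n a x i] X J.Icarr[OF prod(1)] J.I_r_closed[OF prod(1)]
      by (intro exI[of _ "\<lambda>j. i \<otimes> a j"]) simp
  next
    case (sum s t)
    then obtain a b where a: "\<And>j. j < n \<Longrightarrow> a j \<in> J" "s = dot a x n"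
      and b: "\<And>j. j < n \<Longrightarrow> b j \<in> J" "t = dot b x n" by blast
    then show ?case using dot_add[of n a b x] X J.Icarr J.a_closed
      by (intro exI[of _ "\<lambda>j. a j \<oplus> b j"]) simp
  qed
qed

text \<open>Writing r x_i as a combination of the generators x_j with coefficients A_ij in
  \<open>I\<close> gives the system r - A, whose diagonal is monic of degree 1 in \<open>r\<close>
  and whose other entries are lower terms.\<close>

lemma monic_annihilator:
  assumes J: "ideal J R" and fin: "finite X" "X \<subseteq> carrier R" "J = Idl X"
    and rJ: "\<And>a. a \<in> J \<Longrightarrow> r \<otimes> a \<in> I \<cdot> J"
  shows "\<exists>D. \<exists>c \<in> monic_value R I r D. \<forall>a \<in> J. c \<otimes> a = \<zero>"
proof -
  obtain xs where xs: "set xs = X" using fin(1) finite_list by blast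
  define n where "n = length xs"
  define x where "x i = xs ! i" for i
  have X: "x ` {..<n} = X" using xs by (auto simp: x_def n_def set_conv_nth)
  have xc: "x j \<in> carrier R" if "j < n" for j using that X fin(2) by blast
  have "\<forall>i\<in>{..<n}. \<exists>a. (\<forall>j<n. a j \<in> I) \<and> r \<otimes> x i = dot a x n"
  proof
    fix i assume "i \<in> {..<n}"
    then have "x i \<in> J" using X fin genideal_self by blast
    then have "r \<otimes> x i \<in> I \<cdot> (Idl (x ` {..<n}))" using rJ fin(3) X by simp
    from ideal_prod_genideal_dot[OF xc I this] show "\<exists>a. (\<forall>j<n. a j \<in> I) \<and> r \<otimes> x i = dot a x n" by simp
  qed
  then obtain A where A: "\<And>i j. i < n \<Longrightarrow> j < n \<Longrightarrow> A i j \<in> I" "\<And>i. i < n \<Longrightarrow> r \<otimes> x i = dot (A i) x n"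
    by (metis lessThan_iff)
  define b where "b i j = r \<otimes> unit_vector n i j \<oplus> (\<ominus> \<one>) \<otimes> A i j" for i j
  have uc: "unit_vector n i j \<in> carrier R" if "j < n" for i j using that free_module_coord[OF unit_vector_closed] by blast
  have Ac: "A i j \<in> carrier R" if "i < n" "j < n" for i j using A(1)[OF that] I.Icarr by blast
  have neg: "(\<ominus> \<one>) \<otimes> A i j \<in> lower_terms R I r 1" if "i < n" "j < n" for i j
  proof -
    have "(\<ominus> \<one>) \<otimes> A i j \<in> I [^]\<^bsub>ideals_set R\<^esub> (1::nat)"
      unfolding ideal_power(3)[OF I] using A(1)[OF that] I.I_l_closed by simp
    from lower_terms_single[OF _ _ this, of 1] show ?thesis using Ac[OF that] by simp
  qed
  have "\<exists>D. \<exists>c \<in> monic_value R I r D. \<forall>i<n. c \<otimes> x i = \<zero>"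
  proof (rule monic_annihilator_of_system[of n x b 1])
    fix i assume i: "i < n"
    show "x i \<in> carrier R" by (rule xc[OF i])
    have "b i i = r [^] (1::nat) \<oplus> (\<ominus> \<one>) \<otimes> A i i" using i r by (simp add: b_def unit_vector_def)
    then show "b i i \<in> monic_value R I r 1" using neg[OF i i] unfolding monic_value_def by blast
    show "b i j \<in> lower_terms R I r 1" if "j < n" "i \<noteq> j" for j
      using neg[OF i that(1)] that i r Ac[OF i that(1)] by (simp add: b_def unit_vector_def)
    have "dot (b i) x n = dot (\<lambda>j. r \<otimes> unit_vector n i j) x n \<oplus> dot (\<lambda>j. (\<ominus> \<one>) \<otimes> A i j) x n"
      unfolding b_def using i r uc Ac xc by (intro dot_add) auto
    also have "\<dots> = r \<otimes> dot (unit_vector n i) x n \<oplus> (\<ominus> \<one>) \<otimes> dot (A i) x n"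
      using i r uc Ac xc by (simp add: dot_scale)
    also have "dot (unit_vector n i) x n = x i"
      using partial_comb_at_unit_vector[OF regular_module, of n x i n] xc i by simp
    also have "dot (A i) x n = r \<otimes> x i" using A(2)[OF i] by simp
    finally show "dot (b i) x n = \<zero>" using r xc[OF i] by (simp add: l_minus r_neg)
  qed
  then obtain D c where c: "c \<in> monic_value R I r D" "\<And>i. i < n \<Longrightarrow> c \<otimes> x i = \<zero>" by blast
  have cc: "c \<in> carrier R" by (rule monic_value_closed[OF c(1)])
  \<comment> \<open>The elements killed by \<open>c\<close> form an ideal as a kernel, so killing
    the generators suffices.\<close>
  have "(\<lambda>a. c \<odot>\<^bsub>regular_module R\<^esub> a) \<in> lin_maps R (regular_module R) (regular_module R)"
    by (rule lin_scale[OF regular_module lin_id cc])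
  from lin_kernel_submodule[OF regular_module regular_module this]
  have "ideal {a \<in> carrier R. c \<otimes> a = \<zero>} R" by (intro submodule_regular_imp_ideal) simp
  moreover have "X \<subseteq> {a \<in> carrier R. c \<otimes> a = \<zero>}" using c(2) xc X by auto
  ultimately have "J \<subseteq> {a \<in> carrier R. c \<otimes> a = \<zero>}" unfolding fin(3) by (rule genideal_minimal)
  then show ?thesis using c(1) by blast
qed

end

end

section \<open>Socle elements, functionals to the residue field, and the Burch property\<close>

context noetherian_local_ring
begin

interpretation mm: maximalideal \<mm> R by (rule maximal_ideal)
interpretation kk: Module.module R kk by (rule kk_module)

text \<open>The Noetherian condition as a maximum principle: a nonempty chain of ideals contains its
  union. It yields maximal ideals, a maximal submodule avoiding an element, and maximal
  counterexamples.\<close>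

lemma maximal_in_ideal_family:
  assumes "C \<noteq> {}" "\<And>J. J \<in> C \<Longrightarrow> ideal J R"
  shows "\<exists>M \<in> C. \<forall>N \<in> C. M \<subseteq> N \<longrightarrow> N = M"
proof (rule subset_Zorn)
  fix D assume D: "subset.chain C D"
  show "\<exists>U \<in> C. \<forall>X \<in> D. X \<subseteq> U"
  proof (cases "D = {}")
    case True then show ?thesis using assms(1) by auto
  next
    case False
    have "subset.chain {I. ideal I R} D" using D assms(2) unfolding subset.chain_def by auto
    then have "\<Union>D \<in> D" by (rule ideal_chain_is_trivial[OF False])
    moreover have "D \<subseteq> C" using D by (simp add: subset.chain_def)
    ultimately show ?thesis by (intro bexI[of _ "\<Union>D"]) auto
  qed
qed

text \<open>For a nonunit \<open>c\<close>, an ideal maximal among the proper ones containing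
  \<open>c\<close> is a maximal ideal, hence is \<mm>.\<close>

lemma not_in_mm_imp_unit:
  assumes c: "c \<in> carrier R" "c \<notin> \<mm>"
  shows "\<exists>c' \<in> carrier R. c' \<otimes> c = \<one>"
proof (rule ccontr)
  assume nu: "\<not> ?thesis"
  define C where "C = {J. ideal J R \<and> c \<in> J \<and> \<one> \<notin> J}"
  have "PIdl c \<in> C" using cgenideal_ideal[OF c(1)] cgenideal_self[OF c(1)] nu by (auto simp: C_def cgenideal_def)
  then have "C \<noteq> {}" by auto
  moreover have "ideal J R" if "J \<in> C" for J using that by (simp add: C_def)
  ultimately obtain M where M: "M \<in> C" "\<And>N. N \<in> C \<Longrightarrow> M \<subseteq> N \<Longrightarrow> N = M"
    using maximal_in_ideal_family[of C] by metis
  have "maximalideal M R"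
  proof (rule maximalidealI)
    show "ideal M R" "carrier R \<noteq> M" using M(1) by (auto simp: C_def)
    fix J assume J: "ideal J R" "M \<subseteq> J" "J \<subseteq> carrier R"
    show "J = M \<or> J = carrier R"
    proof (cases "\<one> \<in> J")
      case True then show ?thesis using ideal.one_imp_carrier[OF J(1)] by simp
    next
      case False then show ?thesis using M(1) M(2)[of J] J by (auto simp: C_def)
    qed
  qed
  then have "M = \<mm>" by (rule unique_maximal_ideal)
  then show False using M(1) c(2) by (simp add: C_def)
qed

text \<open>The kernel of multiplication by \<open>z\<close> followed by reduction modulo
  \<open>J\<close>.\<close>

lemma colon_ideal:
  assumes J: "ideal J R" and z: "z \<in> carrier R"
  shows "ideal {a \<in> carrier R. z \<otimes> a \<in> J} R"
proof -
  note Js = ideal_submodule_regular[OF J]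
  have "(\<lambda>a. z \<odot>\<^bsub>regular_module R\<^esub> a) \<in> lin_maps R (regular_module R) (regular_module R)"
    by (rule lin_scale[OF regular_module lin_id z])
  note lin = lin_comp[OF this coset_in_lin_maps[OF regular_module Js]]
  from lin_kernel_submodule[OF regular_module quotient_module_is_module[OF regular_module Js] lin]
  have "ideal {a \<in> carrier R. J +> (z \<otimes> a) = J} R"
    by (intro submodule_regular_imp_ideal) (simp add: quotient_module_zero[OF regular_module Js])
  moreover have "{a \<in> carrier R. J +> (z \<otimes> a) = J} = {a \<in> carrier R. z \<otimes> a \<in> J}"
    using coset_eq_zero_iff[OF regular_module Js] z by auto
  ultimately show ?thesis by simp
qed

text \<open>The generators of \<mm> are treated one at a time: \<open>z\<close> is multiplied by the
  highest power of the new generator that keeps it outside \<open>J\<close>. Generators already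
  treated still carry it into \<open>J\<close>.\<close>

lemma socle_element_exists:
  assumes J: "ideal J R" "\<one> \<notin> J" and rad: "\<mm> \<subseteq> radical_ideal R J"
  shows "\<exists>z \<in> carrier R. z \<notin> J \<and> (\<forall>a \<in> \<mm>. z \<otimes> a \<in> J)"
proof -
  interpret J: ideal J R by (rule J)
  obtain T where T: "T \<subseteq> carrier R" "finite T" "\<mm> = Idl T" using finetely_gen[OF mm_ideal] by blast
  have Tm: "T \<subseteq> \<mm>" using T genideal_self by simp
  have "\<exists>z \<in> carrier R. z \<notin> J \<and> (\<forall>t \<in> T. z \<otimes> t \<in> J)" using T(2) Tm
  proof (induction T rule: finite_induct)
    case empty
    then show ?case using J(2) by auto
  next
    case (insert t T)
    then obtain z where z: "z \<in> carrier R" "z \<notin> J" "\<And>s. s \<in> T \<Longrightarrow> z \<otimes> s \<in> J" by auto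
    have t: "t \<in> carrier R" using insert mm.Icarr by auto
    obtain n :: nat where "t [^] n \<in> J" using insert rad by (auto simp: radical_ideal_def)
    then have ex: "z \<otimes> t [^] n \<in> J" using J.I_l_closed z(1) by simp
    \<comment> \<open>\<open>k\<close> is positive because z itself is outside \<open>J\<close>; the
      exponent k - 1 gives the new element.\<close>
    define k where "k = (LEAST k::nat. z \<otimes> t [^] k \<in> J)"
    have k: "z \<otimes> t [^] k \<in> J" unfolding k_def by (rule LeastI[of "\<lambda>k. z \<otimes> t [^] k \<in> J", OF ex])
    have "k \<noteq> 0" using k z by (auto intro: ccontr)
    then obtain l where l: "k = Suc l" by (cases k) auto
    have "z \<otimes> t [^] l \<notin> J" using not_less_Least[of l "\<lambda>k. z \<otimes> t [^] k \<in> J"] l by (simp add: k_def)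
    moreover have "(z \<otimes> t [^] l) \<otimes> t \<in> J" using k l z t by (simp add: m_assoc)
    moreover have "(z \<otimes> t [^] l) \<otimes> s \<in> J" if s: "s \<in> T" for s
    proof -
      have "s \<in> carrier R" using s insert mm.Icarr by auto
      then have "(z \<otimes> t [^] l) \<otimes> s = (z \<otimes> s) \<otimes> t [^] l" using z t by (simp add: m_ac)
      then show ?thesis using J.I_r_closed[OF z(3)[OF s]] t by simp
    qed
    ultimately show ?case using z t by (intro bexI[of _ "z \<otimes> t [^] l"]) auto
  qed
  then obtain z where z: "z \<in> carrier R" "z \<notin> J" "\<And>t. t \<in> T \<Longrightarrow> z \<otimes> t \<in> J" by blast
  have "T \<subseteq> {a \<in> carrier R. z \<otimes> a \<in> J}" using z T by auto
  then have "\<mm> \<subseteq> {a \<in> carrier R. z \<otimes> a \<in> J}" unfolding T(3) by (rule genideal_minimal[OF colon_ideal[OF J(1) z(1)]])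
  then show ?thesis using z by auto
qed

text \<open>The hypotheses say that J/N is one copy of k spanned by the class of \<open>w\<close>;
  \<pi> reads off the coefficient, chosen by \<rho> and well defined modulo \<mm>.\<close>

lemma residue_functional_exists:
  assumes N: "ideal N R" and J: "ideal J R" and NJ: "N \<subseteq> J" and w: "w \<in> J" "w \<notin> N"
    and mw: "\<And>a. a \<in> \<mm> \<Longrightarrow> a \<otimes> w \<in> N"
    and J_eq: "\<And>a. a \<in> J \<Longrightarrow> \<exists>r \<in> carrier R. a \<oplus> \<ominus> (r \<otimes> w) \<in> N"
  shows "\<exists>\<pi> \<in> lin_maps R (ideal_module R J) kk. \<pi> w = \<mm> +> \<one> \<and> (\<forall>a \<in> J. \<pi> a = \<zero>\<^bsub>kk\<^esub> \<longleftrightarrow> a \<in> N)"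
proof -
  interpret N: ideal N R by (rule N)
  interpret J: ideal J R by (rule J)
  have wR: "w \<in> carrier R" using J.Icarr[OF w(1)] .
  \<comment> \<open>A coefficient outside \<mm> is a unit and would put \<open>w\<close> into
    \<open>N\<close>. This gives uniqueness of coefficients modulo \<mm> and the kernel of
    \<pi>.\<close>
  have iff: "c \<otimes> w \<in> N \<longleftrightarrow> c \<in> \<mm>" if c: "c \<in> carrier R" for c
  proof
    assume cw: "c \<otimes> w \<in> N"
    show "c \<in> \<mm>"
    proof (rule ccontr)
      assume "c \<notin> \<mm>"
      then obtain c' where c': "c' \<in> carrier R" "c' \<otimes> c = \<one>" using not_in_mm_imp_unit[OF c] by blast
      have "c' \<otimes> (c \<otimes> w) = w" using c c' wR by (simp flip: m_assoc)
      then show False using N.I_l_closed[OF cw c'(1)] w(2) by simp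
    qed
  qed (rule mw)
  define \<rho> where "\<rho> a = (SOME r. r \<in> carrier R \<and> a \<oplus> \<ominus> (r \<otimes> w) \<in> N)" for a
  have \<rho>: "\<rho> a \<in> carrier R" "a \<oplus> \<ominus> (\<rho> a \<otimes> w) \<in> N" if "a \<in> J" for a
  proof -
    have "\<exists>r. r \<in> carrier R \<and> a \<oplus> \<ominus> (r \<otimes> w) \<in> N" using J_eq[OF that] by blast
    from someI_ex[OF this] show "\<rho> a \<in> carrier R" "a \<oplus> \<ominus> (\<rho> a \<otimes> w) \<in> N" by (auto simp: \<rho>_def)
  qed
  have uniq: "\<mm> +> \<rho> a = \<mm> +> s" if a: "a \<in> J" and s: "s \<in> carrier R" and as: "a \<oplus> \<ominus> (s \<otimes> w) \<in> N" for a s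
  proof -
    have aR: "a \<in> carrier R" using J.Icarr[OF a] .
    have "(a \<oplus> \<ominus> (s \<otimes> w)) \<oplus> \<ominus> (a \<oplus> \<ominus> (\<rho> a \<otimes> w)) \<in> N"
      using as \<rho>(2)[OF a] by (simp add: N.a_closed N.a_inv_closed)
    moreover have "(a \<oplus> \<ominus> (s \<otimes> w)) \<oplus> \<ominus> (a \<oplus> \<ominus> (\<rho> a \<otimes> w)) = (\<rho> a \<oplus> \<ominus> s) \<otimes> w"
      using aR s \<rho>(1)[OF a] wR by algebra
    ultimately have "\<rho> a \<oplus> \<ominus> s \<in> \<mm>" using iff[of "\<rho> a \<oplus> \<ominus> s"] \<rho>(1)[OF a] s by simp
    moreover have "\<ominus>\<^bsub>regular_module R\<^esub> s = \<ominus> s"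
    proof -
      interpret Rm: Module.module R "regular_module R" by (rule regular_module)
      show ?thesis using s by (intro Rm.minus_equality) (auto simp: l_neg)
    qed
    ultimately show ?thesis
      using coset_eq_iff[OF regular_module ideal_submodule_regular[OF mm_ideal], of "\<rho> a" s] \<rho>(1)[OF a] s
      by simp
  qed
  define \<pi> where "\<pi> a = \<mm> +> \<rho> a" for a
  have \<pi>: "\<pi> \<in> lin_maps R (ideal_module R J) kk"
  proof (rule linI)
    show "\<pi> x \<in> carrier kk" if "x \<in> carrier (ideal_module R J)" for x
      using \<rho>(1)[of x] that by (auto simp: \<pi>_def kk_carrier)
    fix x y assume xy: "x \<in> carrier (ideal_module R J)" "y \<in> carrier (ideal_module R J)"
    then have xy': "x \<in> J" "y \<in> J" by auto
    have c: "x \<in> carrier R" "y \<in> carrier R" using xy' J.Icarr by auto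
    have "(x \<oplus> \<ominus> (\<rho> x \<otimes> w)) \<oplus> (y \<oplus> \<ominus> (\<rho> y \<otimes> w)) \<in> N" using \<rho>(2) xy' by (simp add: N.a_closed)
    moreover have "(x \<oplus> \<ominus> (\<rho> x \<otimes> w)) \<oplus> (y \<oplus> \<ominus> (\<rho> y \<otimes> w)) = (x \<oplus> y) \<oplus> \<ominus> ((\<rho> x \<oplus> \<rho> y) \<otimes> w)"
      using c \<rho>(1) xy' wR by algebra
    ultimately show "\<pi> (x \<oplus>\<^bsub>ideal_module R J\<^esub> y) = \<pi> x \<oplus>\<^bsub>kk\<^esub> \<pi> y"
      using uniq[of "x \<oplus> y" "\<rho> x \<oplus> \<rho> y"] xy' \<rho>(1) by (simp add: \<pi>_def kk_add J.a_closed)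
  next
    fix r x assume r: "r \<in> carrier R" and "x \<in> carrier (ideal_module R J)"
    then have x: "x \<in> J" by simp
    have c: "x \<in> carrier R" using x J.Icarr by auto
    have "r \<otimes> (x \<oplus> \<ominus> (\<rho> x \<otimes> w)) \<in> N" using \<rho>(2)[OF x] r by (simp add: N.I_l_closed)
    moreover have "r \<otimes> (x \<oplus> \<ominus> (\<rho> x \<otimes> w)) = (r \<otimes> x) \<oplus> \<ominus> ((r \<otimes> \<rho> x) \<otimes> w)"
      using c \<rho>(1)[OF x] wR r by algebra
    ultimately show "\<pi> (r \<odot>\<^bsub>ideal_module R J\<^esub> x) = r \<odot>\<^bsub>kk\<^esub> \<pi> x"
      using uniq[of "r \<otimes> x" "r \<otimes> \<rho> x"] x \<rho>(1)[OF x] r by (simp add: \<pi>_def kk_smult J.I_l_closed)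
  qed
  have "\<pi> w = \<mm> +> \<one>" unfolding \<pi>_def using uniq[of w \<one>] w(1) wR by (simp add: r_neg)
  moreover have "\<pi> a = \<zero>\<^bsub>kk\<^esub> \<longleftrightarrow> a \<in> N" if a: "a \<in> J" for a
  proof -
    have aR: "a \<in> carrier R" using J.Icarr[OF a] .
    have eq: "a = (a \<oplus> \<ominus> (\<rho> a \<otimes> w)) \<oplus> \<rho> a \<otimes> w" using aR \<rho>(1)[OF a] wR by algebra
    have eq': "\<rho> a \<otimes> w = a \<oplus> \<ominus> (a \<oplus> \<ominus> (\<rho> a \<otimes> w))" using aR \<rho>(1)[OF a] wR by algebra
    have "\<pi> a = \<zero>\<^bsub>kk\<^esub> \<longleftrightarrow> \<rho> a \<otimes> w \<in> N"
      using iff[OF \<rho>(1)[OF a]] kk_coset_eq_zero[OF \<rho>(1)[OF a]] by (simp add: \<pi>_def kk_zero)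
    also have "\<dots> \<longleftrightarrow> a \<in> N"
      using eq eq' \<rho>(2)[OF a] N.a_closed N.a_inv_closed by metis
    finally show ?thesis .
  qed
  ultimately show ?thesis using \<pi> by blast
qed

text \<open>This is the Burch property of an integrally closed ideal: if \<open>z\<mm> \<subseteq> \<mm>I\<close>, a monic
  polynomial in \<open>z\<close> with coefficients in the powers of \<open>I\<close> annihilates \<open>\<mm>\<close>, so either
  \<open>z \<in> \<mm>\<close> is integral over \<open>I\<close>, or that polynomial is a unit and \<open>\<mm> = 0\<close>.\<close>

lemma integrally_closed_colon:
  assumes I: "integrally_closed_ideal R I" "I \<subseteq> \<mm>" and m0: "\<mm> \<noteq> {\<zero>}"
    and z: "z \<in> carrier R" "z \<notin> I"
  shows "\<exists>y \<in> \<mm>. z \<otimes> y \<notin> I \<cdot> \<mm>"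
proof (rule ccontr)
  assume neg: "\<not> ?thesis"
  have Ii: "ideal I R" using I(1) by (simp add: integrally_closed_ideal_def)
  interpret I: ideal I R by (rule Ii)
  obtain T where T: "T \<subseteq> carrier R" "finite T" "\<mm> = Idl T" using finetely_gen[OF mm_ideal] by blast
  obtain D c where c: "c \<in> monic_value R I z D" "\<And>a. a \<in> \<mm> \<Longrightarrow> c \<otimes> a = \<zero>"
    using monic_annihilator[OF Ii z(1) mm_ideal T(2,1,3)] neg by blast
  have cc: "c \<in> carrier R" by (rule monic_value_closed[OF Ii z(1) c(1)])
  obtain l where l: "l \<in> lower_terms R I z D" "c = z [^] D \<oplus> l" using c(1) by (auto simp: monic_value_def)
  have lc: "l \<in> carrier R" by (rule lower_terms_closed[OF Ii z(1) l(1)])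
  show False
  proof (cases "z \<in> \<mm>")
    case True
    have zc: "z \<otimes> c = \<zero>" using c(2)[OF True] cc z by (simp add: m_comm)
    \<comment> \<open>The extra factor \<open>z\<close>, itself killed by \<open>c\<close>, raises
      the degree to D + 1, so the equation has positive degree even if D = 0.\<close>
    have "z \<otimes> c = z [^] (D + 1) \<oplus> l \<otimes> z [^] (1::nat)"
      using l(2) lc z by (simp add: r_distr m_comm)
    moreover have "l \<otimes> z [^] (1::nat) \<in> lower_terms R I z (D + 1)"
      by (rule lower_terms_mult_power[OF Ii z(1) l(1)])
    from lower_terms_sum[OF Ii z(1) this] obtain a where
      "\<forall>i\<in>{1..D+1}. a i \<in> I [^]\<^bsub>ideals_set R\<^esub> i"
      "l \<otimes> z [^] (1::nat) = (\<Oplus>i\<in>{1..D+1}. a i \<otimes> z [^] (D + 1 - i))" by blast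
    ultimately have "integral_over_ideal R I z"
      unfolding integral_over_ideal_def using z zc by (intro conjI exI[of _ "D + 1"] exI[of _ a]) auto
    then show False using I(1) z(2) by (auto simp: integrally_closed_ideal_def)
  next
    case False
    obtain z' where z': "z' \<in> carrier R" "z' \<otimes> z = \<one>" using not_in_mm_imp_unit[OF z(1) False] by blast
    \<comment> \<open>Every coefficient lies in a positive power of \<open>I\<close>, hence in
      \<mm>. So \<open>c\<close> is congruent to a power of the unit \<open>z\<close> modulo \<mm>
      and is a unit, although it kills \<mm>.\<close>
    have "x \<in> \<mm>" if "x \<in> lower_terms R I z D" for x
      using that
    proof (induction rule: lower_terms.induct)
      case (add x i a)
      have "a \<in> I" if i: "0 < i" and a: "a \<in> I [^]\<^bsub>ideals_set R\<^esub> i" for i :: nat and a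
      proof -
        obtain j where j: "i = Suc j" using i by (cases i) auto
        have "I [^]\<^bsub>ideals_set R\<^esub> i = (I [^]\<^bsub>ideals_set R\<^esub> j) \<cdot> I" using j by (simp add: ideals_set_def nat_pow_def)
        then show ?thesis using ideal_prod_inter[OF ideal_power(1)[OF Ii, of j] Ii] a by auto
      qed
      from this[OF add(2,4)] have "a \<in> \<mm>" using I(2) by auto
      then show ?case using add(5) z(1) by (simp add: mm.I_r_closed mm.a_closed)
    qed simp
    then have lm: "l \<in> \<mm>" using l(1) by simp
    have "z [^] D \<notin> \<mm>"
    proof (induction D)
      case 0
      then show ?case using mm.I_notcarr mm.one_imp_carrier by auto
    next
      case (Suc D)
      show ?case
      proof
        assume "z [^] Suc D \<in> \<mm>"
        then have "z' \<otimes> (z [^] D \<otimes> z) \<in> \<mm>" using mm.I_l_closed z' by simp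
        moreover have "z' \<otimes> (z [^] D \<otimes> z) = z [^] D \<otimes> (z' \<otimes> z)"
          using m_lcomm[of z' "z [^] D" z] z z' by simp
        ultimately show False using Suc z z' by simp
      qed
    qed
    have "c \<notin> \<mm>"
    proof
      assume "c \<in> \<mm>"
      then have "c \<oplus> \<ominus> l \<in> \<mm>" using lm by (simp add: mm.a_closed mm.a_inv_closed)
      moreover have "c \<oplus> \<ominus> l = z [^] D" using l(2) lc z by (simp add: a_assoc r_neg)
      ultimately show False using \<open>z [^] D \<notin> \<mm>\<close> by simp
    qed
    then obtain c' where c': "c' \<in> carrier R" "c' \<otimes> c = \<one>" using not_in_mm_imp_unit[OF cc] by blast
    have "a = \<zero>" if a: "a \<in> \<mm>" for a
    proof -
      have aR: "a \<in> carrier R" using mm.Icarr[OF a] .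
      have "a = c' \<otimes> (c \<otimes> a)" using aR cc c' by (simp flip: m_assoc)
      also have "\<dots> = \<zero>" using c(2)[OF a] c'(1) by simp
      finally show ?thesis .
    qed
    then have "\<mm> \<subseteq> {\<zero>}" by blast
    then show False using m0 mm.zero_closed by blast
  qed
qed

end

section \<open>Growth of sequences\<close>

text \<open>For b = 0 the exponent is -1 and the bound needs n \<le> 2m with m positive, which is
  what 2 \<le> n ensures. For larger b it follows from m \<le> 2n. The factor
  \<open>2 ^ (b + 1)\<close> covers both cases.\<close>

lemma powi_shift_le:
  assumes n: "2 \<le> n" and m: "n \<le> m + 1" "m \<le> n + 1"
  shows "real m powi (int b - 1) \<le> 2 ^ (b + 1) * real n powi (int b - 1)"
proof (cases b)
  case 0
  have "real n \<le> 2 * real m" "0 < real m" "0 < real n" using n m by auto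
  then show ?thesis using 0 by (simp add: power_int_minus field_simps)
next
  case (Suc c)
  have "real m ^ c \<le> (2 * real n) ^ c" using n m by (intro power_mono) auto
  also have "\<dots> = 2 ^ c * real n ^ c" by (simp add: power_mult_distrib)
  also have "\<dots> \<le> 2 ^ (b + 1) * real n ^ c" using Suc by (intro mult_right_mono power_increasing) auto
  finally show ?thesis using Suc by (simp add: power_int_def)
qed

lemma polynomial_growth_transfer:
  fixes f g :: "nat \<Rightarrow> nat"
  assumes fg: "\<And>n. 2 \<le> n \<Longrightarrow> f n \<le> C * (g (n - 1) + g n + g (n + 1))"
    and g: "\<alpha> > 0" "\<forall>\<^sub>F n in sequentially. real (g n) \<le> \<alpha> * real n powi (int b - 1)"
  shows "\<exists>\<alpha>::real. \<alpha> > 0 \<and> (\<forall>\<^sub>F n in sequentially. real (f n) \<le> \<alpha> * real n powi (int b - 1))"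
proof -
  \<comment> \<open>Three neighbouring values, each at most \<open>\<alpha> * 2 ^ (b + 1)\<close>
    times the power of n; C + 1 instead of C keeps \<beta> positive.\<close>
  define \<beta> where "\<beta> = (real C + 1) * (3 * (\<alpha> * 2 ^ (b + 1)))"
  obtain N where N: "\<And>n. N \<le> n \<Longrightarrow> real (g n) \<le> \<alpha> * real n powi (int b - 1)"
    using g(2) unfolding eventually_sequentially by blast
  have "real (f n) \<le> \<beta> * real n powi (int b - 1)" if n: "max 2 (N + 1) \<le> n" for n
  proof -
    have bound: "real (g m) \<le> \<alpha> * 2 ^ (b + 1) * real n powi (int b - 1)"
      if "n \<le> m + 1" "m \<le> n + 1" for m
    proof -
      have "real (g m) \<le> \<alpha> * real m powi (int b - 1)" using N[of m] n that by auto
      also have "\<dots> \<le> \<alpha> * (2 ^ (b + 1) * real n powi (int b - 1))"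
        using powi_shift_le[of n m b] n that g(1) by (intro mult_left_mono) auto
      finally show ?thesis by (simp add: mult.assoc)
    qed
    have "real (f n) \<le> real C * (real (g (n - 1)) + real (g n) + real (g (n + 1)))"
      using fg[of n] n by (simp flip: of_nat_add of_nat_mult)
    also have "\<dots> \<le> (real C + 1) * (3 * (\<alpha> * 2 ^ (b + 1) * real n powi (int b - 1)))"
    proof (rule mult_mono)
      have "n \<le> n - 1 + 1" "n - 1 \<le> n + 1" by auto
      then show "real (g (n - 1)) + real (g n) + real (g (n + 1)) \<le> 3 * (\<alpha> * 2 ^ (b + 1) * real n powi (int b - 1))"
        using bound[of "n - 1"] bound[of n] bound[of "n + 1"] by linarith
    qed auto
    finally show ?thesis by (simp add: \<beta>_def mult.assoc)
  qed
  moreover have "\<beta> > 0" using g(1) by (simp add: \<beta>_def add_pos_nonneg)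
  ultimately show ?thesis unfolding eventually_sequentially by blast
qed

text \<open>Any y above the limsup for \<open>g\<close> is positive, so a finite y may be divided
  by. Then \<open>g\<close> is eventually at most y^n and \<open>f\<close> at most a constant times
  y^n, and the n-th root of the constant tends to 1.\<close>

lemma limsup_root_le:
  fixes f g :: "nat \<Rightarrow> nat"
  assumes fg: "\<And>n. 2 \<le> n \<Longrightarrow> f n \<le> C * (g (n - 1) + g n + g (n + 1))"
  shows "limsup (\<lambda>n. ereal (root n (real (f n)))) \<le> limsup (\<lambda>n. ereal (root n (real (g n))))"
proof (rule dense_ge)
  fix y assume y: "limsup (\<lambda>n. ereal (root n (real (g n)))) < y"
  have "0 = limsup (\<lambda>n::nat. 0::ereal)" by (simp add: Limsup_const)
  also have "\<dots> \<le> limsup (\<lambda>n. ereal (root n (real (g n))))"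
    by (intro Limsup_mono always_eventually allI) (simp add: real_root_ge_zero)
  finally have y0: "0 < y" using y by (rule le_less_trans)
  show "limsup (\<lambda>n. ereal (root n (real (f n)))) \<le> y"
  proof (cases y)
    case (real c)
    have c: "c > 0" using y0 real by simp
    have "\<forall>\<^sub>F n in sequentially. root n (real (g n)) < c" using Limsup_lessD[OF y] real by simp
    then obtain N where N: "\<And>n. N \<le> n \<Longrightarrow> root n (real (g n)) < c" unfolding eventually_sequentially by blast
    have gc: "real (g n) \<le> c ^ n" if "N \<le> n" "0 < n" for n
    proof -
      have "real (g n) = root n (real (g n)) ^ n" using that by simp
      also have "\<dots> \<le> c ^ n" using N[OF that(1)] by (intro power_mono) (auto simp: real_root_ge_zero)
      finally show ?thesis .
    qed
    \<comment> \<open>The terms 1/c, 1 and c account for the degrees n - 1, n and n + 1.\<close>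
    define M where "M = (real C + 1) * (1 / c + 1 + c)"
    have M: "M > 0" using c unfolding M_def by (intro mult_pos_pos add_pos_pos add_nonneg_pos) auto
    have "root n (real (f n)) \<le> root n M * c" if n: "N + 2 \<le> n" for n
    proof -
      have "real (f n) \<le> real C * (real (g (n - 1)) + real (g n) + real (g (n + 1)))"
        using fg[of n] n by (simp flip: of_nat_add of_nat_mult)
      also have "\<dots> \<le> (real C + 1) * (c ^ (n - 1) + c ^ n + c ^ (n + 1))"
        using gc[of "n - 1"] gc[of n] gc[of "n + 1"] n by (intro mult_mono add_mono) auto
      also have "\<dots> = M * c ^ n"
      proof -
        obtain k where k: "n = Suc k" using n by (cases n) auto
        show ?thesis using c unfolding M_def k by (simp add: field_simps)
      qed
      finally have "root n (real (f n)) \<le> root n (M * c ^ n)" using n by (intro real_root_le_mono) auto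
      also have "\<dots> = root n M * c" using n c by (simp add: real_root_mult real_root_power_cancel)
      finally show ?thesis .
    qed
    then have "limsup (\<lambda>n. ereal (root n (real (f n)))) \<le> limsup (\<lambda>n. ereal (root n M * c))"
      by (intro Limsup_mono) (auto simp: eventually_sequentially)
    also have "\<dots> = ereal (1 * c)"
      by (intro lim_imp_Limsup tendsto_ereal tendsto_mult tendsto_const LIMSEQ_root_const M) auto
    finally show ?thesis using real by simp
  qed (use y0 in auto)
qed

section \<open>Betti numbers\<close>

context noetherian_local_ring
begin

interpretation mm: maximalideal \<mm> R by (rule maximal_ideal)
interpretation fm: Module.module R "FF n" for n by (rule FF_module)

lemma mem_add_cgenideal:
  assumes z: "z \<in> carrier R"
  shows "a \<in> J <+>\<^bsub>R\<^esub> PIdl z \<longleftrightarrow> (\<exists>j \<in> J. \<exists>r \<in> carrier R. a = j \<oplus> r \<otimes> z)"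
  by (auto simp: set_add_def' cgenideal_def)

lemma ideal_add_cgenideal:
  assumes J: "ideal J R" and z: "z \<in> carrier R"
  shows "ideal (J <+>\<^bsub>R\<^esub> PIdl z) R" "J \<subseteq> J <+>\<^bsub>R\<^esub> PIdl z" "z \<in> J <+>\<^bsub>R\<^esub> PIdl z"
proof -
  interpret J: ideal J R by (rule J)
  show "ideal (J <+>\<^bsub>R\<^esub> PIdl z) R" by (rule add_ideals[OF J cgenideal_ideal[OF z]])
  show "J \<subseteq> J <+>\<^bsub>R\<^esub> PIdl z"
  proof
    fix a assume "a \<in> J"
    then show "a \<in> J <+>\<^bsub>R\<^esub> PIdl z" unfolding mem_add_cgenideal[OF z]
      using z J.Icarr by (intro bexI[of _ a] bexI[of _ \<zero>]) auto
  qed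
  show "z \<in> J <+>\<^bsub>R\<^esub> PIdl z" unfolding mem_add_cgenideal[OF z]
    using z by (intro bexI[of _ \<zero>] bexI[of _ \<one>]) auto
qed

text \<open>A preimage \<open>g\<close> of 1 splits the augmentation by sending x to e(x) g, so the
  resolution is contractible in positive degrees.\<close>

lemma betti_ring_eq_0: "betti R \<mm> (ideal_module R (carrier R)) (Suc n) = 0"
proof -
  obtain b d e where res: "free_resolution R (ideal_module R (carrier R)) b d e"
    and betti: "\<And>n. betti R \<mm> (ideal_module R (carrier R)) n = cohom_dim b d n"
    by (rule betti_eq_cohom_dim[OF ideal_free_resolution_exists[OF oneideal]]) (rule that)
  have ex: "exact_aug (ideal_module R (carrier R)) b d e"
    by (rule free_resolution_exact_augmented[OF ideal_module_is_module[OF oneideal] res])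
  have e: "e \<in> lin_maps R (FF (b 0)) (ideal_module R (carrier R))"
    using ex by (simp add: exact_aug_def)
  have ec: "e x \<in> carrier R" if "x \<in> vecs (b 0)" for x
    using lin_closed[OF e that] by simp
  have "\<one> \<in> e ` vecs (b 0)" using res by (simp add: free_resolution_def)
  then obtain g where g: "g \<in> vecs (b 0)" "e g = \<one>" by auto
  have "cohom_dim b d (Suc n) = 0"
  proof (rule contractible_cohom_dim_eq_0[OF ex, where \<rho> = "\<lambda>x. e x \<odot>\<^bsub>FF (b 0)\<^esub> g"])
    show "(\<lambda>x. e x \<odot>\<^bsub>FF (b 0)\<^esub> g) \<in> lin_maps R (FF (b 0)) (FF (b 0))"
      using g(1) ec lin_add[OF e] lin_smult[OF e]
      by (intro linI) (auto simp: fm.smult_l_distr fm.smult_assoc1)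
    show "e (e x \<odot>\<^bsub>FF (b 0)\<^esub> g) = e x" if "x \<in> vecs (b 0)" for x
      using lin_smult[OF e ec[OF that] g(1)] g(2) ec[OF that] by simp
    show "e (d 0 x) \<odot>\<^bsub>FF (b 0)\<^esub> g = \<zero>\<^bsub>FF (b 0)\<^esub>"
      if "x \<in> vecs (b (Suc 0))" for x
      using ex that g(1) by (simp add: exact_aug_def)
  qed
  then show ?thesis using betti by simp
qed

text \<open>With \<mm> = 0 the lift \<open>e'\<close> of the augmentation vanishes on boundaries,
  and the splitting used for the ring itself works with \<open>e'\<close> in place of
  \<open>e\<close>.\<close>

lemma betti_kk_eq_0:
  assumes m0: "\<mm> = {\<zero>}" shows "betti R \<mm> kk (Suc n) = 0"
proof -
  obtain b d e where res: "free_resolution R kk b d e" and betti: "\<And>n. betti R \<mm> kk n = cohom_dim b d n"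
    by (rule betti_eq_cohom_dim[OF kk_free_resolution_exists]) (rule that)
  have ex: "exact_aug kk b d e" by (rule free_resolution_exact_augmented[OF kk_module res])
  have e: "e \<in> lin_maps R (FF (b 0)) kk" using ex by (simp add: exact_aug_def)
  obtain e' where e': "e' \<in> lin_maps R (FF (b 0)) (regular_module R)"
      "\<And>x. x \<in> vecs (b 0) \<Longrightarrow> \<mm> +> e' x = e x"
    by (rule residue_lift[OF e]) blast
  have e'c: "e' x \<in> carrier R" if "x \<in> vecs (b 0)" for x
    using lin_closed[OF e'(1) that] by simp
  have "\<mm> +> \<one> \<in> e ` vecs (b 0)" using res by (simp add: free_resolution_def kk_carrier)
  then obtain g where g: "g \<in> vecs (b 0)" "e g = \<mm> +> \<one>" by auto
  have "cohom_dim b d (Suc n) = 0"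
  proof (rule contractible_cohom_dim_eq_0[OF ex, where \<rho> = "\<lambda>x. e' x \<odot>\<^bsub>FF (b 0)\<^esub> g"])
    show "(\<lambda>x. e' x \<odot>\<^bsub>FF (b 0)\<^esub> g) \<in> lin_maps R (FF (b 0)) (FF (b 0))"
      using g(1) e'c lin_add[OF e'(1)] lin_smult[OF e'(1)]
      by (intro linI) (auto simp: fm.smult_l_distr fm.smult_assoc1)
    show "e (e' x \<odot>\<^bsub>FF (b 0)\<^esub> g) = e x" if "x \<in> vecs (b 0)" for x
      using lin_smult[OF e e'c[OF that] g(1)] g(2) e'c[OF that] e'(2)[OF that] by (simp add: kk_smult)
    show "e' (d 0 x) \<odot>\<^bsub>FF (b 0)\<^esub> g = \<zero>\<^bsub>FF (b 0)\<^esub>"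
      if x: "x \<in> vecs (b (Suc 0))" for x
    proof -
      have dx: "d 0 x \<in> vecs (b 0)"
        using ex x free_complex_closed by (auto simp: exact_aug_def)
      have "e (d 0 x) = \<mm>" using ex x by (simp add: exact_aug_def kk_zero)
      then have "e' (d 0 x) \<in> \<mm>" using e'(2)[OF dx] kk_coset_eq_zero[OF e'c[OF dx]] by simp
      then show ?thesis using m0 g(1) by simp
    qed
  qed
  then show ?thesis using betti by simp
qed

text \<open>The chain up to \<open>R\<close> is replaced by a maximal counterexample
  \<open>J\<close>. Adding a socle element gives a larger ideal with quotient k, for which a bound
  holds. The degree is positive because the Betti numbers of \<open>R\<close> vanish only
  there.\<close>

lemma betti_ideal_le:
  assumes I: "ideal I R" and rad: "\<mm> \<subseteq> radical_ideal R I"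
  shows "\<exists>C. \<forall>n. betti R \<mm> (ideal_module R I) (Suc n) \<le> C * betti R \<mm> kk (Suc (Suc n))"
proof (rule ccontr)
  assume bad: "\<not> ?thesis"
  define B where "B = {J. ideal J R \<and> I \<subseteq> J \<and>
    \<not> (\<exists>C. \<forall>n. betti R \<mm> (ideal_module R J) (Suc n) \<le> C * betti R \<mm> kk (Suc (Suc n)))}"
  have "I \<in> B" using bad I by (simp add: B_def)
  then have "B \<noteq> {}" by auto
  moreover have "ideal J R" if "J \<in> B" for J using that by (simp add: B_def)
  ultimately obtain J where J: "J \<in> B" "\<And>N. N \<in> B \<Longrightarrow> J \<subseteq> N \<Longrightarrow> N = J"
    using maximal_in_ideal_family[of B] by metis
  have Ji: "ideal J R" and IJ: "I \<subseteq> J" using J(1) by (auto simp: B_def)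
  interpret J: ideal J R by (rule Ji)
  have "\<exists>C. \<forall>n. betti R \<mm> (ideal_module R J) (Suc n) \<le> C * betti R \<mm> kk (Suc (Suc n))"
  proof (cases "\<one> \<in> J")
    case True
    then have "J = carrier R" by (rule J.one_imp_carrier)
    then show ?thesis using betti_ring_eq_0 by simp
  next
    case False
    have "\<mm> \<subseteq> radical_ideal R J" using rad IJ by (auto simp: radical_ideal_def)
    from socle_element_exists[OF Ji False this]
    obtain z where z: "z \<in> carrier R" "z \<notin> J" "\<And>a. a \<in> \<mm> \<Longrightarrow> z \<otimes> a \<in> J" by blast
    let ?J = "J <+>\<^bsub>R\<^esub> PIdl z"
    note J' = ideal_add_cgenideal[OF Ji z(1)]
    have "?J \<notin> B" using J(2)[of ?J] J' z(2) by auto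
    then obtain C where C: "\<And>n. betti R \<mm> (ideal_module R ?J) (Suc n) \<le> C * betti R \<mm> kk (Suc (Suc n))"
      using J'(1,2) IJ by (auto simp: B_def)
    have "\<exists>\<pi> \<in> lin_maps R (ideal_module R ?J) kk. \<pi> z = \<mm> +> \<one> \<and> (\<forall>a \<in> ?J. \<pi> a = \<zero>\<^bsub>kk\<^esub> \<longleftrightarrow> a \<in> J)"
    proof (rule residue_functional_exists[OF Ji J'(1,2,3) z(2)])
      show "a \<otimes> z \<in> J" if "a \<in> \<mm>" for a using z(3)[OF that] z(1) mm.Icarr[OF that] by (simp add: m_comm)
      show "\<exists>r \<in> carrier R. a \<oplus> \<ominus> (r \<otimes> z) \<in> J" if a: "a \<in> ?J" for a
      proof -
        obtain j r where jr: "j \<in> J" "r \<in> carrier R" "a = j \<oplus> r \<otimes> z"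
          using a unfolding mem_add_cgenideal[OF z(1)] by blast
        have "a \<oplus> \<ominus> (r \<otimes> z) = j" using jr J.Icarr[OF jr(1)] z(1) by (simp add: a_assoc r_neg)
        then show ?thesis using jr(1,2) by (intro bexI[of _ r]) simp_all
      qed
    qed
    then obtain \<pi> where \<pi>: "\<pi> \<in> lin_maps R (ideal_module R ?J) kk" "\<pi> z = \<mm> +> \<one>"
      "\<And>a. a \<in> ?J \<Longrightarrow> \<pi> a = \<zero>\<^bsub>kk\<^esub> \<longleftrightarrow> a \<in> J" by blast
    obtain bF dF eF where F: "free_resolution R kk bF dF eF" and bettiF: "\<And>n. betti R \<mm> kk n = cohom_dim bF dF n"
      by (rule betti_eq_cohom_dim[OF kk_free_resolution_exists]) (rule that)
    obtain bG dG eG where G: "free_resolution R (ideal_module R J) bG dG eG"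
      and bettiG: "\<And>n. betti R \<mm> (ideal_module R J) n = cohom_dim bG dG n"
      by (rule betti_eq_cohom_dim[OF ideal_free_resolution_exists[OF Ji]]) (rule that)
    obtain bG' dG' eG' where G': "free_resolution R (ideal_module R ?J) bG' dG' eG'"
      and bettiG': "\<And>n. betti R \<mm> (ideal_module R ?J) n = cohom_dim bG' dG' n"
      by (rule betti_eq_cohom_dim[OF ideal_free_resolution_exists[OF J'(1)]]) (rule that)
    \<comment> \<open>One copy of k between \<open>J\<close> and the larger ideal costs one more
      Betti number of k, hence C + 1.\<close>
    have "betti R \<mm> (ideal_module R J) (Suc n) \<le> (C + 1) * betti R \<mm> kk (Suc (Suc n))" for n
      using cohom_dim_ideal_le[OF F Ji G J'(1) G' J'(2,3) \<pi>, of "Suc n"] C[of n]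
      by (simp add: bettiF bettiG bettiG')
    then show ?thesis by blast
  qed
  then show False using J(1) unfolding B_def by blast
qed

text \<open>It remains to produce \<mu> with \<mu>(zy) = 1. As zy lies in \<open>I\<close> but not
  in I\<mm>, a hyperplane of I/I\<mm> avoiding its class is the kernel of such a functional.\<close>

lemma betti_residue_field_le:
  assumes I: "integrally_closed_ideal R I" "primary_to R \<mm> I" and m0: "\<mm> \<noteq> {\<zero>}"
  shows "betti R \<mm> kk (Suc n) \<le> betti R \<mm> (ideal_module R I) n + betti R \<mm> (ideal_module R I) (Suc n)"
proof -
  have Ii: "ideal I R" and proper: "I \<noteq> carrier R" and rad: "radical_ideal R I = \<mm>"
    using I(2) by (auto simp: primary_to_def primary_ideal_def)
  interpret I: ideal I R by (rule Ii)
  have Im: "I \<subseteq> \<mm>"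
  proof
    fix x assume x: "x \<in> I"
    then have "x [^] (1::nat) \<in> I" using I.Icarr by simp
    then show "x \<in> \<mm>" unfolding rad[symmetric] radical_ideal_def using I.Icarr[OF x] by (auto intro!: exI[of _ "1::nat"])
  qed
  have "\<one> \<notin> I" using proper I.one_imp_carrier by blast
  from socle_element_exists[OF Ii this] rad
  obtain z where z: "z \<in> carrier R" "z \<notin> I" "\<And>a. a \<in> \<mm> \<Longrightarrow> z \<otimes> a \<in> I" by blast
  obtain y where y: "y \<in> \<mm>" "z \<otimes> y \<notin> I \<cdot> \<mm>" using integrally_closed_colon[OF I(1) Im m0 z(1,2)] by blast
  define w where "w = z \<otimes> y"
  have w: "w \<in> I" "w \<notin> I \<cdot> \<mm>" using z(3)[OF y(1)] y(2) by (auto simp: w_def)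
  have wR: "w \<in> carrier R" using I.Icarr[OF w(1)] .
  \<comment> \<open>A maximal member plays the role of the hyperplane, so no basis of I/I\<mm> is
    chosen.\<close>
  define C where "C = {N. ideal N R \<and> I \<cdot> \<mm> \<subseteq> N \<and> N \<subseteq> I \<and> w \<notin> N}"
  have "I \<cdot> \<mm> \<in> C"
    using ideal_prod_is_ideal[OF Ii mm_ideal] ideal_prod_inter[OF Ii mm_ideal] w by (auto simp: C_def)
  then have "C \<noteq> {}" by auto
  moreover have "ideal N R" if "N \<in> C" for N using that by (simp add: C_def)
  ultimately obtain N where N: "N \<in> C" "\<And>N'. N' \<in> C \<Longrightarrow> N \<subseteq> N' \<Longrightarrow> N' = N"
    using maximal_in_ideal_family[of C] by metis
  have Ni: "ideal N R" and NI: "N \<subseteq> I" "I \<cdot> \<mm> \<subseteq> N" and wN: "w \<notin> N" using N(1) by (auto simp: C_def)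
  interpret N: ideal N R by (rule Ni)
  have ImN: "a \<otimes> x \<in> N" if "a \<in> \<mm>" "x \<in> I" for a x
    using ideal_prod.prod[OF that(2,1), of R] NI(2) mm.Icarr[OF that(1)] I.Icarr[OF that(2)] by (auto simp: m_comm)
  have "\<exists>\<pi> \<in> lin_maps R (ideal_module R I) kk. \<pi> w = \<mm> +> \<one> \<and> (\<forall>a \<in> I. \<pi> a = \<zero>\<^bsub>kk\<^esub> \<longleftrightarrow> a \<in> N)"
  proof (rule residue_functional_exists[OF Ni Ii NI(1) w(1) wN])
    show "a \<otimes> w \<in> N" if "a \<in> \<mm>" for a using ImN[OF that w(1)] .
    show "\<exists>r \<in> carrier R. a \<oplus> \<ominus> (r \<otimes> w) \<in> N" if a: "a \<in> I" for a
    proof (cases "a \<in> N")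
      case True
      then show ?thesis using wR N.Icarr by (intro bexI[of _ \<zero>]) auto
    next
      case False
      have aR: "a \<in> carrier R" using I.Icarr[OF a] .
      note N' = ideal_add_cgenideal[OF Ni aR]
      have "N <+>\<^bsub>R\<^esub> PIdl a \<subseteq> I"
      proof
        fix x assume "x \<in> N <+>\<^bsub>R\<^esub> PIdl a"
        then obtain j r where "j \<in> N" "r \<in> carrier R" "x = j \<oplus> r \<otimes> a"
          unfolding mem_add_cgenideal[OF aR] by blast
        then show "x \<in> I" using NI(1) I.I_l_closed[OF a] I.a_closed by auto
      qed
      then have "w \<in> N <+>\<^bsub>R\<^esub> PIdl a" using N(2)[of "N <+>\<^bsub>R\<^esub> PIdl a"] N' NI False by (auto simp: C_def)
      then obtain j c where jc: "j \<in> N" "c \<in> carrier R" "w = j \<oplus> c \<otimes> a"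
        unfolding mem_add_cgenideal[OF aR] by blast
      \<comment> \<open>Otherwise c a would lie in \<open>N\<close>, and \<open>w\<close> with it.
        As a unit, \<open>c\<close> lets the relation be solved for \<open>a\<close>.\<close>
      have "c \<notin> \<mm>" using ImN[OF _ a, of c] jc wN N.a_closed by auto
      then obtain c' where c': "c' \<in> carrier R" "c' \<otimes> c = \<one>" using not_in_mm_imp_unit[OF jc(2)] by blast
      have jR: "j \<in> carrier R" using N.Icarr[OF jc(1)] .
      have "c' \<otimes> w = c' \<otimes> j \<oplus> a"
        using jc c' jR aR by (simp add: r_distr flip: m_assoc)
      then have "a \<oplus> \<ominus> (c' \<otimes> w) = \<ominus> (c' \<otimes> j)" using c' jR aR by (simp add: minus_add cancel_opposite)
      then show ?thesis using N.I_l_closed[OF jc(1) c'(1)] N.a_inv_closed c'(1) by (metis (no_types))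
    qed
  qed
  then obtain \<mu> where \<mu>: "\<mu> \<in> lin_maps R (ideal_module R I) kk" "\<mu> (z \<otimes> y) = \<mm> +> \<one>" by (auto simp: w_def)
  obtain bF dF eF where F: "free_resolution R kk bF dF eF" and bettiF: "\<And>n. betti R \<mm> kk n = cohom_dim bF dF n"
    by (rule betti_eq_cohom_dim[OF kk_free_resolution_exists]) (rule that)
  obtain bG dG eG where G: "free_resolution R (ideal_module R I) bG dG eG"
    and bettiG: "\<And>n. betti R \<mm> (ideal_module R I) n = cohom_dim bG dG n"
    by (rule betti_eq_cohom_dim[OF ideal_free_resolution_exists[OF Ii]]) (rule that)
  show ?thesis
    using cohom_dim_kk_le[OF F Ii G z(1,3) y(1) \<mu>, of n] by (simp add: bettiF bettiG)
qed

text \<open>Both inequalities are weakened to the same symmetric shape over three neighbouring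
  degrees, so that one growth lemma per invariant serves both directions. If \<mm> = 0 the bound for
  k holds because its left-hand side is zero.\<close>

lemma betti_comparison:
  assumes I: "integrally_closed_ideal R I" "primary_to R \<mm> I"
  shows "\<exists>C. \<forall>n\<ge>2. betti R \<mm> kk n \<le>
      C * (betti R \<mm> (ideal_module R I) (n - 1) + betti R \<mm> (ideal_module R I) n + betti R \<mm> (ideal_module R I) (n + 1)) \<and>
    betti R \<mm> (ideal_module R I) n \<le> C * (betti R \<mm> kk (n - 1) + betti R \<mm> kk n + betti R \<mm> kk (n + 1))"
proof -
  have Ii: "ideal I R" and rad: "radical_ideal R I = \<mm>"
    using I(2) by (auto simp: primary_to_def primary_ideal_def)
  obtain C where C: "\<And>n. betti R \<mm> (ideal_module R I) (Suc n) \<le> C * betti R \<mm> kk (Suc (Suc n))"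
    using betti_ideal_le[OF Ii] rad by auto
  have kk: "betti R \<mm> kk (Suc n) \<le> betti R \<mm> (ideal_module R I) n + betti R \<mm> (ideal_module R I) (Suc n)" for n
    using betti_residue_field_le[OF I] betti_kk_eq_0 by (cases "\<mm> = {\<zero>}") auto
  show ?thesis
  proof (intro exI[of _ "C + 1"] allI impI)
    fix n :: nat assume "2 \<le> n"
    then obtain k where k: "n = Suc k" by (cases n) auto
    show "betti R \<mm> kk n \<le>
      (C + 1) * (betti R \<mm> (ideal_module R I) (n - 1) + betti R \<mm> (ideal_module R I) n + betti R \<mm> (ideal_module R I) (n + 1)) \<and>
      betti R \<mm> (ideal_module R I) n \<le> (C + 1) * (betti R \<mm> kk (n - 1) + betti R \<mm> kk n + betti R \<mm> kk (n + 1))"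
      using kk[of k] C[of k] unfolding k by (simp add: algebra_simps)
  qed
qed

end

theorem theorem2p7:
  fixes R :: "('a, 'b) ring_scheme" and \<mm> I :: "'a set"
  assumes "noetherian_local_ring R \<mm>"
    and "integrally_closed_ideal R I"
    and "primary_to R \<mm> I"
  shows "has_maximal_complexity R \<mm> (ideal_module R I) \<and>
         has_maximal_curvature R \<mm> (ideal_module R I)"
proof -
  interpret noetherian_local_ring R \<mm> by (rule assms(1))
  let ?I = "betti R \<mm> (ideal_module R I)" and ?k = "betti R \<mm> (residue_module R \<mm>)"
  obtain C where C1: "\<And>n. 2 \<le> n \<Longrightarrow> ?k n \<le> C * (?I (n - 1) + ?I n + ?I (n + 1))"
    and C2: "\<And>n. 2 \<le> n \<Longrightarrow> ?I n \<le> C * (?k (n - 1) + ?k n + ?k (n + 1))"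
    using betti_comparison[OF assms(2,3)] by blast
  \<comment> \<open>Both modules admit the same exponents, so the two infima agree, also when no
    exponent is admissible and both are infinite.\<close>
  have "(\<exists>\<alpha>::real. \<alpha> > 0 \<and> (\<forall>\<^sub>F n in sequentially. real (?I n) \<le> \<alpha> * real n powi (int b - 1))) \<longleftrightarrow>
    (\<exists>\<alpha>::real. \<alpha> > 0 \<and> (\<forall>\<^sub>F n in sequentially. real (?k n) \<le> \<alpha> * real n powi (int b - 1)))" for b
    using polynomial_growth_transfer[OF C1, of _ b] polynomial_growth_transfer[OF C2, of _ b] by blast
  then have "complexity R \<mm> (ideal_module R I) = complexity R \<mm> (residue_module R \<mm>)"
    by (simp add: complexity_def)
  moreover have "curvature R \<mm> (ideal_module R I) = curvature R \<mm> (residue_module R \<mm>)"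
    unfolding curvature_def by (rule antisym[OF limsup_root_le[OF C2] limsup_root_le[OF C1]])
  ultimately show ?thesis by (simp add: has_maximal_complexity_def has_maximal_curvature_def)
qed

end
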